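(* Let $n\ge 1$, let $D$ be an $n$ strand Temperley--Lieb diagram and let $\mu\in\mathtt{Dyck}(n)$ be the Dyck path corresponding to $D$ under the folding bijection. Then the coefficient of $D$ in the Jones--Wenzl projection $P^{(n)}$ equals the Dyck tiling generating function: \[ \mathrm{Coeff}^{(n)}(D)=Z(\mu)=\sum_{\mathcal{T}\in\mathcal{D}(\mu)}\ \prod_{d\in \mathcal{T}}\frac{[h(d)]}{[h(d)+1]}. \]
   Context: Work over $\mathbb{C}(q)$ and set $[m]=(q^{m}-q^{-m})/(q-q^{-1})$. Temperley--Lieb algebra. $\mathcal{TL}^A_n$ is the unital associative $\mathbb{C}(q)$-algebra generated by $e_1,\dots,e_{n-1}$ with relations $e_i^2=-[2]e_i$, $e_ie_{i+1}e_i=e_i$, $e_{i+1}e_ie_{i+1}=e_{i+1}$, and $e_ie_j=e_je_i$ for $|i-j|>1$. Diagrams. An $n$ strand Temperley--Lieb diagram consists of $n$ marked points on the top edge and $n$ marked points on the bottom edge of a rectangle, joined in pairs by $n$ non-crossing arcs; isotopic diagrams are identified. The generator $e_i$ is the diagram with a cap joining top points $i,i+1$, a cup joining bottom points $i,i+1$, and vertical strands elsewhere. The product $D_1D_2$ is obtained by placing $D_1$ on top of $D_2$ and removing each closed loop at the cost of a factor $-[2]$. These diagrams form a basis of $\mathcal{TL}^A_n$. Jones--Wenzl projection. $P^{(n)}\in\mathcal{TL}^A_n$ is the unique element with $P^{(n)}\ne 0$, $P^{(n)}P^{(n)}=P^{(n)}$, and $e_iP^{(n)}=P^{(n)}e_i=0$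 for all $1\le i\le n-1$. For a diagram $h$, $\mathrm{Coeff}^{(n)}(h)$ denotes the coefficient of $h$ when $P^{(n)}$ is expanded in the diagram basis. Folding bijection. Label the bottom points $b_1,\dots,b_n$ and the top points $t_1,\dots,t_n$, each from left to right. List the $2n$ points in the order $b_1,\dots,b_n,t_n,\dots,t_1$ on a line; the arcs of $D$ become a non-crossing perfect matching of these $2n$ points. The associated word has $k$-th letter $U$ if the $k$-th point is the left endpoint of its arc, and $R$ otherwise. This word is the Dyck path $\mu$. Dyck paths. A Dyck path of size $n$ is a lattice path from $(0,0)$ to $(2n,0)$ with steps $U=(1,1)$ and $R=(1,-1)$ that never goes below $y=0$. $\mathtt{Dyck}(n)$ denotes the set of such paths. The top path is $\mu_{\mathrm{top}}(n)=U^nR^n$. Unit boxes and tiles. A unit box with center $(a,b)$, where $a,b$ are integers, is the square with vertices $(a\pm1,b)$ and $(a,b\pm1)$. $R(\mu)$ is the region between $\mu$ and $U^nR^n$; it is a union of unit boxes. A Dyck tile of size $m\ge 0$ is a set of $2m+1$ unit boxes whose centers $c_0,\dots,c_{2m}$ satisfy $c_{k+1}-c_k\in\{(1,1),(1,-1)\}$ and form a Dyck path, i.e. no center is below $c_0$ and $c_{2m}$ has the same height as $c_0$. A size-$0$ tile is a single box. Dyck tilings. A Dyck tiling of $R(\mu)$ is a partition of the unit boxes of $R(\mu)$ into Dyck tiles. It is cover-inclusive if, for every tile $d$, the translate of $d$ by $(0,-2)$ either lies strictly below $\mu$ or is contained in a single tile of the tiling. $\mathcal{D}(\mu)$ denotes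 the set of cover-inclusive Dyck tilings of $R(\mu)$. Height. For a tile $d$, $h(d)$ is the minimum of the $y$-coordinates of the centers of its boxes. *)

theory Defs
  imports
    "HOL-Library.Disjoint_Sets"
    "HOL-Library.Poly_Mapping"
    "HOL-Computational_Algebra.Polynomial"
    "HOL-Computational_Algebra.Fraction_Field"
    "HOL-Algebra.QuotRing"
begin

section \<open>The field of rational functions and quantum integers\<close>

type_synonym cq = "complex poly fract"

definition qvar :: cq where
  "qvar = Fract [:0, 1:] 1"

definition qint :: "int \<Rightarrow> cq" where
  "qint m = (qvar powi m - qvar powi (- m)) / (qvar - inverse qvar)"


section \<open>The Temperley--Lieb algebra by generators and relations\<close>

text \<open>Words in the generator indices. As an additive monoid under concatenation they make
  the convolution product of \<^typ>\<open>'a \<Rightarrow>\<^sub>0 'b\<close> the product of noncommutative polynomials.\<close>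

datatype gen_word = Word (letters: "nat list")

instantiation gen_word :: monoid_add
begin

definition zero_gen_word :: gen_word where
  "0 = Word []"

definition plus_gen_word :: "gen_word \<Rightarrow> gen_word \<Rightarrow> gen_word" where
  "v + w = Word (letters v @ letters w)"

instance
  by standard (simp_all add: zero_gen_word_def plus_gen_word_def)

end

definition free_algebra :: "nat \<Rightarrow> (gen_word \<Rightarrow>\<^sub>0 cq) ring" where
  "free_algebra n =
     \<lparr>carrier = {x. \<forall>w\<in>Poly_Mapping.keys x. set (letters w) \<subseteq> {1..<n}},
      mult = (*), one = 1, zero = 0, add = (+)\<rparr>"

definition free_gen :: "nat \<Rightarrow> (gen_word \<Rightarrow>\<^sub>0 cq)" where
  "free_gen i = Poly_Mapping.single (Word [i]) 1"

definition free_scalar :: "cq \<Rightarrow> (gen_word \<Rightarrow>\<^sub>0 cq)" where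
  "free_scalar c = Poly_Mapping.single (Word []) c"

definition tl_relators :: "nat \<Rightarrow> (gen_word \<Rightarrow>\<^sub>0 cq) set" where
  "tl_relators n =
     {free_gen i * free_gen i - free_scalar (- qint 2) * free_gen i | i. i \<in> {1..<n}}
   \<union> {free_gen i * free_gen (i + 1) * free_gen i - free_gen i | i.
        i \<in> {1..<n} \<and> i + 1 \<in> {1..<n}}
   \<union> {free_gen (i + 1) * free_gen i * free_gen (i + 1) - free_gen (i + 1) | i.
        i \<in> {1..<n} \<and> i + 1 \<in> {1..<n}}
   \<union> {free_gen i * free_gen j - free_gen j * free_gen i | i j.
        i \<in> {1..<n} \<and> j \<in> {1..<n} \<and> \<bar>int i - int j\<bar> > 1}"

text \<open>Since the free algebra contains the scalars, the two-sided ring ideal generated by the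
  relators is also the two-sided algebra ideal.\<close>

definition tl_ideal :: "nat \<Rightarrow> (gen_word \<Rightarrow>\<^sub>0 cq) set" where
  "tl_ideal n = genideal (free_algebra n) (tl_relators n)"

definition tl_algebra :: "nat \<Rightarrow> (gen_word \<Rightarrow>\<^sub>0 cq) set ring" where
  "tl_algebra n = free_algebra n Quot tl_ideal n"

definition tl_gen :: "nat \<Rightarrow> nat \<Rightarrow> (gen_word \<Rightarrow>\<^sub>0 cq) set" where
  "tl_gen n i = tl_ideal n +>\<^bsub>free_algebra n\<^esub> free_gen i"

definition is_jones_wenzl :: "nat \<Rightarrow> (gen_word \<Rightarrow>\<^sub>0 cq) set \<Rightarrow> bool" where
  "is_jones_wenzl n P \<longleftrightarrow>
     P \<in> carrier (tl_algebra n) \<and>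
     P \<noteq> \<zero>\<^bsub>tl_algebra n\<^esub> \<and>
     P \<otimes>\<^bsub>tl_algebra n\<^esub> P = P \<and>
     (\<forall>i\<in>{1..<n}. tl_gen n i \<otimes>\<^bsub>tl_algebra n\<^esub> P = \<zero>\<^bsub>tl_algebra n\<^esub> \<and>
                  P \<otimes>\<^bsub>tl_algebra n\<^esub> tl_gen n i = \<zero>\<^bsub>tl_algebra n\<^esub>)"

definition jones_wenzl :: "nat \<Rightarrow> (gen_word \<Rightarrow>\<^sub>0 cq) set" where
  "jones_wenzl n = (THE P. is_jones_wenzl n P)"


section \<open>Temperley--Lieb diagrams\<close>

datatype pt = Top nat | Bot nat

definition points :: "nat \<Rightarrow> pt set" where
  "points n = Top ` {1..n} \<union> Bot ` {1..n}"

text \<open>The position of a marked point in the list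
  \<open>b\<^sub>1, \<dots>, b\<^sub>n, t\<^sub>n, \<dots>, t\<^sub>1\<close>, which is also its cyclic position on the boundary of the
  rectangle.\<close>

fun pos :: "nat \<Rightarrow> pt \<Rightarrow> nat" where
  "pos n (Bot i) = i"
| "pos n (Top i) = 2 * n + 1 - i"

text \<open>An isotopy class of diagrams is determined by the set of pairs of points joined by an arc.\<close>

type_synonym diagram = "pt set set"

definition noncrossing :: "nat \<Rightarrow> diagram \<Rightarrow> bool" where
  "noncrossing n D \<longleftrightarrow>
     (\<nexists>a b c d. {a, b} \<in> D \<and> {c, d} \<in> D \<and>
        pos n a < pos n c \<and> pos n c < pos n b \<and> pos n b < pos n d)"

definition tl_diagrams :: "nat \<Rightarrow> diagram set" where
  "tl_diagrams n =
     {D. partition_on (points n) D \<and> (\<forall>A\<in>D. card A = 2) \<and> noncrossing n D}"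

definition id_diagram :: "nat \<Rightarrow> diagram" where
  "id_diagram n = {{Top j, Bot j} | j. j \<in> {1..n}}"

definition gen_diagram :: "nat \<Rightarrow> nat \<Rightarrow> diagram" where
  "gen_diagram n i =
     {{Top i, Top (i + 1)}, {Bot i, Bot (i + 1)}}
   \<union> {{Top j, Bot j} | j. j \<in> {1..n} - {i, i + 1}}"

text \<open>Stacking \<open>D1\<close> on top of \<open>D2\<close>: the points \<open>GMid i\<close> arise by gluing the bottom points of \<open>D1\<close>
  to the top points of \<open>D2\<close>. Two outer points are joined in the stack iff they lie in the same
  component of the glued graph; the closed loops are the components consisting of glued points
  only.\<close>

datatype glued_pt = GTop nat | GMid nat | GBot nat

fun upper :: "pt \<Rightarrow> glued_pt" where
  "upper (Top i) = GTop i"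
| "upper (Bot i) = GMid i"

fun lower :: "pt \<Rightarrow> glued_pt" where
  "lower (Top i) = GMid i"
| "lower (Bot i) = GBot i"

fun outer :: "pt \<Rightarrow> glued_pt" where
  "outer (Top i) = GTop i"
| "outer (Bot i) = GBot i"

definition glued_arcs :: "diagram \<Rightarrow> diagram \<Rightarrow> (glued_pt \<times> glued_pt) set" where
  "glued_arcs D1 D2 = {(x, y). {x, y} \<in> image upper ` D1 \<union> image lower ` D2}"

definition stack :: "diagram \<Rightarrow> diagram \<Rightarrow> diagram" where
  "stack D1 D2 = {{a, b} | a b. a \<noteq> b \<and> (outer a, outer b) \<in> (glued_arcs D1 D2)\<^sup>*}"

definition loops :: "nat \<Rightarrow> diagram \<Rightarrow> diagram \<Rightarrow> nat" where
  "loops n D1 D2 =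
     card {C. \<exists>i\<in>{1..n}. C = (glued_arcs D1 D2)\<^sup>* `` {GMid i} \<and> C \<subseteq> range GMid}"

text \<open>Linear combinations of diagrams, as coefficient functions, with the bilinear extension of
  the stacking product.\<close>

definition basis_diagram :: "diagram \<Rightarrow> diagram \<Rightarrow> cq" where
  "basis_diagram D = (\<lambda>D'. if D' = D then 1 else 0)"

definition diagram_algebra :: "nat \<Rightarrow> (diagram \<Rightarrow> cq) ring" where
  "diagram_algebra n =
     \<lparr>carrier = {f. \<forall>D. D \<notin> tl_diagrams n \<longrightarrow> f D = 0},
      mult = (\<lambda>f g D. \<Sum>(D1, D2) | D1 \<in> tl_diagrams n \<and> D2 \<in> tl_diagrams n \<and> stack D1 D2 = D.
                f D1 * g D2 * (- qint 2) ^ loops n D1 D2),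
      one = basis_diagram (id_diagram n),
      zero = (\<lambda>D. 0),
      add = (\<lambda>f g D. f D + g D)\<rparr>"

text \<open>The homomorphism from the free algebra that sends each generator to its diagram and the
  isomorphism it induces on the Temperley--Lieb algebra. The latter expands an element of the
  Temperley--Lieb algebra in the diagram basis.\<close>

definition word_diagram :: "nat \<Rightarrow> nat list \<Rightarrow> diagram \<Rightarrow> cq" where
  "word_diagram n ws =
     foldr (\<lambda>i f. basis_diagram (gen_diagram n i) \<otimes>\<^bsub>diagram_algebra n\<^esub> f) ws
       \<one>\<^bsub>diagram_algebra n\<^esub>"

definition free_expansion :: "nat \<Rightarrow> (gen_word \<Rightarrow>\<^sub>0 cq) \<Rightarrow> diagram \<Rightarrow> cq" where
  "free_expansion n x D =
     (\<Sum>w\<in>Poly_Mapping.keys x. Poly_Mapping.lookup x w * word_diagram n (letters w) D)"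

definition diagram_expansion :: "nat \<Rightarrow> (gen_word \<Rightarrow>\<^sub>0 cq) set \<Rightarrow> diagram \<Rightarrow> cq" where
  "diagram_expansion n X = the_elem (free_expansion n ` X)"

definition jw_coeff :: "nat \<Rightarrow> diagram \<Rightarrow> cq" where
  "jw_coeff n D = diagram_expansion n (jones_wenzl n) D"


section \<open>Dyck paths and the folding bijection\<close>

datatype step = Up | Down

fun step_height :: "step \<Rightarrow> int" where
  "step_height Up = 1"
| "step_height Down = -1"

definition height :: "step list \<Rightarrow> nat \<Rightarrow> int" where
  "height \<mu> k = (\<Sum>s\<leftarrow>take k \<mu>. step_height s)"

definition dyck_paths :: "nat \<Rightarrow> step list set" where
  "dyck_paths n =
     {\<mu>. length \<mu> = 2 * n \<and> (\<forall>k\<le>2 * n. 0 \<le> height \<mu> k) \<and> height \<mu> (2 * n) = 0}"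

definition top_path :: "nat \<Rightarrow> step list" where
  "top_path n = replicate n Up @ replicate n Down"

definition folded_path :: "nat \<Rightarrow> diagram \<Rightarrow> step list" where
  "folded_path n D =
     map (\<lambda>k. if \<exists>a b. {a, b} \<in> D \<and> pos n a = k \<and> k < pos n b then Up else Down)
       [1..<2 * n + 1]"


lemma length_folded_path: "length (folded_path n D) = 2 * n"
  by (simp add: folded_path_def)

lemma height_folded_path:
  assumes "k \<le> 2 * n"
  shows "height (folded_path n D) k =
    int (card {j\<in>{1..k}. folded_path n D ! (j - 1) = Up}) -
    int (card {j\<in>{1..k}. folded_path n D ! (j - 1) = Down})"
  using assms
proof (induction k)
  case 0
  then show ?case by (simp add: height_def)
next
  case (Suc k)
  let ?w = "folded_path n D"
  have len: "length ?w = 2 * n" by (simp add: folded_path_def)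
  have h: "height ?w (Suc k) = height ?w k + step_height (?w ! k)"
    using Suc.prems len by (simp add: height_def take_Suc_conv_app_nth)
  have s: "{j\<in>{1..Suc k}. ?w ! (j - 1) = x} =
      (if ?w ! k = x then insert (Suc k) {j\<in>{1..k}. ?w ! (j - 1) = x}
       else {j\<in>{1..k}. ?w ! (j - 1) = x})" for x
    by (auto simp: le_Suc_eq)
  show ?case
    unfolding h s using Suc by (cases "?w ! k") simp_all
qed

lemma folded_path_in_dyck_paths:
  assumes D: "D \<in> tl_diagrams n"
  shows "folded_path n D \<in> dyck_paths n"
proof -
  let ?w = "folded_path n D"
  have part: "partition_on (points n) D" and c2: "\<And>A. A \<in> D \<Longrightarrow> card A = 2"
    using D by (auto simp: tl_diagrams_def)
  have un: "\<Union>D = points n" and dj: "disjoint D"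
    using part by (auto simp: partition_on_def)
  have inj: "a = b" if "a \<in> points n" "b \<in> points n" "pos n a = pos n b" for a b
    using that by (auto simp: points_def)
  have up: "?w ! (j - 1) = Up \<longleftrightarrow> (\<exists>a b. {a, b} \<in> D \<and> pos n a = j \<and> j < pos n b)"
    if "j \<in> {1..2 * n}" for j
  proof -
    have "[1..<2 * n + 1] ! (j - 1) = j" using that by (subst nth_upt) auto
    moreover have "j - 1 < length [1..<2 * n + 1]" using that by auto
    ultimately show ?thesis unfolding folded_path_def by (subst nth_map) auto
  qed
  have arcD: "a \<in> points n \<and> b \<in> points n \<and> pos n a \<noteq> pos n b" if "{a, b} \<in> D" for a b
  proof -
    have "a \<in> points n" "b \<in> points n" using un that by auto
    moreover have "a \<noteq> b" using c2[OF that] by auto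
    ultimately show ?thesis using inj by blast
  qed
  have uniq: "b = b'" if "{a, b} \<in> D" "{a, b'} \<in> D" for a b b'
  proof -
    have "{a, b} = {a, b'}" using disjointD[OF dj that] by blast
    then show ?thesis by (auto simp: doubleton_eq_iff)
  qed
  have ex: "\<exists>a b. {a, b} \<in> D \<and> pos n a = j" if j: "j \<in> {1..2 * n}" for j
  proof -
    define a where "a = (if j \<le> n then Bot j else Top (2 * n + 1 - j))"
    have a: "a \<in> points n" "pos n a = j"
      using j by (auto simp: a_def points_def image_iff Bex_def)
    then obtain A where A: "A \<in> D" "a \<in> A" using un by blast
    then obtain x y where "A = {x, y}" using c2 by (meson card_2_iff)
    then have "A = {a, x} \<or> A = {a, y}" using A by auto
    then show ?thesis using A a by blast
  qed
  have "\<forall>j\<in>{1..2 * n}. \<exists>i. \<exists>a b. {a, b} \<in> D \<and> pos n a = j \<and> pos n b = i"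
    using ex by blast
  from bchoice[OF this] obtain p
    where p: "\<And>j. j \<in> {1..2 * n} \<Longrightarrow> \<exists>a b. {a, b} \<in> D \<and> pos n a = j \<and> pos n b = p j"
    by blast
  have p_eq: "p (pos n a) = pos n b" if ab: "{a, b} \<in> D" and pa: "pos n a \<in> {1..2 * n}" for a b
  proof -
    obtain a' b' where ab': "{a', b'} \<in> D" "pos n a' = pos n a" "pos n b' = p (pos n a)"
      using p[OF pa] by blast
    then have "a' = a" using inj arcD ab by blast
    then show ?thesis using uniq[of a b' b] ab' ab by simp
  qed
  have rng: "pos n a \<in> {1..2 * n}" if "a \<in> points n" for a
    using that by (auto simp: points_def)
  have pr: "p j \<in> {1..2 * n} \<and> p j \<noteq> j \<and> p (p j) = j" if j: "j \<in> {1..2 * n}" for j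
  proof -
    obtain a b where ab: "{a, b} \<in> D" "pos n a = j" "pos n b = p j" using p[OF j] by blast
    have ba: "{b, a} \<in> D" using ab(1) by (simp add: insert_commute)
    have "p (pos n b) = pos n a" using p_eq[OF ba] arcD[OF ba] rng by blast
    then show ?thesis using ab arcD[OF ba] rng[of b] by auto
  qed
  have up': "?w ! (j - 1) = Up \<longleftrightarrow> j < p j" if j: "j \<in> {1..2 * n}" for j
    unfolding up[OF j] using p_eq p[OF j] j by metis
  have down': "?w ! (j - 1) = Down \<longleftrightarrow> p j < j" if j: "j \<in> {1..2 * n}" for j
    using up'[OF j] pr[OF j] by (cases "?w ! (j - 1)") auto
  let ?U = "\<lambda>k. {j\<in>{1..k}. ?w ! (j - 1) = Up}" and ?D = "\<lambda>k. {j\<in>{1..k}. ?w ! (j - 1) = Down}"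
  have U: "?U k = {j\<in>{1..k}. j < p j}" and Dn: "?D k = {j\<in>{1..k}. p j < j}"
    if "k \<le> 2 * n" for k
    using that up' down' by auto
  have injp: "inj_on p {1..2 * n}"
    by (metis inj_onI pr)
  have le: "card (?D k) \<le> card (?U k)" if k: "k \<le> 2 * n" for k
    unfolding U[OF k] Dn[OF k]
  proof (rule card_inj_on_le)
    show "inj_on p {j \<in> {1..k}. p j < j}"
      by (rule inj_on_subset[OF injp]) (use k in auto)
    show "p ` {j \<in> {1..k}. p j < j} \<subseteq> {j \<in> {1..k}. j < p j}"
      using k pr by fastforce
  qed simp
  have ge: "card (?U (2 * n)) \<le> card (?D (2 * n))"
    unfolding U[OF order_refl] Dn[OF order_refl]
  proof (rule card_inj_on_le)
    show "inj_on p {j \<in> {1..2 * n}. j < p j}"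
      by (rule inj_on_subset[OF injp]) auto
    show "p ` {j \<in> {1..2 * n}. j < p j} \<subseteq> {j \<in> {1..2 * n}. p j < j}"
      using pr by fastforce
  qed simp
  show ?thesis
    unfolding dyck_paths_def mem_Collect_eq
    using le ge length_folded_path[of n D]
    by (auto simp: height_folded_path simp del: One_nat_def intro!: le_antisym)
qed


section \<open>Cover-inclusive Dyck tilings\<close>

text \<open>A unit box is represented by its center \<open>(a, b)\<close>.\<close>

type_synonym box = "int \<times> int"

fun box_vertices :: "box \<Rightarrow> (int \<times> int) set" where
  "box_vertices (a, b) = {(a - 1, b), (a + 1, b), (a, b - 1), (a, b + 1)}"

text \<open>The vertices of the boxes that make up the region between two Dyck paths are points
  \<open>(x, y)\<close> with \<open>x + y\<close> even, like the vertices of the paths; hence \<open>a + b\<close> is odd. As the paths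
  are linear between consecutive integers, such a box lies between them iff its vertices do.\<close>

definition region_boxes :: "step list \<Rightarrow> box set" where
  "region_boxes \<mu> =
     {(a, b). odd (a + b) \<and>
        (\<forall>(x, y)\<in>box_vertices (a, b).
           0 \<le> x \<and> x \<le> int (length \<mu>) \<and>
           height \<mu> (nat x) \<le> y \<and> y \<le> height (top_path (length \<mu> div 2)) (nat x))}"

definition dyck_tile :: "box set \<Rightarrow> bool" where
  "dyck_tile d \<longleftrightarrow>
     (\<exists>(m::nat) (c :: nat \<Rightarrow> box). d = c ` {0..2 * m} \<and>
        (\<forall>k<2 * m. c (k + 1) \<in> {(fst (c k) + 1, snd (c k) + 1), (fst (c k) + 1, snd (c k) - 1)}) \<and>
        (\<forall>k\<le>2 * m. snd (c 0) \<le> snd (c k)) \<and>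
        snd (c (2 * m)) = snd (c 0))"

definition dyck_tiling :: "step list \<Rightarrow> box set set \<Rightarrow> bool" where
  "dyck_tiling \<mu> TT \<longleftrightarrow> partition_on (region_boxes \<mu>) TT \<and> (\<forall>d\<in>TT. dyck_tile d)"

definition shift_down :: "box set \<Rightarrow> box set" where
  "shift_down d = (\<lambda>(a, b). (a, b - 2)) ` d"

text \<open>The box directly below a lowest box of the region has its top vertex on the path, so
  ``strictly below'' refers to the centers of the boxes (equivalently, their interiors).\<close>

definition below_path :: "step list \<Rightarrow> box set \<Rightarrow> bool" where
  "below_path \<mu> d \<longleftrightarrow> (\<forall>(a, b)\<in>d. b < height \<mu> (nat a))"

definition cover_inclusive_tilings :: "step list \<Rightarrow> box set set set" where
  "cover_inclusive_tilings \<mu> =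
     {TT. dyck_tiling \<mu> TT \<and>
        (\<forall>d\<in>TT. below_path \<mu> (shift_down d) \<or> (\<exists>d'\<in>TT. shift_down d \<subseteq> d'))}"

definition tile_height :: "box set \<Rightarrow> int" where
  "tile_height d = Min (snd ` d)"

end

theory Submission
  imports Defs
begin

text \<open>A diagram is encoded as a noncrossing matching of the positions \<open>1, \<dots>, 2n\<close> of the folded line;
  stacking \<open>e\<^sub>i\<close> on top of it joins the partners of \<open>p = 2n - i\<close> and \<open>p + 1\<close>.

  A cover-inclusive tiling of \<open>R(\<mu>)\<close> is determined by the numbers of tiles that cross the steps of
  \<open>\<mu>\<close>. Adding the height of the step to twice this number gives a labelling \<open>f\<close> of the arcs that
  strictly increases inwards, has a prescribed parity, and satisfies \<open>f(k) \<le> min(k, 2n + 1 - k)\<close> at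
  both ends of an arc. A tile has the weight of its leftmost box, so the weights telescope along every
  column and \<open>Z(\<mu>) = c\<^sub>n \<Sum>\<^sub>f \<Prod> [f(arc)]\<close>.

  Write \<open>[2][u] = [u + 1] + [u - 1]\<close> for the label \<open>u\<close> of an arc \<open>(p, p + 1)\<close> with \<open>p > n\<close>. Reconnecting
  this arc with the arc at the nearest position to the left whose label is at most \<open>u + 1\<close>, or to the
  right whose label is at most \<open>u - 1\<close>, is a bijection onto the labellings of the other diagrams that
  \<open>e\<^sub>i\<close> sends to the given one. Hence \<open>\<Sum> Z(\<mu>\<^sub>D) D\<close> is killed by every \<open>e\<^sub>i\<close>. The projection built by
  Wenzl's recursion has the form \<open>1 + \<dots>\<close>, so it fixes this sum; it kills every diagram other than the
  identity, since such a diagram has a cap \<open>e\<^sub>i\<close> on top. As \<open>Z\<close> of the top path is \<open>1\<close>, the sum is the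
  projection.\<close>


section \<open>Noncrossing matchings and their labellings\<close>

text \<open>The weight of a tiling does not factor over the arcs of the diagram, whereas a generator
  acts by reconnecting arcs. The labels remove this obstacle. In column \<open>k\<close> the boxes
  that are leftmost in their tile are exactly those of height at least \<open>f k\<close>. The two
  columns at the ends of an arc with label \<open>a\<close> carry heights of opposite parity, so the
  heights below \<open>a\<close> that they lack contribute together
  \<open>[1]/[2] * ... * [a-1]/[a] = 1/[a]\<close>. What is left is the weight of all boxes below
  the top path, the constant \<open>c_n\<close>.

  The asymmetry between \<open>u + 1\<close> on the left and \<open>u - 1\<close> on the right comes
  from the bound \<open>f(k) + k \<le> 2n + 1\<close>. In the extreme case \<open>u = 2n - p\<close>
  an arc from \<open>p + 1\<close> to the right has room only for the label \<open>u - 1\<close>,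
  while an arc from \<open>p\<close> to the left can still take \<open>u + 1\<close>; that this also
  fits under \<open>f(k) \<le> k\<close> is where \<open>p > n\<close> enters. For
  \<open>u = 1\<close> no label is at most \<open>u - 1\<close>, in accordance with
  \<open>[0] = 0\<close>.

  Any combination killed by all generators from the left is a multiple of the projection, so only
  stacking on top is ever computed.\<close>

definition nc_matching :: "nat \<Rightarrow> (nat \<Rightarrow> nat) \<Rightarrow> bool" where
  "nc_matching n \<sigma> \<longleftrightarrow>
     (\<forall>k\<in>{1..2 * n}. \<sigma> k \<in> {1..2 * n} \<and> \<sigma> k \<noteq> k \<and> \<sigma> (\<sigma> k) = k) \<and>
     (\<forall>k. k \<notin> {1..2 * n} \<longrightarrow> \<sigma> k = k) \<and>
     (\<forall>a\<in>{1..2 * n}. \<forall>b. a < b \<and> b < \<sigma> a \<longrightarrow> \<sigma> b < \<sigma> a)"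

definition labelling :: "nat \<Rightarrow> (nat \<Rightarrow> nat) \<Rightarrow> (nat \<Rightarrow> nat) \<Rightarrow> bool" where
  "labelling n \<sigma> f \<longleftrightarrow>
     (\<forall>k\<in>{1..2 * n}. f (\<sigma> k) = f k \<and> 1 \<le> f k \<and> f k \<le> k \<and> f k + k \<le> 2 * n + 1 \<and>
        (even (f k + k) \<longleftrightarrow> k < \<sigma> k)) \<and>
     (\<forall>k. k \<notin> {1..2 * n} \<longrightarrow> f k = 0) \<and>
     (\<forall>a\<in>{1..2 * n}. \<forall>b. a < b \<and> b < \<sigma> a \<longrightarrow> f a < f b)"

definition arc_prod :: "nat \<Rightarrow> (nat \<Rightarrow> nat) \<Rightarrow> (nat \<Rightarrow> 'a) \<Rightarrow> 'a::comm_monoid_mult" where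
  "arc_prod n \<sigma> F = (\<Prod>k | k \<in> {1..2 * n} \<and> k < \<sigma> k. F k)"

definition label_sum :: "nat \<Rightarrow> (nat \<Rightarrow> nat) \<Rightarrow> cq" where
  "label_sum n \<sigma> = (\<Sum>f | labelling n \<sigma> f. arc_prod n \<sigma> (\<lambda>k. qint (int (f k))))"

text \<open>With \<open>p = 2 * n - i\<close> this is the matching of \<open>e_i\<close> stacked on
  the diagram of \<sigma>. In the first case a closed loop splits off and the arcs stay as they
  are.\<close>

definition contract :: "nat \<Rightarrow> (nat \<Rightarrow> nat) \<Rightarrow> nat \<Rightarrow> nat" where
  "contract p \<sigma> = (if \<sigma> p = Suc p then \<sigma>
     else \<sigma>(\<sigma> p := \<sigma> (Suc p), \<sigma> (Suc p) := \<sigma> p, p := Suc p, Suc p := p))"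

section \<open>Elementary facts on matchings, labellings and products over arcs\<close>

lemma nc_matchingD:
  assumes "nc_matching n \<sigma>" "k \<in> {1..2 * n}"
  shows "\<sigma> k \<in> {1..2 * n}" "\<sigma> k \<noteq> k" "\<sigma> (\<sigma> k) = k" "1 \<le> \<sigma> k" "\<sigma> k \<le> 2 * n"
  using assms by (auto simp: nc_matching_def)

lemma nc_matching_fix: "nc_matching n \<sigma> \<Longrightarrow> k \<notin> {1..2 * n} \<Longrightarrow> \<sigma> k = k"
  by (auto simp: nc_matching_def)

lemma nc_matching_invol: "nc_matching n \<sigma> \<Longrightarrow> \<sigma> (\<sigma> k) = k"
  by (metis nc_matchingD(3) nc_matching_fix)

text \<open>The definition bounds the mate of an enclosed position only from above. If it lay to the
  left of \<open>a\<close>, the same bound for the arc from \<open>\<sigma> b\<close> to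
  \<open>b\<close>, which then encloses \<open>a\<close>, would give
  \<open>\<sigma> a < b\<close>.\<close>

lemma nc_matching_nested:
  assumes m: "nc_matching n \<sigma>" and "a < b" "b < \<sigma> a"
  shows "a < \<sigma> b" "\<sigma> b < \<sigma> a"
proof -
  have a: "a \<in> {1..2 * n}" using nc_matching_fix[OF m, of a] assms by fastforce
  then have b: "b \<in> {1..2 * n}" using nc_matchingD[OF m a] assms by auto
  show 1: "\<sigma> b < \<sigma> a" using m a assms(2,3) by (auto simp: nc_matching_def)
  have "\<sigma> b \<noteq> a" using assms nc_matching_invol[OF m, of b] by auto
  moreover have "\<not> \<sigma> b < a"
  proof
    assume "\<sigma> b < a"
    then have "\<sigma> a < \<sigma> (\<sigma> b)"
      using m nc_matchingD[OF m b] assms(2) unfolding nc_matching_def by metis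
    then show False using nc_matching_invol[OF m, of b] assms by simp
  qed
  ultimately show "a < \<sigma> b" by simp
qed

lemma labellingD:
  assumes "labelling n \<sigma> f" "k \<in> {1..2 * n}"
  shows "f (\<sigma> k) = f k" "1 \<le> f k" "f k \<le> k" "f k + k \<le> 2 * n + 1"
    "even (f k + k) \<longleftrightarrow> k < \<sigma> k"
  using assms unfolding labelling_def by blast+

lemma labelling_nested:
  "labelling n \<sigma> f \<Longrightarrow> a \<in> {1..2 * n} \<Longrightarrow> a < b \<Longrightarrow> b < \<sigma> a \<Longrightarrow> f a < f b"
  by (auto simp: labelling_def)

lemma labelling_zero: "labelling n \<sigma> f \<Longrightarrow> k \<notin> {1..2 * n} \<Longrightarrow> f k = 0"
  unfolding labelling_def by blast

text \<open>Crossing arcs would give \<open>f a < f b\<close> and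
  \<open>f b < f (\<sigma> a) = f a\<close>. Hence for an involution without fixed points it
  suffices to exhibit labels, and every reconnection below is shown to be noncrossing in this
  way.\<close>

lemma nc_matchingI_labelling:
  assumes lab: "labelling n \<sigma> f"
    and inv: "\<And>k. k \<in> {1..2 * n} \<Longrightarrow> \<sigma> k \<in> {1..2 * n} \<and> \<sigma> k \<noteq> k \<and> \<sigma> (\<sigma> k) = k"
    and out: "\<And>k. k \<notin> {1..2 * n} \<Longrightarrow> \<sigma> k = k"
  shows "nc_matching n \<sigma>"
  unfolding nc_matching_def
proof (intro conjI ballI allI impI)
  fix a b assume a: "a \<in> {1..2 * n}" and ab: "a < b \<and> b < \<sigma> a"
  have b: "b \<in> {1..2 * n}" using a ab inv[OF a] by auto
  have lt: "f a < f b" using labelling_nested[OF lab a] ab by blast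
  show "\<sigma> b < \<sigma> a"
  proof (rule ccontr)
    assume "\<not> \<sigma> b < \<sigma> a"
    moreover have "\<sigma> b \<noteq> \<sigma> a" using inv[OF a] inv[OF b] ab by (metis nat_neq_iff)
    ultimately have "f b < f (\<sigma> a)" using labelling_nested[OF lab b, of "\<sigma> a"] ab by auto
    then show False using lt labellingD(1)[OF lab a] by simp
  qed
qed (use inv out in auto)

lemma finite_nc_matchings: "finite {\<sigma>. nc_matching n \<sigma>}"
proof (rule finite_imageD)
  \<comment> \<open>Matchings are the identity outside \<open>{1..2 * n}\<close>; the value 0 there
    instead makes them functions with a constant default, of which there are finitely many.\<close>
  let ?z = "\<lambda>\<sigma> k. if k \<in> {1..2 * n} then \<sigma> k else 0"
  show "finite (?z ` {\<sigma>. nc_matching n \<sigma>})"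
  proof (rule finite_subset)
    show "?z ` {\<sigma>. nc_matching n \<sigma>} \<subseteq>
        {f. \<forall>x. (x \<in> {1..2 * n} \<longrightarrow> f x \<in> {0..2 * n}) \<and> (x \<notin> {1..2 * n} \<longrightarrow> f x = 0)}"
      using nc_matchingD(5) by fastforce
  qed (intro finite_set_of_finite_funs, auto)
  show "inj_on ?z {\<sigma>. nc_matching n \<sigma>}"
  proof (rule inj_onI, rule ext)
    fix \<sigma> \<tau> k
    assume m: "\<sigma> \<in> {\<sigma>. nc_matching n \<sigma>}" "\<tau> \<in> {\<sigma>. nc_matching n \<sigma>}" and eq: "?z \<sigma> = ?z \<tau>"
    show "\<sigma> k = \<tau> k"
    proof (cases "k \<in> {1..2 * n}")
      case True
      then show ?thesis using fun_cong[OF eq, of k] by simp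
    next
      case False
      then show ?thesis using nc_matching_fix[OF m(1)[unfolded mem_Collect_eq] False]
          nc_matching_fix[OF m(2)[unfolded mem_Collect_eq] False] by metis
    qed
  qed
qed

lemma finite_labellings: "finite {f. labelling n \<sigma> f}"
proof (rule finite_subset)
  show "{f. labelling n \<sigma> f} \<subseteq>
      {f. \<forall>x. (x \<in> {1..2 * n} \<longrightarrow> f x \<in> {0..2 * n}) \<and> (x \<notin> {1..2 * n} \<longrightarrow> f x = 0)}"
    using labellingD(3) labelling_zero by fastforce
qed (intro finite_set_of_finite_funs, auto)

lemma arc_prod_cong:
  "(\<And>k. k \<in> {1..2 * n} \<Longrightarrow> F k = G k) \<Longrightarrow> arc_prod n \<sigma> F = arc_prod n \<sigma> G"
  by (auto simp: arc_prod_def intro: prod.cong)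

lemma arc_prod_split:
  assumes m: "nc_matching n \<sigma>" and a: "a \<in> {1..2 * n}" and c: "c \<in> {1..2 * n}"
    and ne: "c \<noteq> a" "c \<noteq> \<sigma> a" and F: "F (\<sigma> a) = F a" "F (\<sigma> c) = F c"
  shows "arc_prod n \<sigma> F =
    F a * F c * (\<Prod>k | k \<in> {1..2 * n} - {a, \<sigma> a, c, \<sigma> c} \<and> k < \<sigma> k. F k)"
proof -
  let ?C = "{k. k \<in> {1..2 * n} - {a, \<sigma> a, c, \<sigma> c} \<and> k < \<sigma> k}"
  note ma = nc_matchingD[OF m a] and mc = nc_matchingD[OF m c]
  have ne': "min a (\<sigma> a) \<noteq> min c (\<sigma> c)" using ne ma mc by (metis min_def)
  have "{k. k \<in> {1..2 * n} \<and> k < \<sigma> k} = insert (min a (\<sigma> a)) (insert (min c (\<sigma> c)) ?C)"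
    using a c ma mc by (auto simp: min_def)
  moreover have "min a (\<sigma> a) \<notin> insert (min c (\<sigma> c)) ?C" "min c (\<sigma> c) \<notin> ?C"
    using ne' by (auto simp: min_def)
  moreover have "F (min a (\<sigma> a)) = F a" "F (min c (\<sigma> c)) = F c"
    using F by (auto simp: min_def)
  ultimately show ?thesis
    unfolding arc_prod_def by (simp add: mult.assoc)
qed

text \<open>Applied to the gap between the cup and the position where an arc is cut: the matching
  restricts to this gap, so its length is even, and this fixes the parities of the new
  labels.\<close>

lemma even_card_closed:
  fixes \<sigma> :: "nat \<Rightarrow> nat"
  assumes "finite S" and cl: "\<And>k. k \<in> S \<Longrightarrow> \<sigma> k \<in> S \<and> \<sigma> k \<noteq> k \<and> \<sigma> (\<sigma> k) = k"
  shows "even (card S)"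
proof -
  have "bij_betw \<sigma> {k \<in> S. k < \<sigma> k} {k \<in> S. \<sigma> k < k}"
    by (rule bij_betwI[where g = \<sigma>]) (use cl in auto)
  then have "card {k \<in> S. k < \<sigma> k} = card {k \<in> S. \<sigma> k < k}"
    by (rule bij_betw_same_card)
  moreover have "S = {k \<in> S. k < \<sigma> k} \<union> {k \<in> S. \<sigma> k < k}" using cl by force
  moreover have "{k \<in> S. k < \<sigma> k} \<inter> {k \<in> S. \<sigma> k < k} = {}" by auto
  ultimately have "card S = 2 * card {k \<in> S. k < \<sigma> k}"
    using assms(1) by (metis (no_types, lifting) card_Un_disjoint finite_Un mult_2)
  then show ?thesis by simp
qed


text \<open>The inverse of contracting \<open>(a, b)\<close> for adjacent \<open>a\<close>, \<open>b\<close>: the arc of \<open>k\<close> is cut open and its ends are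
  attached to \<open>a\<close> and \<open>b\<close>.\<close>

definition attach :: "nat \<Rightarrow> nat \<Rightarrow> nat \<Rightarrow> (nat \<Rightarrow> nat) \<Rightarrow> nat \<Rightarrow> nat" where
  "attach a b k \<sigma> = \<sigma>(a := k, k := a, b := \<sigma> k, \<sigma> k := b)"

lemma contract_attach:
  assumes inv: "\<And>x. \<sigma> (\<sigma> x) = x" and k: "k \<noteq> p" "k \<noteq> Suc p" and p: "\<sigma> p = Suc p" and fx: "\<sigma> k \<noteq> k"
  shows "contract p (attach p (Suc p) k \<sigma>) = \<sigma>" "contract p (attach (Suc p) p k \<sigma>) = \<sigma>"
proof -
  have n: "\<sigma> k \<noteq> p" "\<sigma> k \<noteq> Suc p" "\<sigma> (Suc p) = p" using inv k p by metis+
  show "contract p (attach p (Suc p) k \<sigma>) = \<sigma>" "contract p (attach (Suc p) p k \<sigma>) = \<sigma>"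
    using n k p fx inv by (auto simp: contract_def attach_def fun_eq_iff)
qed

lemma attach_contract:
  assumes inv: "\<And>x. \<tau> (\<tau> x) = x" and p: "\<tau> p \<noteq> Suc p" and fx: "\<tau> p \<noteq> p" "\<tau> (Suc p) \<noteq> Suc p"
  shows "attach p (Suc p) (\<tau> p) (contract p \<tau>) = \<tau>"
    "attach (Suc p) p (\<tau> (Suc p)) (contract p \<tau>) = \<tau>"
proof -
  have n: "\<tau> p \<noteq> \<tau> (Suc p)" "\<tau> (Suc p) \<noteq> p" using inv p by (metis n_not_Suc_n)+
  show "attach p (Suc p) (\<tau> p) (contract p \<tau>) = \<tau>"
    "attach (Suc p) p (\<tau> (Suc p)) (contract p \<tau>) = \<tau>"
    using n p fx inv by (auto simp: contract_def attach_def fun_eq_iff)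
qed

section \<open>Attaching an arc to the cup and contracting again, with labels\<close>

definition left_pos :: "nat \<Rightarrow> (nat \<Rightarrow> nat) \<Rightarrow> nat" where
  "left_pos p f = Max {k \<in> {1..<p}. f k \<le> Suc (f p)}"

definition right_pos :: "nat \<Rightarrow> nat \<Rightarrow> (nat \<Rightarrow> nat) \<Rightarrow> nat" where
  "right_pos n p f = Min {k \<in> {p + 2..2 * n}. f k \<le> f p - 1}"

lemma left_pos:
  assumes lab: "labelling n \<sigma> f" and p: "n < p" "p < 2 * n"
  shows "1 \<le> left_pos p f" "left_pos p f < p" "f (left_pos p f) \<le> Suc (f p)"
    "\<And>i. left_pos p f < i \<Longrightarrow> i < p \<Longrightarrow> Suc (f p) < f i"
proof -
  let ?S = "{k \<in> {1..<p}. f k \<le> Suc (f p)}"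
  \<comment> \<open>Position 1 has label at most 1 and always qualifies, so the maximum is taken
    over a nonempty set.\<close>
  have "f 1 \<le> 1" using labellingD(3)[OF lab, of 1] p by auto
  then have "1 \<in> ?S" using p by auto
  then have "?S \<noteq> {}" by blast
  then have "Max ?S \<in> ?S" by (intro Max_in) auto
  then show "1 \<le> left_pos p f" "left_pos p f < p" "f (left_pos p f) \<le> Suc (f p)"
    by (auto simp: left_pos_def)
  then show "Suc (f p) < f i" if "left_pos p f < i" "i < p" for i
    using that Max_ge[of ?S i] unfolding left_pos_def by fastforce
qed

text \<open>With \<open>2 \<le> f p\<close> the last position \<open>2 * n\<close>, whose label is
  at most 1, qualifies. For \<open>f p = 1\<close> there is no such position, and the corresponding
  term of the peak relation carries the factor \<open>[0]\<close>.\<close>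

lemma right_pos:
  assumes lab: "labelling n \<sigma> f" and p: "n < p" "p < 2 * n" and \<sigma>: "\<sigma> p = Suc p" and f: "2 \<le> f p"
  shows "Suc p < right_pos n p f" "right_pos n p f \<le> 2 * n" "f (right_pos n p f) \<le> f p - 1"
    "\<And>i. Suc p < i \<Longrightarrow> i < right_pos n p f \<Longrightarrow> f p - 1 < f i"
proof -
  let ?S = "{k \<in> {p + 2..2 * n}. f k \<le> f p - 1}"
  have "f (2 * n) \<le> 1" using labellingD(4)[OF lab, of "2 * n"] p by auto
  moreover have "2 * n \<noteq> Suc p"
    using labellingD(4)[OF lab, of "Suc p"] labellingD(1)[OF lab, of p] p \<sigma> f by auto
  ultimately have "2 * n \<in> ?S" using p f by auto
  then have "?S \<noteq> {}" by blast
  then have "Min ?S \<in> ?S" by (intro Min_in) auto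
  then show "Suc p < right_pos n p f" and r: "right_pos n p f \<le> 2 * n" and "f (right_pos n p f) \<le> f p - 1"
    by (auto simp: right_pos_def)
  then show "f p - 1 < f i" if "Suc p < i" "i < right_pos n p f" for i
    using that Min_le[of ?S i] unfolding right_pos_def by fastforce
qed

text \<open>The end at \<open>k\<close> is attached to \<open>p\<close> with the raised label, the
  other end of the cut arc to \<open>Suc p\<close> with its old label. The new arc from
  \<open>k\<close> to \<open>p\<close> may enclose everything in between because \<open>k\<close> is
  the nearest position with a label at most \<open>Suc (f p)\<close>. The strict inequality at the
  end separates these labellings from those obtained on the right.\<close>

lemma labelling_attach_left:
  assumes m: "nc_matching n \<sigma>" and lab: "labelling n \<sigma> f" and p: "n < p" "p < 2 * n" and \<sigma>p: "\<sigma> p = Suc p"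
  defines "k \<equiv> left_pos p f"
  defines "\<tau> \<equiv> attach p (Suc p) k \<sigma>" and "g \<equiv> f(p := Suc (f p), k := Suc (f p), Suc p := f k)"
  shows "labelling n \<tau> g" "nc_matching n \<tau>" "f k < Suc (f p)"
proof -
  note k = left_pos[OF lab p, folded k_def]
  note inv = nc_matching_invol[OF m]
  have pin: "p \<in> {1..2 * n}" "Suc p \<in> {1..2 * n}" and kin: "k \<in> {1..2 * n}" using p k by auto
  have \<sigma>Sp: "\<sigma> (Suc p) = p" using \<sigma>p inv by metis
  have oth: "\<And>i. i \<noteq> Suc p \<Longrightarrow> \<sigma> i \<noteq> p" "\<And>i. i \<noteq> p \<Longrightarrow> \<sigma> i \<noteq> Suc p"
    using inv \<sigma>p \<sigma>Sp by metis+
  have fSp: "f (Suc p) = f p" using labellingD(1)[OF lab pin(1)] \<sigma>p by simp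
  define k' where "k' = \<sigma> k"
  have k'in: "k' \<in> {1..2 * n}" and k'k: "k' \<noteq> k" and \<sigma>k': "\<sigma> k' = k"
    using nc_matchingD[OF m kin] by (auto simp: k'_def)
  have fk': "f k' = f k" using labellingD(1)[OF lab kin] by (simp add: k'_def)
  have k'p: "k' \<noteq> p" "k' \<noteq> Suc p" using \<sigma>k' \<sigma>p \<sigma>Sp k by auto
  \<comment> \<open>A mate strictly between \<open>k\<close> and \<open>p\<close> would have the
    same small label as \<open>k\<close> and would have been chosen instead.\<close>
  have k'cases: "k' < k \<or> Suc p < k'"
  proof (rule ccontr)
    assume "\<not> ?thesis"
    then have "k < k'" "k' < p" using k'k k'p by auto
    then show False using k(4)[of k'] fk' k(3) by simp
  qed
  have closed: "k < \<sigma> i \<and> \<sigma> i < p" if i: "k < i" "i < p" "k' < k" for i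
  proof -
    have iin: "i \<in> {1..2 * n}" using i k p by auto
    have fi: "Suc (f p) < f i" using k(4) i by blast
    have "\<sigma> i \<noteq> k"
    proof
      assume "\<sigma> i = k"
      then have "i = k'" using inv[of i] by (simp add: k'_def)
      then show False using i by simp
    qed
    moreover have "\<sigma> i \<noteq> p" "\<sigma> i \<noteq> Suc p"
      by (rule oth; use i in simp)+
    moreover have "\<not> Suc p < \<sigma> i"
      using labelling_nested[OF lab iin, of p] i fi by auto
    moreover have "\<not> \<sigma> i < k"
    proof
      assume "\<sigma> i < k"
      then have "f (\<sigma> i) < f k"
        using labelling_nested[OF lab, of "\<sigma> i" k] nc_matchingD[OF m iin] i by auto
      then show False using labellingD(1)[OF lab iin] fi k(3) by simp
    qed
    ultimately show ?thesis by linarith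
  qed
  have parity: "odd (p - k)" if "k' < k"
  proof -
    have "even (card {k<..<p})"
      by (rule even_card_closed[where \<sigma> = \<sigma>])
        (use closed that nc_matchingD[OF m] k p in auto)
    then show ?thesis using k(2) by auto
  qed
  have pu: "even (f p + p)" using labellingD(5)[OF lab pin(1)] \<sigma>p by simp
  have kpar: "even (f k + k) \<longleftrightarrow> k < k'" using labellingD(5)[OF lab kin] by (simp add: k'_def)
  \<comment> \<open>If \<open>k\<close> is a right end, equality is excluded by parity; otherwise
    its arc encloses the cup and its label is even below \<open>f p\<close>.\<close>
  show l: "f k < Suc (f p)"
  proof (cases "k' < k")
    case True
    then have "odd (f k + k)" using kpar by auto
    then have "f k \<noteq> Suc (f p)" using parity[OF True] pu k(2) by (auto simp: even_diff_nat)
    then show ?thesis using k(3) by simp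
  next
    case False
    then have "f k < f p" using labelling_nested[OF lab kin, of p] k'cases k by (auto simp: k'_def)
    then show ?thesis by simp
  qed
  have kp: "odd (p - k)"
  proof (cases "k' < k")
    case False
    then have "Suc p < k'" using k'cases by blast
    have cl: "k < \<sigma> i \<and> \<sigma> i < p" if i: "k < i" "i < p" for i
    proof -
      have iin: "i \<in> {1..2 * n}" using i k p by auto
      have "\<sigma> i \<noteq> p" "\<sigma> i \<noteq> Suc p"
        by (rule oth; use i in simp)+
      moreover have "k < \<sigma> i" 
        using nc_matching_nested[OF m, of k i] i \<open>Suc p < k'\<close> by (auto simp: k'_def)
      moreover have "\<not> Suc p < \<sigma> i"
        using labelling_nested[OF lab iin, of p] i k(4)[OF i] by auto
      ultimately show ?thesis by linarith
    qed
    have "even (card {k<..<p})"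
      by (rule even_card_closed[where \<sigma> = \<sigma>])
        (use cl nc_matchingD[OF m] k p in auto)
    then show ?thesis using k(2) by auto
  qed (use parity in auto)
  have \<tau>: "\<tau> p = k" "\<tau> k = p" "\<tau> (Suc p) = k'" "\<tau> k' = Suc p"
    "\<And>x. x \<notin> {p, Suc p, k, k'} \<Longrightarrow> \<tau> x = \<sigma> x"
    using k k'k k'p by (auto simp: \<tau>_def attach_def k'_def)
  have g: "g p = Suc (f p)" "g k = Suc (f p)" "g (Suc p) = f k" "g k' = f k"
    "\<And>x. x \<notin> {p, Suc p, k, k'} \<Longrightarrow> g x = f x"
    using k k'k k'p fk' by (auto simp: g_def)
  have \<sigma>oth: "\<sigma> x \<notin> {p, Suc p, k, k'}" if "x \<notin> {p, Suc p, k, k'}" for x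
    using that inv[of x] \<sigma>p \<sigma>Sp \<sigma>k' by (auto simp: k'_def)
  \<comment> \<open>If \<open>k\<close> is adjacent to \<open>p\<close>, the bound comes from
    \<open>f p \<le> 2 * n - p\<close> and \<open>p > n\<close>. Otherwise the position after
    \<open>k\<close> has a label above \<open>Suc (f p)\<close> but at most
    \<open>Suc k\<close>.\<close>
  have bnd: "Suc (f p) \<le> k"
  proof (cases "Suc k = p")
    case True
    then show ?thesis using labellingD(4)[OF lab pin(2)] fSp p by auto
  next
    case False
    then have "Suc (f p) < f (Suc k)" using k(4)[of "Suc k"] k(2) by auto
    moreover have "f (Suc k) \<le> Suc k" using labellingD(3)[OF lab, of "Suc k"] k(2) p by auto
    ultimately show ?thesis by simp
  qed
  have up: "f p + Suc p \<le> 2 * n + 1" using labellingD(4)[OF lab pin(2)] fSp by simp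
  show L: "labelling n \<tau> g"
    unfolding labelling_def
  proof (intro conjI ballI allI impI)
    fix x assume x: "x \<in> {1..2 * n}"
    show "g (\<tau> x) = g x"
    proof (cases "x \<in> {p, Suc p, k, k'}")
      case True
      then show ?thesis using \<tau>(1-4) g(1-4) by auto
    next
      case False
      then show ?thesis using \<tau>(5) g(5) \<sigma>oth labellingD(1)[OF lab x] by presburger
    qed
    show "1 \<le> g x"
      using g labellingD(2)[OF lab x] labellingD(2)[OF lab kin] by (cases "x \<in> {p, Suc p, k, k'}") auto
    show "g x \<le> x"
      using g labellingD(3)[OF lab x] labellingD(3)[OF lab k'in] fk' bnd k(2) l
      by (cases "x \<in> {p, Suc p, k, k'}") auto
    show "g x + x \<le> 2 * n + 1"
      using g labellingD(4)[OF lab x] labellingD(4)[OF lab k'in] fk' up k(2) l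
      by (cases "x \<in> {p, Suc p, k, k'}") auto
    show "even (g x + x) = (x < \<tau> x)"
    proof (cases "x \<in> {p, Suc p, k, k'}")
      case True
      have "even (f k + k') \<longleftrightarrow> k' < k"
        using labellingD(5)[OF lab k'in] fk' \<sigma>k' by simp
      then have "even (f k + k') \<longleftrightarrow> k' < Suc p" using k'cases k(2) by auto
      moreover have "even (f k + Suc p) \<longleftrightarrow> Suc p < k'"
        using kpar kp k'cases k(2) by (auto simp: even_diff_nat)
      moreover have "odd (Suc (f p) + p)" "even (Suc (f p) + k)"
        using pu kp k(2) by (auto simp: even_diff_nat)
      ultimately show ?thesis using True k(2)
        by (elim insertE emptyE) (simp_all add: \<tau>(1-4) g(1-4))
    next
      case False
      then show ?thesis using g \<tau> labellingD(5)[OF lab x] by auto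
    qed
  next
    fix x assume "x \<notin> {1..2 * n}"
    then show "g x = 0" using g(5)[of x] labelling_zero[OF lab] pin kin k'in by fastforce
  next
    fix x i assume x: "x \<in> {1..2 * n}" and i: "x < i \<and> i < \<tau> x"
    consider "x = k" | "x = k'" "k' < k" | "x = Suc p" "Suc p < k'" | "x \<notin> {p, Suc p, k, k'}"
    proof -
      have "x \<noteq> p" using i \<tau>(1) k(2) by auto
      moreover have "x = k' \<Longrightarrow> k' < k" using i \<tau>(4) k'cases by simp
      moreover have "x = Suc p \<Longrightarrow> Suc p < k'" using i \<tau>(3) by simp
      ultimately show thesis using that by blast
    qed
    then show "g x < g i"
    proof cases
      case 1
      then have "k < i" "i < p" using i \<tau> by auto
      moreover have "i \<noteq> k'" using k'cases calculation by auto
      ultimately show ?thesis using k(4)[of i] g 1 by auto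
    next
      case 2
      then have i': "k' < i" "i < Suc p" using i \<tau> by auto
      consider "i < k" | "i = k" | "k < i" "i < p" | "i = p" using i' by linarith
      then show ?thesis
      proof cases
        case 1
        then have "f k' < f i" using labelling_nested[OF lab k'in, of i] i' \<sigma>k' by auto
        then show ?thesis using g 2 1 i' fk' k(2) by auto
      next
        case 3
        then show ?thesis using k(4)[of i] g 2 i' l by auto
      qed (use g 2 l in auto)
    next
      case 3
      then have i': "Suc p < i" "i < k'" using i \<tau> by auto
      then have "f k < f i" using labelling_nested[OF lab kin, of i] k(2) by (auto simp: k'_def)
      then show ?thesis using g i' 3 k(2) by auto
    next
      case 4
      then have i': "x < i" "i < \<sigma> x" using i \<tau> by auto
      note so = \<sigma>oth[OF 4]
      have fi: "f x < f i" using labelling_nested[OF lab x i'] .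
      have gx: "g x = f x" using g 4 by auto
      have fxk: "f x < f k" if "x < p" "Suc p < \<sigma> x"
      proof (cases "x < k")
        case True
        then show ?thesis using labelling_nested[OF lab x, of k] that k(2) by auto
      next
        case False
        then have "Suc (f p) < f x" using k(4)[of x] 4 that by auto
        moreover have "f x < f p" using labelling_nested[OF lab x, of p] that by auto
        ultimately show ?thesis by simp
      qed
      show ?thesis
      proof (cases "i \<in> {p, Suc p}")
        case True
        then have "x < p" "Suc p < \<sigma> x" using i' 4 so by auto
        then have "f x < f k" using fxk by blast
        then show ?thesis using True g gx l by auto
      next
        case False
        then show ?thesis using g gx fi l fk' by (cases "i \<in> {k, k'}") auto
      qed
    qed
  qed
  show "nc_matching n \<tau>"
  proof (rule nc_matchingI_labelling[OF L])
    fix x assume x: "x \<in> {1..2 * n}"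
    show "\<tau> x \<in> {1..2 * n} \<and> \<tau> x \<noteq> x \<and> \<tau> (\<tau> x) = x"
    proof (cases "x \<in> {p, Suc p, k, k'}")
      case True
      then show ?thesis using \<tau>(1-4) kin pin k'in k(2) k'p by auto
    next
      case False
      then show ?thesis using \<tau>(5) \<sigma>oth nc_matchingD[OF m x] by presburger
    qed
  next
    fix x assume x: "x \<notin> {1..2 * n}"
    then have "x \<notin> {p, Suc p, k, k'}" using kin pin k'in by auto
    then show "\<tau> x = x" using \<tau>(5) nc_matching_fix[OF m x] by simp
  qed
qed


text \<open>The mirror image, with the label lowered to \<open>f p - 1\<close>. Here the label of
  the cut arc may equal the new one, which is why the comparison is weak on this side.\<close>

lemma labelling_attach_right:
  assumes m: "nc_matching n \<sigma>" and lab: "labelling n \<sigma> f" and p: "n < p" "p < 2 * n" and \<sigma>p: "\<sigma> p = Suc p"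
    and f2: "2 \<le> f p"
  defines "k \<equiv> right_pos n p f"
  defines "\<tau> \<equiv> attach (Suc p) p k \<sigma>" and "g \<equiv> f(Suc p := f p - 1, k := f p - 1, p := f k)"
  shows "labelling n \<tau> g" "nc_matching n \<tau>" "f k \<le> f p - 1"
proof -
  define y where "y = f p - 1"
  have fy: "f p = Suc y" "1 \<le> y" using f2 by (auto simp: y_def)
  note k = right_pos[OF lab p \<sigma>p f2, folded k_def y_def]
  note inv = nc_matching_invol[OF m]
  have pin: "p \<in> {1..2 * n}" "Suc p \<in> {1..2 * n}" and kin: "k \<in> {1..2 * n}" using p k by auto
  have \<sigma>Sp: "\<sigma> (Suc p) = p" using \<sigma>p inv by metis
  have oth: "\<And>i. i \<noteq> Suc p \<Longrightarrow> \<sigma> i \<noteq> p" "\<And>i. i \<noteq> p \<Longrightarrow> \<sigma> i \<noteq> Suc p"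
    using inv \<sigma>p \<sigma>Sp by metis+
  have fSp: "f (Suc p) = Suc y" using labellingD(1)[OF lab pin(1)] \<sigma>p fy by simp
  show l: "f k \<le> f p - 1" using k(3) fy by simp
  define k' where "k' = \<sigma> k"
  have k'in: "k' \<in> {1..2 * n}" and k'k: "k' \<noteq> k" and \<sigma>k': "\<sigma> k' = k"
    using nc_matchingD[OF m kin] by (auto simp: k'_def)
  have fk': "f k' = f k" using labellingD(1)[OF lab kin] by (simp add: k'_def)
  have k'p: "k' \<noteq> p" "k' \<noteq> Suc p" using \<sigma>k' \<sigma>p \<sigma>Sp k by auto
  have k'cases: "k < k' \<or> k' < p"
  proof (rule ccontr)
    assume "\<not> ?thesis"
    then have "k' < k" "Suc p < k'" using k'k k'p by auto
    then show False using k(4)[of k'] fk' k(3) by simp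
  qed
  have closed: "Suc p < \<sigma> i \<and> \<sigma> i < k" if i: "Suc p < i" "i < k" for i
  proof -
    have iin: "i \<in> {1..2 * n}" using i k p by auto
    note iin' = nc_matchingD[OF m iin]
    have fi: "y < f i" "f (\<sigma> i) = f i" using k(4) i labellingD(1)[OF lab iin] by auto
    have "\<sigma> i \<noteq> k"
    proof
      assume "\<sigma> i = k"
      then have "i = k'" using inv[of i] by (simp add: k'_def)
      then show False using i k'cases by simp
    qed
    moreover have "\<sigma> i \<noteq> p" "\<sigma> i \<noteq> Suc p"
      by (rule oth; use i in simp)+
    moreover have "\<not> \<sigma> i < p"
      using labelling_nested[OF lab iin'(1), of p] iin' i fi fy by auto
    moreover have "\<not> k < \<sigma> i"
      using labelling_nested[OF lab iin, of k] i k(3) fi by auto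
    ultimately show ?thesis by linarith
  qed
  have kp: "even (k - p)"
  proof -
    have "even (card {Suc p<..<k})"
      by (rule even_card_closed[where \<sigma> = \<sigma>])
        (use closed nc_matchingD[OF m] k p in auto)
    then show ?thesis using k(1) by auto
  qed
  have pu: "even (Suc y + p)" using labellingD(5)[OF lab pin(1)] \<sigma>p fy by simp
  have kpar: "even (f k + k) \<longleftrightarrow> k < k'" using labellingD(5)[OF lab kin] by (simp add: k'_def)
  have \<tau>: "\<tau> p = k'" "\<tau> k' = p" "\<tau> (Suc p) = k" "\<tau> k = Suc p"
    "\<And>x. x \<notin> {p, Suc p, k, k'} \<Longrightarrow> \<tau> x = \<sigma> x"
    using k k'k k'p by (auto simp: \<tau>_def attach_def k'_def)
  have g: "g (Suc p) = y" "g k = y" "g p = f k" "g k' = f k"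
    "\<And>x. x \<notin> {p, Suc p, k, k'} \<Longrightarrow> g x = f x"
    using k k'k k'p fk' by (auto simp: g_def y_def)
  have \<sigma>oth: "\<sigma> x \<notin> {p, Suc p, k, k'}" if "x \<notin> {p, Suc p, k, k'}" for x
    using that inv[of x] \<sigma>p \<sigma>Sp \<sigma>k' by (auto simp: k'_def)
  \<comment> \<open>For \<open>k = p + 2\<close> the lowered label can attain the bound:
    \<open>f p + (p + 1) \<le> 2 * n + 1\<close> allows exactly \<open>f p - 1\<close> one position
    further to the right.\<close>
  have bnd: "y + k \<le> 2 * n + 1"
  proof (cases "k = Suc (Suc p)")
    case True
    then show ?thesis using labellingD(4)[OF lab pin(2)] fSp p by auto
  next
    case False
    then have "y < f (k - 1)" using k(4)[of "k - 1"] k(1) by auto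
    moreover have "k - 1 \<in> {1..2 * n}" using k(1,2) p by auto
    then have "f (k - 1) + (k - 1) \<le> 2 * n + 1" using labellingD(4)[OF lab] by blast
    ultimately show ?thesis by simp
  qed
  have up: "Suc y \<le> p" using labellingD(3)[OF lab pin(1)] fy by simp
  have up2: "y + Suc p \<le> 2 * n" using labellingD(4)[OF lab pin(2)] fSp by simp
  show L: "labelling n \<tau> g"
    unfolding labelling_def
  proof (intro conjI ballI allI impI)
    fix x assume x: "x \<in> {1..2 * n}"
    show "g (\<tau> x) = g x"
    proof (cases "x \<in> {p, Suc p, k, k'}")
      case True
      then show ?thesis using \<tau>(1-4) g(1-4) by auto
    next
      case False
      then show ?thesis using \<tau>(5) g(5) \<sigma>oth labellingD(1)[OF lab x] by presburger
    qed
    show "1 \<le> g x"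
      using g labellingD(2)[OF lab x] labellingD(2)[OF lab kin] fy by (cases "x \<in> {p, Suc p, k, k'}") auto
    show "g x \<le> x"
      using g labellingD(3)[OF lab x] labellingD(3)[OF lab k'in] fk' up k
      by (cases "x \<in> {p, Suc p, k, k'}") auto
    show "g x + x \<le> 2 * n + 1"
      using g labellingD(4)[OF lab x] labellingD(4)[OF lab k'in] fk' up2 k bnd
      by (cases "x \<in> {p, Suc p, k, k'}") auto
    show "even (g x + x) = (x < \<tau> x)"
    proof (cases "x \<in> {p, Suc p, k, k'}")
      case True
      have "even (f k + k') \<longleftrightarrow> k' < k"
        using labellingD(5)[OF lab k'in] fk' \<sigma>k' by simp
      then have "even (f k + k') \<longleftrightarrow> k' < p" using k'cases k(1) by auto
      moreover have "even (f k + p) \<longleftrightarrow> p < k'"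
        using kpar kp k'cases k(1) by (auto simp: even_diff_nat)
      moreover have "odd (y + k)" "even (y + Suc p)"
        using pu kp k(1) by (auto simp: even_diff_nat)
      ultimately show ?thesis using True k(1)
        by (elim insertE emptyE) (simp_all add: \<tau>(1-4) g(1-4))
    next
      case False
      then show ?thesis using g \<tau> labellingD(5)[OF lab x] by auto
    qed
  next
    fix x assume "x \<notin> {1..2 * n}"
    then show "g x = 0" using g(5)[of x] labelling_zero[OF lab] pin kin k'in by fastforce
  next
    fix x i assume x: "x \<in> {1..2 * n}" and i: "x < i \<and> i < \<tau> x"
    consider "x = Suc p" | "x = p" "k < k'" | "x = k'" "k' < p" | "x \<notin> {p, Suc p, k, k'}"
    proof -
      have "x \<noteq> k" using i \<tau>(4) k(1) by auto
      moreover have "x = k' \<Longrightarrow> k' < p" using i \<tau>(2) k'cases by simp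
      moreover have "x = p \<Longrightarrow> k < k'" using i \<tau>(1) k'cases by simp
      ultimately show thesis using that by blast
    qed
    then show "g x < g i"
    proof cases
      case 1
      then have "Suc p < i" "i < k" using i \<tau> by auto
      moreover have "i \<noteq> k'" using k'cases calculation by auto
      ultimately show ?thesis using k(4)[of i] g 1 by auto
    next
      case 2
      then have i': "p < i" "i < k'" using i \<tau> by auto
      \<comment> \<open>If an arc opens at \<open>k\<close>, the new arc from \<open>p\<close>
        encloses the one from \<open>Suc p\<close> to \<open>k\<close>, so their labels must differ
        strictly; parity excludes equality.\<close>
      have odd: "f k \<noteq> y" using kpar 2 pu kp k(1) by (auto simp: even_diff_nat)
      then have lt: "f k < y" using k(3) by simp
      consider "i < k" "Suc p < i" | "i = k" | "k < i" | "i = Suc p" using i' by linarith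
      then show ?thesis
      proof cases
        case 1
        then show ?thesis using k(4)[of i] g 2 i' lt by auto
      next
        case 3
        then have "f k < f i" using labelling_nested[OF lab kin, of i] i' by (auto simp: k'_def)
        then show ?thesis using g 2 3 i' k(1) by auto
      qed (use g 2 lt in auto)
    next
      case 3
      then have i': "k' < i" "i < p" using i \<tau> by auto
      then have "f k' < f i" using labelling_nested[OF lab k'in, of i] k(1) \<sigma>k' by auto
      then show ?thesis using g i' 3 k(1) fk' by auto
    next
      case 4
      then have i': "x < i" "i < \<sigma> x" using i \<tau> by auto
      note so = \<sigma>oth[OF 4]
      have fi: "f x < f i" using labelling_nested[OF lab x i'] .
      have gx: "g x = f x" using g 4 by auto
      have fxk: "f x < f k" if "x < p" "Suc p < \<sigma> x"
      proof (cases "k < \<sigma> x")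
        case True
        then show ?thesis using labelling_nested[OF lab x, of k] that k(1) by auto
      next
        case False
        then have "y < f (\<sigma> x)" using k(4)[of "\<sigma> x"] so that by auto
        moreover have "f x < f p" using labelling_nested[OF lab x, of p] that by auto
        ultimately show ?thesis using labellingD(1)[OF lab x] fy by simp
      qed
      show ?thesis
      proof (cases "i \<in> {p, Suc p}")
        case True
        then have "x < p" "Suc p < \<sigma> x" using i' 4 so by auto
        then have "f x < f k" using fxk by blast
        then show ?thesis using True g gx k(3) by auto
      next
        case False
        then show ?thesis using g gx fi k(3) fk' by (cases "i \<in> {k, k'}") auto
      qed
    qed
  qed
  show "nc_matching n \<tau>"
  proof (rule nc_matchingI_labelling[OF L])
    fix x assume x: "x \<in> {1..2 * n}"
    show "\<tau> x \<in> {1..2 * n} \<and> \<tau> x \<noteq> x \<and> \<tau> (\<tau> x) = x"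
    proof (cases "x \<in> {p, Suc p, k, k'}")
      case True
      then show ?thesis using \<tau>(1-4) kin pin k'in k(1) k'p by auto
    next
      case False
      then show ?thesis using \<tau>(5) \<sigma>oth nc_matchingD[OF m x] by presburger
    qed
  next
    fix x assume x: "x \<notin> {1..2 * n}"
    then have "x \<notin> {p, Suc p, k, k'}" using kin pin k'in by auto
    then show "\<tau> x = x" using \<tau>(5) nc_matching_fix[OF m x] by simp
  qed
qed


text \<open>Inverse to the attachment on the left: the larger label at \<open>p\<close> drops by one
  and moves to the cup, the joined arc takes the smaller label. All positions between
  \<open>\<tau> p\<close> and \<open>p\<close> lie inside their arc and have labels above
  \<open>g p\<close>, so the cut is recovered as \<open>left_pos\<close>.\<close>

lemma labelling_contract_left:
  assumes m: "nc_matching n \<tau>" and lab: "labelling n \<tau> g" and p: "n < p" "p < 2 * n"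
    and \<tau>p: "\<tau> p \<noteq> Suc p" and gt: "g (Suc p) < g p"
  defines "\<sigma> \<equiv> contract p \<tau>" and "f \<equiv> g(p := g p - 1, Suc p := g p - 1, \<tau> p := g (Suc p))"
  shows "labelling n \<sigma> f" "left_pos p f = \<tau> p" "f p = g p - 1" "f (\<tau> p) = g (Suc p)" "\<tau> p < p"
proof -
  note inv = nc_matching_invol[OF m]
  have pin: "p \<in> {1..2 * n}" "Suc p \<in> {1..2 * n}" using p by auto
  define j where "j = \<tau> p"
  define j' where "j' = \<tau> (Suc p)"
  have jin: "j \<in> {1..2 * n}" "j' \<in> {1..2 * n}" using nc_matchingD(1)[OF m] pin by (auto simp: j_def j'_def)
  have \<tau>j: "\<tau> j = p" "\<tau> j' = Suc p" using inv by (auto simp: j_def j'_def)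
  have jne: "j \<noteq> p" "j \<noteq> Suc p" "j' \<noteq> p" "j' \<noteq> Suc p" "j \<noteq> j'"
    using nc_matchingD(2)[OF m pin(1)] nc_matchingD(2)[OF m pin(2)] \<tau>p \<tau>j
    by (auto simp: j_def j'_def)
  have gj: "g j = g p" "g j' = g (Suc p)" using labellingD(1)[OF lab] pin by (auto simp: j_def j'_def)
  \<comment> \<open>An arc leading from \<open>p\<close> to the right would enclose
    \<open>Suc p\<close> and have the smaller label.\<close>
  have jp: "j < p"
  proof (rule ccontr)
    assume "\<not> j < p"
    then have "g p < g (Suc p)" using labelling_nested[OF lab pin(1), of "Suc p"] jne by (auto simp: j_def)
    then show False using gt by simp
  qed
  then show "\<tau> p < p" by (simp add: j_def)
  have j'cases: "j' < j \<or> Suc p < j'"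
  proof (rule ccontr)
    assume "\<not> ?thesis"
    then have "j < j'" "j' < p" using jne by auto
    then show False using nc_matching_nested[OF m, of j j'] \<tau>j by simp
  qed
  have p1: "odd (g p + p)" using labellingD(5)[OF lab pin(1)] jp by (auto simp: j_def)
  have pj: "even (g p + j)" using labellingD(5)[OF lab jin(1)] gj \<tau>j jp by auto
  have pS: "even (g (Suc p) + Suc p) \<longleftrightarrow> Suc p < j'" using labellingD(5)[OF lab pin(2)] by (simp add: j'_def)
  have pj': "even (g (Suc p) + j') \<longleftrightarrow> j' < Suc p" using labellingD(5)[OF lab jin(2)] gj \<tau>j by simp
  have lpos: "1 \<le> g (Suc p)" using labellingD(2)[OF lab pin(2)] .
  define u where "u = g p - 1"
  have gp: "g p = Suc u" "g (Suc p) \<le> u" "1 \<le> u" using gt lpos by (auto simp: u_def)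
  have \<sigma>: "\<sigma> p = Suc p" "\<sigma> (Suc p) = p" "\<sigma> j = j'" "\<sigma> j' = j"
    "\<And>x. x \<notin> {p, Suc p, j, j'} \<Longrightarrow> \<sigma> x = \<tau> x"
    using jne \<tau>p by (auto simp: \<sigma>_def contract_def j_def j'_def)
  have f: "f p = u" "f (Suc p) = u" "f j = g (Suc p)" "f j' = g (Suc p)"
    "\<And>x. x \<notin> {p, Suc p, j, j'} \<Longrightarrow> f x = g x"
    using jne gj by (auto simp: f_def u_def j_def)
  show "f p = g p - 1" using f(1) by (simp add: u_def)
  show "f (\<tau> p) = g (Suc p)" using f(3) by (simp add: j_def)
  have \<tau>oth: "\<tau> x \<notin> {p, Suc p, j, j'}" if "x \<notin> {p, Suc p, j, j'}" for x
    using that inv[of x] \<tau>j by (auto simp: j_def j'_def)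
  have btw: "g p < g i" if "j < i" "i < p" for i
    using labelling_nested[OF lab jin(1), of i] that \<tau>j gj by simp
  show "left_pos p f = \<tau> p"
    unfolding left_pos_def j_def[symmetric]
  proof (rule Max_eqI)
    show "j \<in> {k \<in> {1..<p}. f k \<le> Suc (f p)}" using f jp jin gp by auto
    fix i assume i: "i \<in> {k \<in> {1..<p}. f k \<le> Suc (f p)}"
    show "i \<le> j"
    proof (rule ccontr)
      assume "\<not> i \<le> j"
      then have ji: "j < i" "i < p" using i by auto
      then have "i \<noteq> j'" using j'cases by auto
      then have "f i = g i" using f(5)[of i] ji by auto
      then show False using btw[OF ji] i f(1) gp by simp
    qed
  qed simp
  show "labelling n \<sigma> f"
    unfolding labelling_def
  proof (intro conjI ballI allI impI)
    fix x assume x: "x \<in> {1..2 * n}"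
    show "f (\<sigma> x) = f x"
    proof (cases "x \<in> {p, Suc p, j, j'}")
      case True
      then show ?thesis by (elim insertE emptyE) (simp_all add: \<sigma>(1-4) f(1-4))
    next
      case False
      then show ?thesis using \<sigma>(5) f(5) \<tau>oth labellingD(1)[OF lab x] by presburger
    qed
    show "1 \<le> f x"
      using f labellingD(2)[OF lab x] gp lpos by (cases "x \<in> {p, Suc p, j, j'}") auto
    show "f x \<le> x"
      using f labellingD(3)[OF lab x] labellingD(3)[OF lab pin(1)] gp gj
      by (cases "x \<in> {p, Suc p, j, j'}") auto
    show "f x + x \<le> 2 * n + 1"
      using f labellingD(4)[OF lab x] labellingD(4)[OF lab pin(1)] gp gj jp
      by (cases "x \<in> {p, Suc p, j, j'}") auto
    show "even (f x + x) = (x < \<sigma> x)"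
    proof (cases "x \<in> {p, Suc p, j, j'}")
      case True
      have "even (g (Suc p) + j') \<longleftrightarrow> j' < j" using pj' j'cases jp by auto
      moreover have "even (g (Suc p) + j) \<longleftrightarrow> j < j'"
        using pS p1 pj j'cases jp by auto
      moreover have "even (u + p)" using p1 gp by simp
      ultimately show ?thesis using True jp
        by (elim insertE emptyE) (simp_all add: \<sigma>(1-4) f(1-4))
    next
      case False
      then show ?thesis using f \<sigma> labellingD(5)[OF lab x] by auto
    qed
  next
    fix x assume "x \<notin> {1..2 * n}"
    then show "f x = 0" using f(5)[of x] labelling_zero[OF lab] pin jin by fastforce
  next
    fix x i assume x: "x \<in> {1..2 * n}" and i: "x < i \<and> i < \<sigma> x"
    consider "x = j" "Suc p < j'" | "x = j'" "j' < j" | "x \<notin> {p, Suc p, j, j'}"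
    proof -
      have "x \<noteq> p" using i \<sigma>(1) by auto
      moreover have "x \<noteq> Suc p" using i \<sigma>(2) by auto
      moreover have "x = j \<Longrightarrow> Suc p < j'" using i \<sigma>(3) j'cases by simp
      moreover have "x = j' \<Longrightarrow> j' < j" using i \<sigma>(4) by simp
      ultimately show thesis using that by blast
    qed
    then show "f x < f i"
    proof cases
      case 1
      then have i': "j < i" "i < j'" using i \<sigma> by auto
      have ne: "g (Suc p) \<noteq> u" using pS 1 p1 gp by auto
      then have lt: "g (Suc p) < u" using gp by simp
      consider "i < p" | "i = p \<or> i = Suc p" | "Suc p < i" by linarith
      then show ?thesis
      proof cases
        case 1
        then show ?thesis using btw[of i] i' f \<open>x = j\<close> gt by simp
      next
        case 2
        then show ?thesis using f \<open>x = j\<close> lt by auto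
      next
        case 3
        then have "g (Suc p) < g i" using labelling_nested[OF lab pin(2), of i] i' by (simp add: j'_def)
        then show ?thesis using 3 f i' \<open>x = j\<close> jp by simp
      qed
    next
      case 2
      then have i': "j' < i" "i < j" using i \<sigma> by auto
      have "g j' < g i" using labelling_nested[OF lab jin(2), of i] i' \<tau>j jp by simp
      then show ?thesis using f gj i' 2 jp by simp
    next
      case 3
      then have i': "x < i" "i < \<tau> x" using i \<sigma> by auto
      note so = \<tau>oth[OF 3]
      have fi: "g x < g i" using labelling_nested[OF lab x i'] .
      have fx: "f x = g x" using f 3 by auto
      show ?thesis
      proof (cases "i \<in> {p, Suc p, j, j'}")
        case True
        have "Suc p < \<tau> x" "x < p"
        proof -
          consider "i = p" | "i = Suc p" | "i = j" | "i = j'" using True by blast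
          then have "x \<le> Suc p \<and> p \<le> \<tau> x"
            using nc_matching_nested[OF m i'] i' \<tau>j by cases (auto simp: j_def j'_def)
          then show "Suc p < \<tau> x" "x < p" using so 3 by auto
        qed
        then have "g x < g (Suc p)" using labelling_nested[OF lab x, of "Suc p"] by auto
        then show ?thesis using True f fx gp by auto
      next
        case False
        then show ?thesis using f fx fi by auto
      qed
    qed
  qed
qed

text \<open>Inverse to the attachment on the right: here the label at \<open>Suc p\<close> is raised
  by one and moves to the cup. The positions under the arc from \<open>Suc p\<close> have larger
  labels, so its right end is recovered as \<open>right_pos\<close>.\<close>

lemma labelling_contract_right:
  assumes m: "nc_matching n \<tau>" and lab: "labelling n \<tau> g" and p: "n < p" "p < 2 * n"
    and \<tau>p: "\<tau> p \<noteq> Suc p" and le: "g p \<le> g (Suc p)"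
  defines "\<sigma> \<equiv> contract p \<tau>"
    and "f \<equiv> g(p := Suc (g (Suc p)), Suc p := Suc (g (Suc p)), \<tau> (Suc p) := g p)"
  shows "labelling n \<sigma> f" "right_pos n p f = \<tau> (Suc p)" "f p = Suc (g (Suc p))"
    "f (\<tau> (Suc p)) = g p" "Suc p < \<tau> (Suc p)" "1 \<le> g (Suc p)"
proof -
  note inv = nc_matching_invol[OF m]
  have pin: "p \<in> {1..2 * n}" "Suc p \<in> {1..2 * n}" using p by auto
  define j where "j = \<tau> p"
  define j' where "j' = \<tau> (Suc p)"
  have jin: "j \<in> {1..2 * n}" "j' \<in> {1..2 * n}" using nc_matchingD(1)[OF m] pin by (auto simp: j_def j'_def)
  have \<tau>j: "\<tau> j = p" "\<tau> j' = Suc p" using inv by (auto simp: j_def j'_def)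
  have jne: "j \<noteq> p" "j \<noteq> Suc p" "j' \<noteq> p" "j' \<noteq> Suc p" "j \<noteq> j'"
    using nc_matchingD(2)[OF m pin(1)] nc_matchingD(2)[OF m pin(2)] \<tau>p \<tau>j
    by (auto simp: j_def j'_def)
  have gj: "g j = g p" "g j' = g (Suc p)" using labellingD(1)[OF lab] pin by (auto simp: j_def j'_def)
  have jp: "Suc p < j'"
  proof (rule ccontr)
    assume "\<not> Suc p < j'"
    then have "g j' < g p" using labelling_nested[OF lab jin(2), of p] jne \<tau>j by auto
    then show False using le gj by simp
  qed
  then show "Suc p < \<tau> (Suc p)" by (simp add: j'_def)
  have jcases: "j < p \<or> j' < j"
  proof (rule ccontr)
    assume "\<not> ?thesis"
    then have "Suc p < j" "j < \<tau> (Suc p)" using jne by (auto simp: j'_def)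
    then show False using nc_matching_nested[OF m, of "Suc p" j] \<tau>j by simp
  qed
  have p1: "even (g (Suc p) + Suc p)" using labellingD(5)[OF lab pin(2)] jp by (auto simp: j'_def)
  have pj': "odd (g (Suc p) + j')" using labellingD(5)[OF lab jin(2)] gj \<tau>j jp by auto
  have pS: "even (g p + p) \<longleftrightarrow> p < j" using labellingD(5)[OF lab pin(1)] by (simp add: j_def)
  have pj: "even (g p + j) \<longleftrightarrow> j < p" using labellingD(5)[OF lab jin(1)] gj \<tau>j by simp
  have lpos: "1 \<le> g p" using labellingD(2)[OF lab pin(1)] .
  show "1 \<le> g (Suc p)" using labellingD(2)[OF lab pin(2)] .
  define y where "y = g (Suc p)"
  have gp: "g (Suc p) = y" "g p \<le> y" "1 \<le> y" using le lpos by (auto simp: y_def)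
  have \<sigma>: "\<sigma> p = Suc p" "\<sigma> (Suc p) = p" "\<sigma> j = j'" "\<sigma> j' = j"
    "\<And>x. x \<notin> {p, Suc p, j, j'} \<Longrightarrow> \<sigma> x = \<tau> x"
    using jne \<tau>p by (auto simp: \<sigma>_def contract_def j_def j'_def)
  have f: "f p = Suc y" "f (Suc p) = Suc y" "f j = g p" "f j' = g p"
    "\<And>x. x \<notin> {p, Suc p, j, j'} \<Longrightarrow> f x = g x"
    using jne gj by (auto simp: f_def y_def j'_def)
  show "f p = Suc (g (Suc p))" using f(1) by (simp add: y_def)
  show "f (\<tau> (Suc p)) = g p" using f(4) by (simp add: j'_def)
  have \<tau>oth: "\<tau> x \<notin> {p, Suc p, j, j'}" if "x \<notin> {p, Suc p, j, j'}" for x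
    using that inv[of x] \<tau>j by (auto simp: j_def j'_def)
  have btw: "y < g i" if "Suc p < i" "i < j'" for i
    using labelling_nested[OF lab pin(2), of i] that gp by (simp add: j'_def)
  show "right_pos n p f = \<tau> (Suc p)"
    unfolding right_pos_def j'_def[symmetric]
  proof (rule Min_eqI)
    show "j' \<in> {k \<in> {p + 2..2 * n}. f k \<le> f p - 1}" using f jp jin gp by auto
    fix i assume i: "i \<in> {k \<in> {p + 2..2 * n}. f k \<le> f p - 1}"
    show "j' \<le> i"
    proof (rule ccontr)
      assume "\<not> j' \<le> i"
      then have ji: "Suc p < i" "i < j'" using i by auto
      then have "i \<noteq> j" using jcases by auto
      then have "f i = g i" using f(5)[of i] ji by auto
      then show False using btw[OF ji] i f(1) gp by simp
    qed
  qed simp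
  show "labelling n \<sigma> f"
    unfolding labelling_def
  proof (intro conjI ballI allI impI)
    fix x assume x: "x \<in> {1..2 * n}"
    show "f (\<sigma> x) = f x"
    proof (cases "x \<in> {p, Suc p, j, j'}")
      case True
      then show ?thesis by (elim insertE emptyE) (simp_all add: \<sigma>(1-4) f(1-4))
    next
      case False
      then show ?thesis using \<sigma>(5) f(5) \<tau>oth labellingD(1)[OF lab x] by presburger
    qed
    show "1 \<le> f x"
      using f labellingD(2)[OF lab x] gp lpos by (cases "x \<in> {p, Suc p, j, j'}") auto
    have yb: "y + j' \<le> 2 * n + 1" using labellingD(4)[OF lab jin(2)] gj gp by simp
    show "f x \<le> x"
      using f labellingD(3)[OF lab x] labellingD(3)[OF lab pin(1)] gp gj jp yb p
      by (cases "x \<in> {p, Suc p, j, j'}") auto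
    show "f x + x \<le> 2 * n + 1"
      using f labellingD(4)[OF lab x] labellingD(4)[OF lab pin(1)] gp gj jp yb
      by (cases "x \<in> {p, Suc p, j, j'}") auto
    show "even (f x + x) = (x < \<sigma> x)"
    proof (cases "x \<in> {p, Suc p, j, j'}")
      case True
      have "even (g p + j) \<longleftrightarrow> j < j'" using pj jcases jp by auto
      moreover have "even (g p + j') \<longleftrightarrow> j' < j"
        using pS p1 pj' jcases jp by auto
      moreover have "even (Suc y + p)" using p1 gp by simp
      ultimately show ?thesis using True jp
        by (elim insertE emptyE) (simp_all add: \<sigma>(1-4) f(1-4))
    next
      case False
      then show ?thesis using f \<sigma> labellingD(5)[OF lab x] by auto
    qed
  next
    fix x assume "x \<notin> {1..2 * n}"
    then show "f x = 0" using f(5)[of x] labelling_zero[OF lab] pin jin by fastforce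
  next
    fix x i assume x: "x \<in> {1..2 * n}" and i: "x < i \<and> i < \<sigma> x"
    consider "x = j" "j < p" | "x = j'" "j' < j" | "x \<notin> {p, Suc p, j, j'}"
    proof -
      have "x \<noteq> p" using i \<sigma>(1) by auto
      moreover have "x \<noteq> Suc p" using i \<sigma>(2) by auto
      moreover have "x = j \<Longrightarrow> j < p" using i \<sigma>(3) jcases by simp
      moreover have "x = j' \<Longrightarrow> j' < j" using i \<sigma>(4) by simp
      ultimately show thesis using that by blast
    qed
    then show "f x < f i"
    proof cases
      case 1
      then have i': "j < i" "i < j'" using i \<sigma> by auto
      consider "i < p" | "i = p \<or> i = Suc p" | "Suc p < i" by linarith
      then show ?thesis
      proof cases
        case 1
        then have "g j < g i" using labelling_nested[OF lab jin(1), of i] i' \<tau>j by simp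
        then show ?thesis using 1 i' f \<open>x = j\<close> gj jp by simp
      next
        case 2
        then show ?thesis using f \<open>x = j\<close> gp by auto
      next
        case 3
        then show ?thesis using btw[of i] f i' \<open>x = j\<close> 1 gp by simp
      qed
    next
      case 2
      then have i': "j' < i" "i < j" using i \<sigma> by auto
      have "g p < g i" using labelling_nested[OF lab pin(1), of i] i' jp by (simp add: j_def)
      then show ?thesis using f gj i' 2 jp by simp
    next
      case 3
      then have i': "x < i" "i < \<tau> x" using i \<sigma> by auto
      note so = \<tau>oth[OF 3]
      have fi: "g x < g i" using labelling_nested[OF lab x i'] .
      have fx: "f x = g x" using f 3 by auto
      show ?thesis
      proof (cases "i \<in> {p, Suc p, j, j'}")
        case True
        have "Suc p < \<tau> x" "x < p"
        proof -
          consider "i = p" | "i = Suc p" | "i = j" | "i = j'" using True by blast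
          then have "x \<le> Suc p \<and> p \<le> \<tau> x"
            using nc_matching_nested[OF m i'] i' \<tau>j by cases (auto simp: j_def j'_def)
          then show "Suc p < \<tau> x" "x < p" using so 3 by auto
        qed
        then have "g x < g p" using labelling_nested[OF lab x, of p] by auto
        then show ?thesis using True f fx gp by auto
      next
        case False
        then show ?thesis using f fx fi by auto
      qed
    qed
  qed
qed


section \<open>Quantum integers\<close>

text \<open>The indeterminate is not a root of unity, by comparison of degrees. The nonvanishing of
  \<open>[m]\<close> for positive \<open>m\<close> rests on this.\<close>

lemma qvar_power_eq_1_iff: "qvar ^ k = 1 \<longleftrightarrow> k = 0"
proof
  assume "qvar ^ k = 1"
  moreover have "qvar ^ k = Fract ([:0, 1:] ^ k) 1"
    by (induction k) (simp_all add: qvar_def One_fract_def)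
  ultimately have "[:0, 1:] ^ k = (1 :: complex poly)"
    by (simp add: One_fract_def eq_fract)
  then have "degree ([:0, 1:] ^ k :: complex poly) = 0" by simp
  then show "k = 0" by (simp add: degree_power_eq)
qed simp

lemma qvar_nonzero: "qvar \<noteq> 0"
  using qvar_power_eq_1_iff[of 1] by (simp add: qvar_def Zero_fract_def eq_fract)

lemma qint_denominator_nonzero: "qvar - inverse qvar \<noteq> 0"
proof
  assume "qvar - inverse qvar = 0"
  then have "qvar ^ 2 = 1" using qvar_nonzero by (simp add: field_simps power2_eq_square)
  then show False using qvar_power_eq_1_iff[of 2] by simp
qed

lemma qint_0 [simp]: "qint 0 = 0"
  by (simp add: qint_def)

lemma qint_1 [simp]: "qint 1 = 1"
  using qint_denominator_nonzero by (simp add: qint_def)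

lemma qint_2_mult: "qint 2 * qint m = qint (m + 1) + qint (m - 1)"
proof -
  let ?d = "qvar - inverse qvar"
  have d: "?d \<noteq> 0" by (rule qint_denominator_nonzero)
  have 2: "qvar powi 2 - qvar powi (- 2) = ?d * (qvar + inverse qvar)"
    using qvar_nonzero by (simp add: power_int_minus field_simps power2_eq_square)
  have p: "qvar powi (m + 1) = qvar powi m * qvar" "qvar powi (m - 1) = qvar powi m * inverse qvar"
    "qvar powi (- (m + 1)) = qvar powi (- m) * inverse qvar" "qvar powi (- (m - 1)) = qvar powi (- m) * qvar"
    using qvar_nonzero power_int_add[of qvar m 1] power_int_add[of qvar m "-1"]
      power_int_add[of qvar "-m" 1] power_int_add[of qvar "-m" "-1"]
    by (simp_all add: power_int_minus)
  have "qint 2 * qint m = (qvar + inverse qvar) * (qvar powi m - qvar powi (- m)) / ?d"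
    unfolding qint_def 2 using d by simp
  also have "\<dots> = qint (m + 1) + qint (m - 1)"
    unfolding qint_def p add_divide_distrib[symmetric] by (simp add: algebra_simps)
  finally show ?thesis .
qed

lemma qint_nonzero: "m > 0 \<Longrightarrow> qint m \<noteq> 0"
proof
  assume m: "m > 0" and "qint m = 0"
  then have "qvar powi m = qvar powi (- m)"
    using qint_denominator_nonzero by (simp add: qint_def)
  then have "qvar powi m * qvar powi m = 1"
    using qvar_nonzero by (metis power_int_minus power_int_eq_0_iff right_inverse)
  moreover have "qvar powi m = qvar ^ nat m" using m by (simp add: power_int_def)
  ultimately have "qvar ^ (nat m + nat m) = 1" by (simp add: power_add)
  then show False using qvar_power_eq_1_iff m by simp
qed

section \<open>The peak relation for label sums\<close>

lemma arc_prod_remove: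
  assumes "\<sigma> p = Suc p" "\<sigma> (Suc p) = p" "p \<in> {1..2 * n}"
  shows "arc_prod n \<sigma> F = F p * arc_prod n \<sigma> (\<lambda>x. if x = p \<or> x = Suc p then 1 else F x)"
proof -
  let ?A = "{k. k \<in> {1..2 * n} \<and> k < \<sigma> k}"
  have A: "p \<in> ?A" "finite ?A" "Suc p \<notin> ?A" using assms by auto
  have "prod F (?A - {p}) = (\<Prod>x\<in>?A - {p}. if x = p \<or> x = Suc p then 1 else F x)"
  proof (rule prod.cong[OF refl])
    fix x assume x: "x \<in> ?A - {p}"
    then have "x \<noteq> Suc p" using A(3) by blast
    with x show "F x = (if x = p \<or> x = Suc p then 1 else F x)" by simp
  qed
  then show ?thesis
    unfolding arc_prod_def prod.remove[OF A(2,1), of F]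
      prod.remove[OF A(2,1), of "\<lambda>x. if x = p \<or> x = Suc p then 1 else F x"]
    by simp
qed

text \<open>Away from the four ends the arcs and labels agree. The joined arc carries one of the
  labels \<open>g p\<close> and \<open>g (Suc p)\<close>; once it is cancelled, the other label is
  the whole difference between the two products.\<close>

lemma arc_prod_contract:
  fixes w :: "nat \<Rightarrow> 'a::comm_monoid_mult"
  assumes m: "nc_matching n \<tau>" "nc_matching n \<sigma>" and lab: "labelling n \<tau> g" "labelling n \<sigma> f"
    and p: "p \<in> {1..2 * n}" "Suc p \<in> {1..2 * n}" and \<tau>p: "\<tau> p \<noteq> Suc p" and \<sigma>: "contract p \<tau> = \<sigma>"
    and fg: "\<And>x. x \<notin> {p, Suc p, \<tau> p, \<tau> (Suc p)} \<Longrightarrow> f x = g x"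
  shows "w (f (\<tau> p)) * arc_prod n \<tau> (\<lambda>k. w (g k)) =
    w (g p) * w (g (Suc p)) * arc_prod n \<sigma> (\<lambda>x. if x = p \<or> x = Suc p then 1 else w (f x))"
proof -
  note inv = nc_matching_invol[OF m(1)]
  have fx: "\<tau> p \<noteq> p" "\<tau> (Suc p) \<noteq> Suc p" using nc_matchingD(2)[OF m(1)] p by auto
  have ne: "\<tau> (Suc p) \<noteq> p" "\<tau> p \<noteq> \<tau> (Suc p)" using inv \<tau>p by (metis n_not_Suc_n)+
  have s: "\<sigma> p = Suc p" "\<sigma> (\<tau> p) = \<tau> (Suc p)" "\<sigma> (Suc p) = p" "\<sigma> (\<tau> (Suc p)) = \<tau> p"
    "\<And>x. x \<notin> {p, Suc p, \<tau> p, \<tau> (Suc p)} \<Longrightarrow> \<sigma> x = \<tau> x"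
    using \<sigma> \<tau>p fx ne by (auto simp: contract_def)
  let ?C = "\<Prod>k | k \<in> {1..2 * n} - {p, \<tau> p, Suc p, \<tau> (Suc p)} \<and> k < \<tau> k. w (g k)"
  have 1: "arc_prod n \<tau> (\<lambda>k. w (g k)) = w (g p) * w (g (Suc p)) * ?C"
    using labellingD(1)[OF lab(1)] p \<tau>p by (intro arc_prod_split[OF m(1) p]) auto
  have "arc_prod n \<sigma> (\<lambda>x. if x = p \<or> x = Suc p then 1 else w (f x)) =
     1 * w (f (\<tau> p)) * (\<Prod>k | k \<in> {1..2 * n} - {p, \<sigma> p, \<tau> p, \<sigma> (\<tau> p)} \<and> k < \<sigma> k.
        (if k = p \<or> k = Suc p then 1 else w (f k)))"
    using arc_prod_split[OF m(2) p(1), of "\<tau> p" "\<lambda>x. if x = p \<or> x = Suc p then 1 else w (f x)"]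
      s fx ne \<tau>p nc_matchingD(1)[OF m(1) p(1)] labellingD(1)[OF lab(2), of "\<tau> p"] by auto
  also have "(\<Prod>k | k \<in> {1..2 * n} - {p, \<sigma> p, \<tau> p, \<sigma> (\<tau> p)} \<and> k < \<sigma> k.
        (if k = p \<or> k = Suc p then 1 else w (f k))) = ?C"
    using s(5) fg by (intro prod.cong) (auto simp: s(1,2))
  finally show ?thesis using 1 by (simp add: mult_ac)
qed

theorem label_sum_peak:
  assumes m: "nc_matching n \<sigma>" and p: "n < p" "p < 2 * n" and \<sigma>p: "\<sigma> p = Suc p"
  shows "qint 2 * label_sum n \<sigma> =
    (\<Sum>\<tau> | nc_matching n \<tau> \<and> contract p \<tau> = \<sigma> \<and> \<tau> \<noteq> \<sigma>. label_sum n \<tau>)"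
proof -
  let ?S = "{\<tau>. nc_matching n \<tau> \<and> contract p \<tau> = \<sigma> \<and> \<tau> \<noteq> \<sigma>}"
  let ?w = "\<lambda>k::nat. qint (int k)"
  let ?W = "\<lambda>\<tau> g. arc_prod n \<tau> (\<lambda>k. ?w (g k))"
  let ?R = "\<lambda>f. arc_prod n \<sigma> (\<lambda>x. if x = p \<or> x = Suc p then 1 else ?w (f x))"
  define T where "T = Sigma ?S (\<lambda>\<tau>. {g. labelling n \<tau> g})"
  \<comment> \<open>Comparing the labels at \<open>p\<close> and \<open>Suc p\<close> tells on which
    side of the cup the arc was cut.\<close>
  define T1 where "T1 = {(\<tau>, g) \<in> T. g (Suc p) < g p}"
  define T2 where "T2 = {(\<tau>, g) \<in> T. g p \<le> g (Suc p)}"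
  define up1 where "up1 = (\<lambda>f. (attach p (Suc p) (left_pos p f) \<sigma>, f(p := Suc (f p), left_pos p f := Suc (f p), Suc p := f (left_pos p f))))"
  define dn1 :: "(nat \<Rightarrow> nat) \<times> (nat \<Rightarrow> nat) \<Rightarrow> nat \<Rightarrow> nat"
    where "dn1 = (\<lambda>(\<tau>, g). g(p := g p - 1, Suc p := g p - 1, \<tau> p := g (Suc p)))"
  define up2 where "up2 = (\<lambda>f. (attach (Suc p) p (right_pos n p f) \<sigma>, f(Suc p := f p - 1, right_pos n p f := f p - 1, p := f (right_pos n p f))))"
  define dn2 :: "(nat \<Rightarrow> nat) \<times> (nat \<Rightarrow> nat) \<Rightarrow> nat \<Rightarrow> nat"
    where "dn2 = (\<lambda>(\<tau>, g). g(p := Suc (g (Suc p)), Suc p := Suc (g (Suc p)), \<tau> (Suc p) := g p))"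
  have pin: "p \<in> {1..2 * n}" "Suc p \<in> {1..2 * n}" using p by auto
  have finS: "finite ?S" using finite_nc_matchings by (rule finite_subset[rotated]) auto
  have finT: "finite T" unfolding T_def using finS finite_labellings by auto
  have TD: "nc_matching n \<tau>" "labelling n \<tau> g" "contract p \<tau> = \<sigma>" "\<tau> p \<noteq> Suc p" "\<tau> p \<noteq> p" "\<tau> (Suc p) \<noteq> Suc p"
    if "(\<tau>, g) \<in> T" for \<tau> g
    using that pin nc_matchingD(2)[of n \<tau>] by (auto simp: T_def contract_def)
  have inv: "\<sigma> (\<sigma> x) = x" for x using nc_matching_invol[OF m] .
  have \<sigma>Sp: "\<sigma> (Suc p) = p" using \<sigma>p inv by metis
  have "(\<Sum>\<tau>\<in>?S. label_sum n \<tau>) = (\<Sum>(\<tau>, g)\<in>T. ?W \<tau> g)"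
    unfolding label_sum_def T_def using finS finite_labellings by (intro sum.Sigma) auto
  also have "\<dots> = (\<Sum>(\<tau>, g)\<in>T1. ?W \<tau> g) + (\<Sum>(\<tau>, g)\<in>T2. ?W \<tau> g)"
  proof -
    have "T = T1 \<union> T2" "T1 \<inter> T2 = {}" "finite T1" "finite T2"
      using finT by (auto simp: T1_def T2_def intro: finite_subset[OF _ finT])
    then show ?thesis by (simp add: sum.union_disjoint)
  qed
  also have "(\<Sum>(\<tau>, g)\<in>T1. ?W \<tau> g) = (\<Sum>f | labelling n \<sigma> f. ?w (Suc (f p)) * ?R f)"
  proof (rule sum.reindex_bij_witness[where i = up1 and j = dn1])
    fix a assume "a \<in> T1"
    then obtain \<tau> g where a: "a = (\<tau>, g)" and T: "(\<tau>, g) \<in> T" and gt: "g (Suc p) < g p"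
      by (auto simp: T1_def)
    note D = TD[OF T]
    define f where "f = g(p := g p - 1, Suc p := g p - 1, \<tau> p := g (Suc p))"
    note L = labelling_contract_left[OF D(1,2) p D(4) gt, folded f_def]
    have e: "dn1 a = f"
      by (simp add: a f_def dn1_def)
    have gp: "Suc (f p) = g p" using L(3) gt by simp
    have gt': "g (\<tau> p) = g p" using labellingD(1)[OF D(2) pin(1)] .
    show "dn1 a \<in> {f. labelling n \<sigma> f}"
      unfolding e using L(1) D(3) by simp
    have "f(p := Suc (f p), left_pos p f := Suc (f p), Suc p := f (left_pos p f)) = g"
      unfolding L(2,4) gp using gt' D(4,5) by (auto simp: f_def fun_eq_iff)
    moreover have "attach p (Suc p) (left_pos p f) \<sigma> = \<tau>"
      unfolding L(2) D(3)[symmetric] using attach_contract(1)[OF nc_matching_invol[OF D(1)] D(4,5,6)] .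
    ultimately show "up1 (dn1 a) = a"
      unfolding e by (simp add: a up1_def)
    have "?w (f (\<tau> p)) * ?W \<tau> g = ?w (g p) * ?w (g (Suc p)) * ?R f"
    proof (rule arc_prod_contract[OF D(1) m D(2) _ pin D(4) D(3)])
      show "labelling n \<sigma> f" using L(1) D(3) by simp
      show "f x = g x" if "x \<notin> {p, Suc p, \<tau> p, \<tau> (Suc p)}" for x
        using that by (auto simp: f_def)
    qed
    moreover have "?w (g (Suc p)) \<noteq> 0"
      using labellingD(2)[OF D(2) pin(2)] by (intro qint_nonzero) auto
    ultimately have "?W \<tau> g = ?w (g p) * ?R f" unfolding L(4) by (simp add: mult_ac)
    then show "?w (Suc (dn1 a p)) * ?R (dn1 a) = (case a of (\<tau>, g) \<Rightarrow> ?W \<tau> g)"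
      unfolding e gp by (simp add: a)
  next
    fix f assume "f \<in> {f. labelling n \<sigma> f}"
    then have lab: "labelling n \<sigma> f" by simp
    let ?k = "left_pos p f"
    note k = left_pos[OF lab p]
    note L = labelling_attach_left[OF m lab p \<sigma>p]
    have fSp: "f (Suc p) = f p" using labellingD(1)[OF lab pin(1)] \<sigma>p by simp
    have kin: "?k \<in> {1..2 * n}" using k p by auto
    have \<sigma>k: "\<sigma> ?k \<noteq> p" "\<sigma> ?k \<noteq> ?k" using nc_matchingD[OF m kin] inv[of ?k] \<sigma>p k by auto
    have c: "contract p (attach p (Suc p) ?k \<sigma>) = \<sigma>"
      using contract_attach(1)[OF inv _ _ \<sigma>p \<sigma>k(2)] k by auto
    have ne: "attach p (Suc p) ?k \<sigma> \<noteq> \<sigma>"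
    proof
      assume "attach p (Suc p) ?k \<sigma> = \<sigma>"
      then have "attach p (Suc p) ?k \<sigma> p = Suc p" using \<sigma>p by simp
      then show False using \<sigma>k k by (auto simp: attach_def)
    qed
    show "up1 f \<in> T1"
      unfolding up1_def using L c ne k by (auto simp: T1_def T_def)
    show "dn1 (up1 f) = f"
      unfolding up1_def dn1_def using k \<sigma>k fSp by (auto simp: attach_def fun_eq_iff)
  qed
  also have "(\<Sum>(\<tau>, g)\<in>T2. ?W \<tau> g) = (\<Sum>f | labelling n \<sigma> f \<and> 2 \<le> f p. ?w (f p - 1) * ?R f)"
  proof (rule sum.reindex_bij_witness[where i = up2 and j = dn2])
    fix a assume "a \<in> T2"
    then obtain \<tau> g where a: "a = (\<tau>, g)" and T: "(\<tau>, g) \<in> T" and le: "g p \<le> g (Suc p)"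
      by (auto simp: T2_def)
    note D = TD[OF T]
    define f where "f = g(p := Suc (g (Suc p)), Suc p := Suc (g (Suc p)), \<tau> (Suc p) := g p)"
    note L = labelling_contract_right[OF D(1,2) p D(4) le, folded f_def]
    have e: "dn2 a = f"
      by (simp add: a f_def dn2_def)
    have gp: "f p - 1 = g (Suc p)" using L(3) by simp
    have gt': "g (\<tau> (Suc p)) = g (Suc p)" using labellingD(1)[OF D(2) pin(2)] .
    show "dn2 a \<in> {f. labelling n \<sigma> f \<and> 2 \<le> f p}"
      unfolding e using L(1,3,6) D(3) by simp
    have \<tau>Sp: "\<tau> (Suc p) \<noteq> p" using D(4) nc_matching_invol[OF D(1), of "Suc p"] by auto
    have "f(Suc p := f p - 1, right_pos n p f := f p - 1, p := f (right_pos n p f)) = g"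
      unfolding L(2,4) gp using gt' D(6) \<tau>Sp by (auto simp: f_def fun_eq_iff)
    moreover have "attach (Suc p) p (right_pos n p f) \<sigma> = \<tau>"
      unfolding L(2) D(3)[symmetric] using attach_contract(2)[OF nc_matching_invol[OF D(1)] D(4,5,6)] .
    ultimately show "up2 (dn2 a) = a"
      unfolding e by (simp add: a up2_def)
    have lab: "labelling n \<sigma> f" using L(1) D(3) by simp
    have "?w (f (\<tau> p)) * ?W \<tau> g = ?w (g p) * ?w (g (Suc p)) * ?R f"
    proof (rule arc_prod_contract[OF D(1) m D(2) lab pin D(4) D(3)])
      show "f x = g x" if "x \<notin> {p, Suc p, \<tau> p, \<tau> (Suc p)}" for x
        using that by (auto simp: f_def)
    qed
    moreover have "f (\<tau> p) = g p"
      using L(4) labellingD(1)[OF lab nc_matchingD(1)[OF D(1) pin(1)]] D(3,4) nc_matchingD(2)[OF D(1) pin(1)] \<tau>Sp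
      by (auto simp: contract_def split: if_splits)
    moreover have "?w (g p) \<noteq> 0"
      using labellingD(2)[OF D(2) pin(1)] by (intro qint_nonzero) auto
    ultimately have "?W \<tau> g = ?w (g (Suc p)) * ?R f" by (simp add: mult_ac)
    then show "?w (dn2 a p - 1) * ?R (dn2 a) = (case a of (\<tau>, g) \<Rightarrow> ?W \<tau> g)"
      unfolding e gp by (simp add: a)
  next
    fix f assume "f \<in> {f. labelling n \<sigma> f \<and> 2 \<le> f p}"
    then have lab: "labelling n \<sigma> f" and f2: "2 \<le> f p" by auto
    let ?k = "right_pos n p f"
    note k = right_pos[OF lab p \<sigma>p f2]
    note L = labelling_attach_right[OF m lab p \<sigma>p f2]
    have fSp: "f (Suc p) = f p" using labellingD(1)[OF lab pin(1)] \<sigma>p by simp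
    have kin: "?k \<in> {1..2 * n}" using k p by auto
    have \<sigma>k: "\<sigma> ?k \<noteq> Suc p" "\<sigma> ?k \<noteq> p" "\<sigma> ?k \<noteq> ?k" using nc_matchingD[OF m kin] inv[of ?k] \<sigma>p \<sigma>Sp k by auto
    have c: "contract p (attach (Suc p) p ?k \<sigma>) = \<sigma>"
      using contract_attach(2)[OF inv _ _ \<sigma>p \<sigma>k(3)] k by auto
    have ne: "attach (Suc p) p ?k \<sigma> \<noteq> \<sigma>"
    proof
      assume "attach (Suc p) p ?k \<sigma> = \<sigma>"
      then have "attach (Suc p) p ?k \<sigma> (Suc p) = p" using \<sigma>Sp by simp
      then show False using \<sigma>k k by (auto simp: attach_def)
    qed
    show "up2 f \<in> T2"
      unfolding up2_def using L c ne k by (auto simp: T2_def T_def)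
    show "dn2 (up2 f) = f"
      unfolding up2_def dn2_def using k \<sigma>k fSp f2 by (auto simp: attach_def fun_eq_iff)
  qed
  \<comment> \<open>Labellings with \<open>f p = 1\<close> have no partner on the right; they are
    added back at no cost since \<open>[0] = 0\<close>.\<close>
  also have "(\<Sum>f | labelling n \<sigma> f \<and> 2 \<le> f p. ?w (f p - 1) * ?R f) =
      (\<Sum>f | labelling n \<sigma> f. ?w (f p - 1) * ?R f)"
  proof (rule sum.mono_neutral_left[OF finite_labellings])
    show "\<forall>f\<in>{f. labelling n \<sigma> f} - {f. labelling n \<sigma> f \<and> 2 \<le> f p}. ?w (f p - 1) * ?R f = 0"
    proof
      fix f assume "f \<in> {f. labelling n \<sigma> f} - {f. labelling n \<sigma> f \<and> 2 \<le> f p}"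
      then have "f p - 1 = 0" by auto
      then show "?w (f p - 1) * ?R f = 0" by simp
    qed
  qed auto
  also have "(\<Sum>f | labelling n \<sigma> f. ?w (Suc (f p)) * ?R f) + \<dots> = qint 2 * label_sum n \<sigma>"
    unfolding label_sum_def sum_distrib_left sum.distrib[symmetric]
  proof (rule sum.cong[OF refl])
    fix f assume "f \<in> {f. labelling n \<sigma> f}"
    then have "1 \<le> f p" using labellingD(2)[of n \<sigma> f p] pin by auto
    then have "?w (Suc (f p)) = qint (int (f p) + 1)" "?w (f p - 1) = qint (int (f p) - 1)"
      by (simp_all add: of_nat_diff add.commute)
    then have "?w (Suc (f p)) + ?w (f p - 1) = qint 2 * ?w (f p)" using qint_2_mult by simp
    then have "qint 2 * (?w (f p) * ?R f) = ?w (Suc (f p)) * ?R f + ?w (f p - 1) * ?R f"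
      by (simp only: mult.assoc[symmetric] distrib_right[symmetric])
    then show "?w (Suc (f p)) * ?R f + ?w (f p - 1) * ?R f = qint 2 * arc_prod n \<sigma> (\<lambda>k. ?w (f k))"
      using arc_prod_remove[OF \<sigma>p \<sigma>Sp pin(1), of "\<lambda>k. ?w (f k)"] by simp
  qed
  finally show ?thesis by simp
qed


section \<open>Heights of the folded path\<close>

definition matching_path :: "nat \<Rightarrow> (nat \<Rightarrow> nat) \<Rightarrow> step list" where
  "matching_path n \<sigma> = map (\<lambda>k. if k < \<sigma> k then Up else Down) [1..<2 * n + 1]"

locale matching =
  fixes n :: nat and \<sigma> :: "nat \<Rightarrow> nat"
  assumes nc: "nc_matching n \<sigma>"
begin

lemmas invol = nc_matching_invol[OF nc]
lemmas nested = nc_matching_nested[OF nc]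

text \<open>The left ends of the arcs that pass over the gap between the positions \<open>k\<close>
  and \<open>k + 1\<close>. Their number turns out to be the height of the path after
  \<open>k\<close> steps.\<close>

definition cover :: "nat \<Rightarrow> nat set" where
  "cover k = {x. x \<le> k \<and> k < \<sigma> x}"

definition ht :: "nat \<Rightarrow> nat" where
  "ht k = card (cover k)"

text \<open>The height of the top path after \<open>k\<close> steps.\<close>

definition lam :: "nat \<Rightarrow> nat" where
  "lam k = min k (2 * n - k)"

text \<open>The nesting depth of the arc at \<open>k\<close>. It is the least possible label of this
  arc, attained by a tiling in which no tile crosses the step.\<close>

definition step_ht :: "nat \<Rightarrow> nat" where
  "step_ht k = max (ht (k - 1)) (ht k)"

lemma finite_cover [simp]: "finite (cover k)"
  by (rule finite_subset[of _ "{..k}"]) (auto simp: cover_def)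

lemma cover_pos: "x \<in> cover k \<Longrightarrow> x \<in> {1..2 * n}"
  using nc_matching_fix[OF nc, of x] by (fastforce simp: cover_def)

lemma cover_Up:
  assumes "k \<in> {1..2 * n}" "k < \<sigma> k"
  shows "cover k = insert k (cover (k - 1))" "k \<notin> cover (k - 1)"
proof -
  have ne: "\<sigma> x \<noteq> k" if "x < k" for x
    using that assms invol[of x] by auto
  show "cover k = insert k (cover (k - 1))"
  proof (intro equalityI subsetI)
    fix x assume "x \<in> cover k"
    then show "x \<in> insert k (cover (k - 1))" by (auto simp: cover_def)
  next
    fix x assume "x \<in> insert k (cover (k - 1))"
    then consider "x = k" | "x < k" "k - 1 < \<sigma> x" using assms by (auto simp: cover_def)
    then show "x \<in> cover k"
    proof cases
      case 2
      then show ?thesis using ne[of x] by (auto simp: cover_def)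
    qed (use assms in \<open>auto simp: cover_def\<close>)
  qed
  show "k \<notin> cover (k - 1)" using assms by (auto simp: cover_def)
qed

lemma cover_Down:
  assumes k: "k \<in> {1..2 * n}" and "\<not> k < \<sigma> k"
  shows "cover (k - 1) = insert (\<sigma> k) (cover k)" "\<sigma> k \<notin> cover k" "\<sigma> k < k"
proof -
  show lt: "\<sigma> k < k" using assms nc_matchingD(2)[OF nc k] by auto
  show "\<sigma> k \<notin> cover k" using invol[of k] by (simp add: cover_def)
  show "cover (k - 1) = insert (\<sigma> k) (cover k)"
  proof (intro equalityI subsetI)
    fix x assume x: "x \<in> cover (k - 1)"
    then have "x \<le> k" "k \<le> \<sigma> x" by (auto simp: cover_def)
    moreover have "x = \<sigma> k" if "\<sigma> x = k" using that invol[of x] by simp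
    ultimately show "x \<in> insert (\<sigma> k) (cover k)" by (cases "\<sigma> x = k") (auto simp: cover_def)
  next
    fix x assume "x \<in> insert (\<sigma> k) (cover k)"
    then consider "x = \<sigma> k" | "x \<in> cover k" by blast
    then show "x \<in> cover (k - 1)"
    proof cases
      case 1
      then have "x \<le> k - 1" "\<sigma> x = k" using lt invol[of k] by simp_all
      then show ?thesis using k by (simp add: cover_def)
    next
      case 2
      then have "x \<noteq> k" using assms by (auto simp: cover_def)
      then show ?thesis using 2 by (auto simp: cover_def)
    qed
  qed
qed

lemma ht_Up: "k \<in> {1..2 * n} \<Longrightarrow> k < \<sigma> k \<Longrightarrow> ht k = Suc (ht (k - 1))"
  using cover_Up[of k] by (simp add: ht_def)

lemma ht_Down: "k \<in> {1..2 * n} \<Longrightarrow> \<not> k < \<sigma> k \<Longrightarrow> ht (k - 1) = Suc (ht k)"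
  using cover_Down[of k] by (simp add: ht_def)

lemma ht_0 [simp]: "ht 0 = 0"
proof -
  have "\<sigma> 0 = 0" using nc_matching_fix[OF nc, of 0] by simp
  then have "x \<notin> cover 0" for x by (cases x) (auto simp: cover_def)
  then have "cover 0 = {}" by blast
  then show ?thesis by (simp add: ht_def)
qed

lemma step_ht_eq:
  assumes "k \<in> {1..2 * n}"
  shows "step_ht k = (if k < \<sigma> k then ht k else ht (k - 1))"
  using ht_Up[OF assms] ht_Down[OF assms] by (auto simp: step_ht_def)

lemma ht_parity: "k \<le> 2 * n \<Longrightarrow> even (ht k + k)"
proof (induction k)
  case (Suc k)
  then show ?case using ht_Up[of "Suc k"] ht_Down[of "Suc k"] by (cases "Suc k < \<sigma> (Suc k)") auto
qed simp

text \<open>The arcs over the gap have distinct left ends in \<open>{1..k}\<close> and distinct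
  right ends in \<open>{Suc k..2 * n}\<close>.\<close>

lemma ht_le_lam:
  assumes "k \<le> 2 * n"
  shows "ht k \<le> lam k"
proof -
  have "cover k \<subseteq> {1..k}"
  proof
    fix x assume "x \<in> cover k"
    then show "x \<in> {1..k}" using cover_pos[of x k] by (auto simp: cover_def)
  qed
  then have "ht k \<le> k" unfolding ht_def using card_mono[of "{1..k}"] by fastforce
  moreover have "inj_on \<sigma> (cover k)" by (rule inj_on_inverseI[where g = \<sigma>]) (rule invol)
  then have "ht k = card (\<sigma> ` cover k)" by (simp add: ht_def card_image)
  moreover have "\<sigma> ` cover k \<subseteq> {Suc k..2 * n}"
  proof
    fix y assume "y \<in> \<sigma> ` cover k"
    then obtain x where x: "x \<in> cover k" "y = \<sigma> x" by blast
    then show "y \<in> {Suc k..2 * n}"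
      using nc_matchingD(5)[OF nc cover_pos[OF x(1)]] by (auto simp: cover_def)
  qed
  then have "card (\<sigma> ` cover k) \<le> 2 * n - k" using card_mono[of "{Suc k..2 * n}"] by fastforce
  ultimately show ?thesis by (simp add: lam_def)
qed

lemma height_matching_path: "k \<le> 2 * n \<Longrightarrow> height (matching_path n \<sigma>) k = int (ht k)"
proof (induction k)
  case (Suc k)
  have l: "length (matching_path n \<sigma>) = 2 * n" by (simp add: matching_path_def)
  have "height (matching_path n \<sigma>) (Suc k) =
      height (matching_path n \<sigma>) k + step_height (matching_path n \<sigma> ! k)"
    using Suc.prems l by (simp add: height_def take_Suc_conv_app_nth)
  moreover have "matching_path n \<sigma> ! k = (if Suc k < \<sigma> (Suc k) then Up else Down)"
    using Suc.prems by (simp add: matching_path_def del: upt_Suc)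
  ultimately show ?case
    using Suc ht_Up[of "Suc k"] ht_Down[of "Suc k"] by auto
qed (simp add: height_def)

text \<open>When the matching preserves the positions from \<open>s + 1\<close> to \<open>t\<close>,
  an arc over the gap at \<open>s\<close> must pass over all of them. This is the source of the Dyck
  condition for the tiles constructed from a labelling.\<close>

lemma ht_closed:
  assumes "s \<le> t" and cl: "\<And>x. s < x \<Longrightarrow> x \<le> t \<Longrightarrow> s < \<sigma> x \<and> \<sigma> x \<le> t"
  shows "ht s = ht t" "s \<le> k \<Longrightarrow> k \<le> t \<Longrightarrow> ht s \<le> ht k"
proof -
  have sub: "cover s \<subseteq> cover k" if k: "s \<le> k" "k \<le> t" for k
  proof
    fix x assume x: "x \<in> cover s"
    have "\<not> \<sigma> x \<le> k"
      using cl[of "\<sigma> x"] x k invol[of x] by (fastforce simp: cover_def)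
    then show "x \<in> cover k" using x k by (auto simp: cover_def)
  qed
  show "ht s \<le> ht k" if "s \<le> k" "k \<le> t"
    unfolding ht_def by (rule card_mono[OF finite_cover sub[OF that]])
  have "cover t \<subseteq> cover s"
  proof
    fix x assume x: "x \<in> cover t"
    then have "\<not> s < x" using cl[of x] by (auto simp: cover_def)
    then show "x \<in> cover s" using x assms(1) by (auto simp: cover_def)
  qed
  then show "ht s = ht t" unfolding ht_def using sub[of t] assms(1) by (metis order_refl subset_antisym)
qed

lemma ht_in_arc:
  assumes "a \<in> {1..2 * n}" "a < \<sigma> a"
  shows "ht (\<sigma> a - 1) = ht a" "ht (a - 1) = ht (\<sigma> a)"
    "a \<le> k \<Longrightarrow> k < \<sigma> a \<Longrightarrow> ht a \<le> ht k"
proof -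
  have "a < \<sigma> x \<and> \<sigma> x \<le> \<sigma> a - 1" if "a < x" "x \<le> \<sigma> a - 1" for x
  proof -
    have "x < \<sigma> a" using that assms by linarith
    then show ?thesis using nested[OF that(1)] by fastforce
  qed
  note c = ht_closed[of a "\<sigma> a - 1", OF _ this]
  show e: "ht (\<sigma> a - 1) = ht a" "a \<le> k \<Longrightarrow> k < \<sigma> a \<Longrightarrow> ht a \<le> ht k" using c assms by auto
  have "\<not> \<sigma> a < \<sigma> (\<sigma> a)" using assms invol[of a] by simp
  then show "ht (a - 1) = ht (\<sigma> a)"
    using ht_Down[of "\<sigma> a"] ht_Up[OF assms] nc_matchingD(1)[OF nc assms(1)] e by simp
qed

lemma step_ht_mate:
  assumes "k \<in> {1..2 * n}"
  shows "step_ht (\<sigma> k) = step_ht k"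
proof (cases "k < \<sigma> k")
  case True
  then have "\<not> \<sigma> k < \<sigma> (\<sigma> k)" using invol[of k] by simp
  then show ?thesis
    using True step_ht_eq[OF assms] step_ht_eq[OF nc_matchingD(1)[OF nc assms]] ht_in_arc(1)[OF assms True] by simp
next
  case False
  then have "\<sigma> k < \<sigma> (\<sigma> k)" using invol[of k] nc_matchingD(2)[OF nc assms] by simp
  then show ?thesis
    using False step_ht_eq[OF assms] step_ht_eq[OF nc_matchingD(1)[OF nc assms]]
      ht_in_arc(1)[OF nc_matchingD(1)[OF nc assms]] invol[of k] by simp
qed

lemma step_ht_parity:
  assumes "k \<in> {1..2 * n}"
  shows "even (step_ht k + k) \<longleftrightarrow> k < \<sigma> k"
  using ht_parity[of k] ht_parity[of "k - 1"] assms ht_Down[OF assms] step_ht_eq[OF assms] by auto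

lemma step_ht_less:
  assumes a: "a \<in> {1..2 * n}" and b: "a < b" "b < \<sigma> a"
  shows "step_ht a < step_ht b"
proof -
  have bin: "b \<in> {1..2 * n}" using a b nc_matchingD(5)[OF nc a] by auto
  have "ht a \<le> ht b" "ht a \<le> ht (b - 1)" using ht_in_arc(3)[OF a, of b] ht_in_arc(3)[OF a, of "b - 1"] b by auto
  then show ?thesis
    using ht_Up[OF bin] ht_Down[OF bin] step_ht_eq[OF a] step_ht_eq[OF bin] b by auto
qed

lemma step_ht_bounds:
  assumes k: "k \<in> {1..2 * n}"
  shows "1 \<le> step_ht k" "step_ht k \<le> k" "step_ht k + k \<le> 2 * n + 1"
proof -
  show "1 \<le> step_ht k" using ht_Up[OF k] ht_Down[OF k] step_ht_eq[OF k] by auto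
  show "step_ht k \<le> k" "step_ht k + k \<le> 2 * n + 1"
  proof -
    have "k - 1 \<le> 2 * n" "k \<le> 2 * n" using k by auto
    then have "ht (k - 1) \<le> k - 1" "ht (k - 1) \<le> 2 * n - (k - 1)" "ht k \<le> k" "ht k \<le> 2 * n - k"
      using ht_le_lam[of k] ht_le_lam[of "k - 1"] by (simp_all add: lam_def)
    then show "step_ht k \<le> k" "step_ht k + k \<le> 2 * n + 1"
      using k unfolding step_ht_def by auto
  qed
qed

text \<open>The induction follows the innermost arc around the given one.\<close>

lemma labelling_level:
  assumes lab: "labelling n \<sigma> f" and b: "b \<in> {1..2 * n}"
  shows "step_ht b \<le> f b"
    "a \<in> {1..2 * n} \<Longrightarrow> a < b \<Longrightarrow> b < \<sigma> a \<Longrightarrow> f a + step_ht b \<le> f b + step_ht a"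
proof -
  have *: "step_ht b \<le> f b \<and> (a \<in> {1..2 * n} \<and> a < b \<and> b < \<sigma> a \<longrightarrow> f a + step_ht b \<le> f b + step_ht a)"
    if "b \<in> {1..2 * n}" "b < \<sigma> b" for a b
    using that
  proof (induction b arbitrary: a rule: less_induct)
    case (less b)
    have sb: "step_ht b = Suc (card (cover (b - 1)))"
      using step_ht_eq[OF less.prems(1)] less.prems(2) ht_Up[OF less.prems] by (simp add: ht_def)
    have cov: "x \<in> cover (b - 1) \<longleftrightarrow> x < b \<and> b < \<sigma> x" for x
      using cover_Up[OF less.prems] less.prems by (auto simp: cover_def)
    show ?case
    proof (cases "cover (b - 1) = {}")
      case True
      then have "step_ht b = 1" using sb by simp
      moreover have "\<not> (a < b \<and> b < \<sigma> a)" using True cov[of a] by blast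
      ultimately show ?thesis using labellingD(2)[OF lab less.prems(1)] by auto
    next
      case False
      define c where "c = Max (cover (b - 1))"
      have cin: "c \<in> cover (b - 1)" unfolding c_def using False by (intro Max_in) auto
      have cmax: "x \<le> c" if "x \<in> cover (b - 1)" for x unfolding c_def using that by simp
      have c: "c < b" "b < \<sigma> c" "c \<in> {1..2 * n}" using cin cov cover_pos by auto
      have "cover (b - 1) = cover c"
      proof (intro equalityI subsetI)
        fix x assume x: "x \<in> cover (b - 1)"
        then show "x \<in> cover c" using cmax[OF x] c cov[of x] by (auto simp: cover_def)
      next
        fix x assume x: "x \<in> cover c"
        show "x \<in> cover (b - 1)"
        proof (cases "x = c")
          case False
          then have "\<sigma> c < \<sigma> x" using x nested[of x c] by (auto simp: cover_def)
          then show ?thesis using x c cov by (auto simp: cover_def)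
        qed (use cin in simp)
      qed
      then have s: "step_ht b = Suc (step_ht c)"
        using sb step_ht_eq[OF c(3)] c by (simp add: ht_def)
      have f: "f c < f b" using labelling_nested[OF lab c(3,1,2)] .
      have IH: "step_ht c \<le> f c \<and> (a \<in> {1..2 * n} \<and> a < c \<and> c < \<sigma> a \<longrightarrow> f a + step_ht c \<le> f c + step_ht a)" for a
        using less.IH[OF c(1,3)] c by auto
      show ?thesis
      proof (intro conjI impI)
        show "step_ht b \<le> f b" using s f conjunct1[OF IH] by simp
        assume a: "a \<in> {1..2 * n} \<and> a < b \<and> b < \<sigma> a"
        then have "a \<le> c" using cov cmax by blast
        moreover have "c < \<sigma> a" using c a by simp
        ultimately show "f a + step_ht b \<le> f b + step_ht a"
          using IH[of a] a s f by (cases "a = c") auto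
      qed
    qed
  qed
  show "step_ht b \<le> f b"
  proof (cases "b < \<sigma> b")
    case False
    then have "\<sigma> b < \<sigma> (\<sigma> b)" using invol[of b] nc_matchingD(2)[OF nc b] by simp
    then show ?thesis
      using *[OF nc_matchingD(1)[OF nc b]] step_ht_mate[OF b] labellingD(1)[OF lab b] by simp
  qed (use * b in blast)
  show "f a + step_ht b \<le> f b + step_ht a" if a: "a \<in> {1..2 * n}" "a < b" "b < \<sigma> a"
  proof (cases "b < \<sigma> b")
    case False
    then have "\<sigma> b < \<sigma> (\<sigma> b)" using invol[of b] nc_matchingD(2)[OF nc b] by simp
    moreover have "a < \<sigma> b" "\<sigma> b < \<sigma> a" using nested[OF a(2,3)] by auto
    ultimately show ?thesis
      using *[OF nc_matchingD(1)[OF nc b], of a] a step_ht_mate[OF b] labellingD(1)[OF lab b] by simp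
  qed (use * b a in blast)
qed

end


section \<open>Cover-inclusive tilings as labellings\<close>

lemma height_top_path: "k \<le> 2 * n \<Longrightarrow> height (top_path n) k = int (min k (2 * n - k))"
  by (cases "k \<le> n") (simp_all add: height_def top_path_def take_replicate sum_list_replicate of_nat_diff)

lemma lessThan_card_if_downward_closed:
  assumes "finite S" and cl: "\<And>j::nat. Suc j \<in> S \<Longrightarrow> j \<in> S"
  shows "S = {..<card S}"
proof -
  define m where "m = (LEAST m. m \<notin> S)"
  have "\<exists>m. m \<notin> S" using assms(1) by (metis ex_new_if_finite infinite_UNIV_nat)
  then have m: "m \<notin> S" unfolding m_def by (rule LeastI_ex)
  have up: "m + i \<notin> S" for i
    by (induction i) (use m cl in auto)
  have "j \<in> S \<longleftrightarrow> j < m" for j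
  proof
    assume "j \<in> S"
    then show "j < m" using up[of "j - m"] by (cases "j < m") auto
  next
    assume "j < m"
    then show "j \<in> S" unfolding m_def using not_less_Least by blast
  qed
  then have "S = {..<m}" by auto
  then show ?thesis by simp
qed

section \<open>The boxes of the region by column and layer, and the tiles of a given tiling\<close>

context matching
begin

abbreviation path :: "step list" where
  "path \<equiv> matching_path n \<sigma>"

text \<open>The box over position \<open>k\<close> in layer \<open>j\<close>: the layers are the translates of the path by \<open>(0, 2j + 1)\<close>,
  and every tile of a cover-inclusive tiling turns out to stay within one layer.\<close>

definition box_at :: "nat \<Rightarrow> nat \<Rightarrow> box" where
  "box_at k j = (int k, int (ht k + 1 + 2 * j))"

text \<open>The centres in a column and the height of the top path there have opposite parities, so
  the strict inequality says that the top vertex of the box does not exceed the top path.\<close>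

definition in_region :: "nat \<Rightarrow> nat \<Rightarrow> bool" where
  "in_region k j \<longleftrightarrow> k \<le> 2 * n \<and> ht k + 1 + 2 * j < lam k"

lemma box_at_eq_iff [simp]: "box_at k j = box_at k' j' \<longleftrightarrow> k = k' \<and> j = j'"
  by (auto simp: box_at_def)

lemma ht_Suc: "k < 2 * n \<Longrightarrow> ht (Suc k) = Suc (ht k) \<or> ht k = Suc (ht (Suc k))"
  using ht_Up[of "Suc k"] ht_Down[of "Suc k"] by auto

lemma length_path: "length path = 2 * n"
  by (simp add: matching_path_def)

text \<open>The top and bottom vertices decide: both paths change height by one in each step, so the
  left and right vertices then lie between them as well.\<close>

lemma region_boxes_path: "region_boxes path = {box_at k j | k j. in_region k j}"
proof (intro equalityI subsetI)
  fix x assume x: "x \<in> region_boxes path"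
  obtain a b where ab: "x = (a, b)" by (cases x)
  let ?P = "\<lambda>x y. 0 \<le> x \<and> x \<le> int (2 * n) \<and> height path (nat x) \<le> y \<and> y \<le> height (top_path n) (nat x)"
  have odd: "odd (a + b)" and v: "?P (a - 1) b" "?P (a + 1) b" "?P a (b - 1)" "?P a (b + 1)"
    using x unfolding ab by (auto simp: region_boxes_def length_path)
  define k where "k = nat a"
  have a: "a = int k" "k \<le> 2 * n" using v by (auto simp: k_def)
  have b: "int (ht k) \<le> b - 1" "b + 1 \<le> int (lam k)"
    using v(3,4) a height_matching_path[OF a(2)] height_top_path[OF a(2)] by (auto simp: lam_def)
  have "even (ht k + k)" using ht_parity[OF a(2)] .
  then have "even (b - 1 - int (ht k))" using odd a by auto
  then obtain i where i: "b - 1 - int (ht k) = 2 * i" by (elim evenE)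
  define j where "j = nat i"
  have "i = int j" using i b unfolding j_def by linarith
  then have bj: "b = int (ht k + 1 + 2 * j)" using i by simp
  then have "ht k + 1 + 2 * j < lam k" using b(2) by linarith
  then have "x = box_at k j \<and> in_region k j"
    using ab a bj by (simp add: box_at_def in_region_def)
  then show "x \<in> {box_at k j | k j. in_region k j}" by blast
next
  fix x assume "x \<in> {box_at k j | k j. in_region k j}"
  then obtain k j where x: "x = box_at k j" and k: "k \<le> 2 * n" and j: "ht k + 1 + 2 * j < lam k"
    by (auto simp: in_region_def)
  define b where "b = ht k + 1 + 2 * j"
  have k1: "1 \<le> k" "Suc k \<le> 2 * n" using j by (auto simp: lam_def)
  have ab: "x = (int k, int b)" using x by (simp add: box_at_def b_def)
  have par: "even (ht k + k)" using ht_parity[OF k] .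
  then have odd: "odd (int k + int b)" by (simp add: b_def)
  have hs: "ht (k - 1) \<le> Suc (ht k)" "ht (Suc k) \<le> Suc (ht k)"
  proof -
    have "k - 1 < 2 * n" "Suc (k - 1) = k" "k < 2 * n" using k1 by auto
    then show "ht (k - 1) \<le> Suc (ht k)" "ht (Suc k) \<le> Suc (ht k)"
      using ht_Suc[of "k - 1"] ht_Suc[of k] by auto
  qed
  have ls: "lam k \<le> Suc (lam (k - 1))" "lam k \<le> Suc (lam (Suc k))"
    using k1 by (auto simp: lam_def)
  have nats: "nat (int k - 1) = k - 1" "nat (int k + 1) = Suc k" by auto
  have hp: "height path (k - 1) = int (ht (k - 1))" "height path k = int (ht k)" "height path (Suc k) = int (ht (Suc k))"
    "height (top_path n) (k - 1) = int (lam (k - 1))" "height (top_path n) k = int (lam k)"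
    "height (top_path n) (Suc k) = int (lam (Suc k))"
    unfolding lam_def using k1 by (intro height_matching_path height_top_path; simp)+
  have "ht k < b" "b < lam k" using j by (auto simp: b_def)
  then show "x \<in> region_boxes path"
    unfolding ab region_boxes_def mem_Collect_eq case_prod_conv box_vertices.simps length_path
    using odd k1 hs ls by (auto simp: nats[unfolded One_nat_def] hp[unfolded One_nat_def])
qed

lemma in_region_Suc: "in_region k (Suc j) \<Longrightarrow> in_region k j"
  by (simp add: in_region_def)

lemma in_region_pos: "in_region k j \<Longrightarrow> 1 \<le> k"
  by (simp add: in_region_def lam_def)

lemma shift_box_at: "(\<lambda>(a, b). (a, b - 2)) (box_at k (Suc j)) = box_at k j"
  by (simp add: box_at_def)

lemma box_at_shift_down: "box_at k (Suc j) \<in> d \<Longrightarrow> box_at k j \<in> shift_down d"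
  unfolding shift_down_def shift_box_at[of k j, symmetric] by (rule imageI)

text \<open>Some tile crosses the \<open>k\<close>-th step of the path in layer
  \<open>j\<close>.\<close>

definition joins :: "box set set \<Rightarrow> nat \<Rightarrow> nat \<Rightarrow> bool" where
  "joins TT k j \<longleftrightarrow> 1 \<le> k \<and> (\<exists>d\<in>TT. box_at (k - 1) j \<in> d \<and> box_at k j \<in> d)"

context
  fixes TT assumes TT: "TT \<in> cover_inclusive_tilings path"
begin

lemma tiling_partition: "partition_on (region_boxes path) TT"
  using TT by (simp add: cover_inclusive_tilings_def dyck_tiling_def)

lemma tile_box:
  assumes "d \<in> TT" "x \<in> d"
  obtains k j where "x = box_at k j" "in_region k j"
  using tiling_partition assms region_boxes_path unfolding partition_on_def by blast

lemma tile_unique: "d \<in> TT \<Longrightarrow> d' \<in> TT \<Longrightarrow> x \<in> d \<Longrightarrow> x \<in> d' \<Longrightarrow> d = d'"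
  using tiling_partition unfolding partition_on_def disjoint_def by blast

lemma tile_exists: "in_region k j \<Longrightarrow> \<exists>d\<in>TT. box_at k j \<in> d"
  using tiling_partition region_boxes_path unfolding partition_on_def by blast

text \<open>A box above the lowest layer has its translate still in the region, which rules out the
  alternative that the translated tile lies below the path.\<close>

lemma tile_cover:
  assumes "d \<in> TT" "box_at k (Suc j) \<in> d"
  shows "\<exists>d'\<in>TT. shift_down d \<subseteq> d'"
proof -
  have "in_region k (Suc j)" using assms by (metis tile_box box_at_eq_iff)
  then have "k \<le> 2 * n" by (simp add: in_region_def)
  then have "\<not> below_path path (shift_down d)"
    using box_at_shift_down[OF assms(2)] unfolding below_path_def
    by (force simp: box_at_def height_matching_path)
  then show ?thesis using TT assms(1) by (auto simp: cover_inclusive_tilings_def)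
qed

text \<open>If a tile met two layers, repeated shifting would lead to a tile with one box in layer 0
  and another box above it. Its next translate would have to lie in a tile although one of its boxes
  has left the region.\<close>

lemma tile_layer:
  assumes "d \<in> TT" "box_at k j \<in> d" "box_at k' j' \<in> d"
  shows "j' = j"
  using assms
proof (induction j arbitrary: d j')
  case 0
  show ?case
  proof (cases j')
    case (Suc i)
    then obtain d' where d': "d' \<in> TT" "shift_down d \<subseteq> d'" using tile_cover 0 by blast
    have "(int k, int (ht k + 1) - 2) \<in> d'"
      using d'(2) 0(2) by (force simp: shift_down_def box_at_def)
    then obtain k1 j1 where "(int k, int (ht k + 1) - 2) = box_at k1 j1" using tile_box[OF d'(1)] by metis
    then show ?thesis by (auto simp: box_at_def)
  qed simp
next
  case (Suc j)
  obtain d' where d': "d' \<in> TT" "shift_down d \<subseteq> d'" using tile_cover Suc.prems by blast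
  have 1: "box_at k j \<in> d'" using d'(2) Suc.prems(2) box_at_shift_down by blast
  show ?case
  proof (cases j')
    case 0
    have "(int k', int (ht k' + 1) - 2) \<in> d'"
      using d'(2) Suc.prems(3) 0 by (force simp: shift_down_def box_at_def)
    then obtain k1 j1 where "(int k', int (ht k' + 1) - 2) = box_at k1 j1" using tile_box[OF d'(1)] by metis
    then show ?thesis by (auto simp: box_at_def)
  next
    case (Suc i)
    then have "box_at k' i \<in> d'" using d'(2) Suc.prems(3) box_at_shift_down by blast
    then show ?thesis using Suc.IH[OF d'(1) 1] Suc by simp
  qed
qed

text \<open>Within one layer the centres follow the path, so the Dyck condition on a tile becomes a
  condition on the heights of the path over an interval.\<close>

lemma tile_interval:
  assumes "d \<in> TT"
  obtains s t j where "s \<le> t" "d = (\<lambda>k. box_at k j) ` {s..t}" "ht s = ht t"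
    "\<And>k. s \<le> k \<Longrightarrow> k \<le> t \<Longrightarrow> ht s \<le> ht k \<and> in_region k j"
proof -
  have "dyck_tile d" using TT assms by (simp add: cover_inclusive_tilings_def dyck_tiling_def)
  then obtain m :: nat and c :: "nat \<Rightarrow> box" where d: "d = c ` {0..2 * m}"
    and st: "\<And>k. k < 2 * m \<Longrightarrow> c (k + 1) \<in> {(fst (c k) + 1, snd (c k) + 1), (fst (c k) + 1, snd (c k) - 1)}"
    and lo: "\<And>k. k \<le> 2 * m \<Longrightarrow> snd (c 0) \<le> snd (c k)" and ends: "snd (c (2 * m)) = snd (c 0)"
    unfolding dyck_tile_def by blast
  have "c 0 \<in> d" using d by auto
  then obtain s j where s: "c 0 = box_at s j" using tile_box[OF assms] by metis
  have col: "k \<le> 2 * m \<Longrightarrow> fst (c k) = int (s + k)" for k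
  proof (induction k)
    case (Suc k)
    then show ?case using st[of k] by auto
  qed (simp add: s box_at_def)
  have c: "c k = box_at (s + k) j \<and> in_region (s + k) j" if k: "k \<le> 2 * m" for k
  proof -
    have ck: "c k \<in> d" "c 0 \<in> d" using d k by auto
    then obtain k' j' where kj: "c k = box_at k' j'" "in_region k' j'" using tile_box[OF assms] by metis
    moreover have "j' = j" using tile_layer[OF assms, of s j k' j'] ck kj s by simp
    moreover have "k' = s + k" using col[OF k] kj by (simp add: box_at_def)
    ultimately show ?thesis by simp
  qed
  show thesis
  proof (rule that[of s "s + 2 * m" j])
    have "{s..s + 2 * m} = (+) s ` {0..2 * m}" by (simp add: image_add_atLeastAtMost)
    moreover have "d = (\<lambda>k. box_at (s + k) j) ` {0..2 * m}"
      unfolding d using c by (intro image_cong) auto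
    ultimately show "d = (\<lambda>k. box_at k j) ` {s..s + 2 * m}" by (simp only: image_image)
    show "ht s = ht (s + 2 * m)" using ends c[of "2 * m"] c[of 0] by (simp add: box_at_def)
    fix k assume k: "s \<le> k" "k \<le> s + 2 * m"
    then have "k - s \<le> 2 * m" "s + (k - s) = k" by auto
    then show "ht s \<le> ht k \<and> in_region k j" using lo[of "k - s"] c[of "k - s"] c[of 0] by (simp add: box_at_def)
  qed simp
qed

lemma joins_region: "joins TT k j \<Longrightarrow> in_region k j \<and> in_region (k - 1) j \<and> k \<in> {1..2 * n}"
  unfolding joins_def by (metis atLeastAtMost_iff box_at_eq_iff in_region_def tile_box)

lemma joins_Suc:
  assumes "joins TT k (Suc j)"
  shows "joins TT k j"
proof -
  obtain d where d: "d \<in> TT" "box_at (k - 1) (Suc j) \<in> d" "box_at k (Suc j) \<in> d" and k: "1 \<le> k"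
    using assms unfolding joins_def by blast
  obtain d' where d': "d' \<in> TT" "shift_down d \<subseteq> d'" using tile_cover d by blast
  have "box_at k j \<in> d'" "box_at (k - 1) j \<in> d'"
    using d' d box_at_shift_down by blast+
  then show ?thesis using d' k unfolding joins_def by blast
qed

text \<open>A tile starts and ends at its minimal height. Having gone up at the left end of an arc
  it must come down again, which cannot happen before the right end; the reverse argument applies at
  a right end. The number of crossings is therefore a function on arcs, and it does not decrease
  inwards.\<close>

lemma joins_arc:
  assumes "joins TT k j"
  shows "min k (\<sigma> k) \<le> i \<Longrightarrow> i \<le> max k (\<sigma> k) \<Longrightarrow> joins TT i j"
proof -
  obtain d where d: "d \<in> TT" "box_at (k - 1) j \<in> d" "box_at k j \<in> d" and k: "1 \<le> k"
    using assms unfolding joins_def by blast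
  have kin: "k \<in> {1..2 * n}" using joins_region assms by blast
  obtain s t j' where st: "s \<le> t" "d = (\<lambda>k. box_at k j') ` {s..t}" "ht s = ht t"
    "\<And>k. s \<le> k \<Longrightarrow> k \<le> t \<Longrightarrow> ht s \<le> ht k \<and> in_region k j'"
    using tile_interval[OF d(1)] by metis
  have j': "j' = j" "s \<le> k - 1" "k \<le> t" using d(2,3) unfolding st(2) by auto
  have "s \<le> min k (\<sigma> k) - 1 \<and> max k (\<sigma> k) \<le> t"
  proof (cases "k < \<sigma> k")
    case True
    have "\<not> t < \<sigma> k"
    proof
      assume "t < \<sigma> k"
      then have "ht k \<le> ht t" using ht_in_arc(3)[OF kin True, of t] j' by simp
      moreover have "k - 1 \<le> t" using j'(3) by simp
      ultimately show False using ht_Up[OF kin True] st(3) st(4)[of "k - 1"] j' by simp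
    qed
    then show ?thesis using True j' by simp
  next
    case False
    let ?x = "\<sigma> k"
    have x: "?x < k" "?x \<in> {1..2 * n}" "\<sigma> ?x = k" using False nc_matchingD[OF nc kin] by auto
    have "\<not> ?x \<le> s"
    proof
      assume "?x \<le> s"
      then have "ht ?x \<le> ht s" using ht_in_arc(3)[OF x(2), of s] x j' k by simp
      moreover have "ht (k - 1) = ht ?x" using ht_in_arc(1)[OF x(2)] x by simp
      moreover have "s \<le> k" using j'(2) by simp
      ultimately show False using ht_Down[OF kin False] st(4)[of k] j' by simp
    qed
    then show ?thesis using False j' x by simp
  qed
  moreover have "1 \<le> min k (\<sigma> k)" using k nc_matchingD(4)[OF nc kin] by simp
  ultimately have mem: "1 \<le> i \<and> i - 1 \<in> {s..t} \<and> i \<in> {s..t}" if "min k (\<sigma> k) \<le> i" "i \<le> max k (\<sigma> k)"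
    unfolding atLeastAtMost_iff using that by linarith
  then show "joins TT i j" if "min k (\<sigma> k) \<le> i" "i \<le> max k (\<sigma> k)"
  proof -
    have "box_at (i - 1) j \<in> d" "box_at i j \<in> d" "1 \<le> i"
      using mem[OF that] unfolding st(2) j' by blast+
    then show ?thesis using d(1) unfolding joins_def by blast
  qed
qed

text \<open>A tile consists of the columns that can be reached from one of its boxes through crossed
  steps, so the crossings determine the tiling.\<close>

lemma tile_mem_iff:
  assumes d: "d \<in> TT" "box_at k j \<in> d"
  shows "x \<in> d \<longleftrightarrow> (\<exists>i. x = box_at i j \<and> (\<forall>y. min k i < y \<and> y \<le> max k i \<longrightarrow> joins TT y j))"
proof -
  obtain s t j' where st: "s \<le> t" "d = (\<lambda>k. box_at k j') ` {s..t}"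
    using tile_interval[OF d(1)] by metis
  have j': "j' = j" "s \<le> k" "k \<le> t" using d(2) unfolding st(2) by auto
  show ?thesis
  proof
    assume "x \<in> d"
    then obtain i where i: "x = box_at i j" "s \<le> i" "i \<le> t" unfolding st(2) j' by auto
    have "joins TT y j" if "min k i < y \<and> y \<le> max k i" for y
    proof -
      have "1 \<le> y \<and> y - 1 \<in> {s..t} \<and> y \<in> {s..t}"
        unfolding atLeastAtMost_iff using that i j' by linarith
      then have "box_at (y - 1) j \<in> d" "box_at y j \<in> d" "1 \<le> y" unfolding st(2) j' by blast+
      then show ?thesis using d(1) unfolding joins_def by blast
    qed
    then show "\<exists>i. x = box_at i j \<and> (\<forall>y. min k i < y \<and> y \<le> max k i \<longrightarrow> joins TT y j)" using i by blast
  next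
    assume "\<exists>i. x = box_at i j \<and> (\<forall>y. min k i < y \<and> y \<le> max k i \<longrightarrow> joins TT y j)"
    then obtain i where x: "x = box_at i j" and J: "\<And>y. min k i < y \<Longrightarrow> y \<le> max k i \<Longrightarrow> joins TT y j" by blast
    have step: "box_at (y - 1) j \<in> d \<longleftrightarrow> box_at y j \<in> d" if y: "joins TT y j" for y
      using y d(1) tile_unique unfolding joins_def by blast
    have up: "i = k + m \<Longrightarrow> box_at i j \<in> d" for m
      using J
    proof (induction m arbitrary: i)
      case 0 then show ?case using d by simp
    next
      case (Suc m)
      have "box_at (k + m) j \<in> d" using Suc by (intro Suc.IH) auto
      then show ?case using step[of i] Suc.prems by simp
    qed
    have dn: "k = i + m \<Longrightarrow> box_at i j \<in> d" for m
      using J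
    proof (induction m arbitrary: i)
      case 0 then show ?case using d by simp
    next
      case (Suc m)
      have "box_at (Suc i) j \<in> d" using Suc.prems by (intro Suc.IH) auto
      then show ?case using step[of "Suc i"] Suc.prems by simp
    qed
    show "x \<in> d" using up[of "i - k"] dn[of "k - i"] x by (cases "k \<le> i") auto
  qed
qed

end

end


section \<open>Weights of single boxes and of columns\<close>

definition box_weight :: "nat \<Rightarrow> cq" where
  "box_weight b = qint (int b) / qint (int b + 1)"

text \<open>The heights \<open>b\<close> with \<open>odd (k + b)\<close> are those of box centres in
  column \<open>k\<close>; the product runs over those below \<open>a\<close>, whether or not they
  belong to the region.\<close>

definition column_weight :: "nat \<Rightarrow> nat \<Rightarrow> cq" where
  "column_weight k a = (\<Prod>b | 1 \<le> b \<and> b < a \<and> odd (k + b). box_weight b)"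

text \<open>The weight of all boxes between the axis and the top path, the constant
  \<open>c_n\<close> of the overview.\<close>

definition total_weight :: "nat \<Rightarrow> cq" where
  "total_weight n = (\<Prod>k\<in>{1..2 * n}. column_weight k (min k (2 * n - k)))"

definition tiling_sum :: "step list \<Rightarrow> cq" where
  "tiling_sum \<mu> = (\<Sum>TT\<in>cover_inclusive_tilings \<mu>. \<Prod>d\<in>TT. qint (tile_height d) / qint (tile_height d + 1))"

text \<open>The two columns carry heights of complementary parity, so together they contain every
  height below \<open>a\<close> once and the quotients telescope. A single column alone does not
  telescope.\<close>

lemma column_weight_opposite:
  assumes "1 \<le> a" and "\<And>b. odd (k + b) \<longleftrightarrow> even (l + b)"
  shows "column_weight k a * column_weight l a = 1 / qint (int a)"
proof -
  let ?A = "\<lambda>k. {b. 1 \<le> b \<and> b < a \<and> odd (k + b)}"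
  have "{1..<a} = ?A k \<union> ?A l" unfolding assms(2) by auto
  moreover have "?A k \<inter> ?A l = {}" unfolding assms(2) by auto
  moreover have "finite (?A i)" for i by (rule finite_subset[of _ "{..<a}"]) auto
  ultimately have "column_weight k a * column_weight l a = (\<Prod>b\<in>{1..<a}. box_weight b)"
    unfolding column_weight_def by (simp add: prod.union_disjoint)
  also have "\<dots> = 1 / qint (int a)"
    using assms(1)
  proof (induction a rule: dec_induct)
    case (step a)
    then have "qint (int a) \<noteq> 0" by (intro qint_nonzero) auto
    then show ?case using step by (simp add: box_weight_def add.commute)
  qed simp
  finally show ?thesis .
qed

section \<open>From a tiling to its labelling\<close>

context matching
begin

lemma prod_arcs: "(\<Prod>k\<in>{1..2 * n}. G k) = arc_prod n \<sigma> (\<lambda>x. G x * G (\<sigma> x))"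
proof -
  let ?U = "{k. k \<in> {1..2 * n} \<and> k < \<sigma> k}" and ?D = "{k. k \<in> {1..2 * n} \<and> \<sigma> k < k}"
  have "k < \<sigma> k \<or> \<sigma> k < k" if "k \<in> {1..2 * n}" for k
    using nc_matchingD(2)[OF nc that] by linarith
  then have "{1..2 * n} = ?U \<union> ?D" by blast
  then have "(\<Prod>k\<in>{1..2 * n}. G k) = prod G (?U \<union> ?D)" by (rule arg_cong)
  also have "\<dots> = prod G ?U * prod G ?D" by (rule prod.union_disjoint) auto
  also have "prod G ?D = (\<Prod>k\<in>?U. G (\<sigma> k))"
    by (rule prod.reindex_bij_witness[of _ \<sigma> \<sigma>]) (use nc_matchingD[OF nc] in auto)
  finally show ?thesis by (simp add: arc_prod_def prod.distrib)
qed

lemma joins_range: "TT \<in> cover_inclusive_tilings path \<Longrightarrow> joins TT k j \<Longrightarrow> k \<in> {1..2 * n}"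
  using joins_region by blast

definition tiling_label :: "box set set \<Rightarrow> nat \<Rightarrow> nat" where
  "tiling_label TT k = (if k \<in> {1..2 * n} then step_ht k + 2 * card {j. joins TT k j} else 0)"

text \<open>By cover-inclusion the layers in which a step is crossed form an initial segment, so
  their number determines them.\<close>

lemma joins_iff:
  assumes TT: "TT \<in> cover_inclusive_tilings path" and k: "k \<in> {1..2 * n}"
  shows "joins TT k j \<longleftrightarrow> step_ht k + 2 * j < tiling_label TT k"
proof -
  have "{j. joins TT k j} \<subseteq> {..2 * n}"
  proof
    fix j assume "j \<in> {j. joins TT k j}"
    then have "in_region k j" using joins_region[OF TT] by blast
    then show "j \<in> {..2 * n}" by (simp add: in_region_def lam_def)
  qed
  then have "finite {j. joins TT k j}" by (rule finite_subset) simp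
  then have "{j. joins TT k j} = {..<card {j. joins TT k j}}"
    by (rule lessThan_card_if_downward_closed) (use joins_Suc[OF TT] in auto)
  then have "joins TT k j \<longleftrightarrow> j < card {j. joins TT k j}" by blast
  then show ?thesis using k by (simp add: tiling_label_def)
qed

lemma labelling_tiling_label:
  assumes TT: "TT \<in> cover_inclusive_tilings path"
  shows "labelling n \<sigma> (tiling_label TT)"
proof -
  have mate: "{j. joins TT (\<sigma> k) j} = {j. joins TT k j}" for k
    using joins_arc[OF TT, of k _ "\<sigma> k"] joins_arc[OF TT, of "\<sigma> k" _ k] invol[of k] by auto
  show ?thesis
    unfolding labelling_def
  proof (intro conjI ballI allI impI)
    fix k assume k: "k \<in> {1..2 * n}"
    note sb = step_ht_bounds[OF k]
    show "tiling_label TT (\<sigma> k) = tiling_label TT k"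
      using mate step_ht_mate[OF k] k nc_matchingD(1)[OF nc k] by (simp add: tiling_label_def)
    show "1 \<le> tiling_label TT k" using sb k by (simp add: tiling_label_def)
    show "even (tiling_label TT k + k) = (k < \<sigma> k)"
      using step_ht_parity[OF k] k by (simp add: tiling_label_def)
    \<comment> \<open>The highest crossing has a box of the region on each side of the step; the one
      over the higher end of the step gives both bounds.\<close>
    have "tiling_label TT k \<le> k \<and> tiling_label TT k + k \<le> 2 * n + 1"
    proof (cases "card {j. joins TT k j}")
      case 0
      then show ?thesis using sb k by (simp add: tiling_label_def)
    next
      case (Suc g)
      then have "joins TT k g" using joins_iff[OF TT k, of g] k by (simp add: tiling_label_def)
      then have "in_region k g" "in_region (k - 1) g" using joins_region[OF TT] by blast+
      then have "ht k + 1 + 2 * g < k" "ht k + 1 + 2 * g < 2 * n - k"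
        "ht (k - 1) + 1 + 2 * g < k - 1" "ht (k - 1) + 1 + 2 * g < 2 * n - (k - 1)"
        by (simp_all add: in_region_def lam_def)
      moreover have "tiling_label TT k = max (ht (k - 1)) (ht k) + 2 * g + 2"
        using Suc k by (simp add: tiling_label_def step_ht_def)
      ultimately show ?thesis using k by (auto simp: max_def)
    qed
    then show "tiling_label TT k \<le> k" "tiling_label TT k + k \<le> 2 * n + 1" by auto
  next
    fix k assume "k \<notin> {1..2 * n}"
    then show "tiling_label TT k = 0" unfolding tiling_label_def by (rule if_not_P)
  next
    fix a b assume a: "a \<in> {1..2 * n}" and ab: "a < b \<and> b < \<sigma> a"
    have b: "b \<in> {1..2 * n}" using a ab nc_matchingD(5)[OF nc a] by auto
    have s: "step_ht a < step_ht b" using step_ht_less a ab by blast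
    show "tiling_label TT a < tiling_label TT b"
    proof (cases "card {j. joins TT a j}")
      case 0
      then show ?thesis using s a b by (simp add: tiling_label_def)
    next
      case (Suc g)
      then have "joins TT a g" using joins_iff[OF TT a, of g] a by (simp add: tiling_label_def)
      then have "joins TT b g" using joins_arc[OF TT, of a g b] ab by auto
      then have "g < card {j. joins TT b j}" using joins_iff[OF TT b, of g] b by (simp add: tiling_label_def)
      then show ?thesis using Suc s a b by (simp add: tiling_label_def)
    qed
  qed
qed

text \<open>Equal labels mean equal crossings, and the crossings determine the tiles. Inclusion in
  one direction is enough by symmetry.\<close>

lemma inj_tiling_label: "inj_on tiling_label (cover_inclusive_tilings path)"
proof -
  have sub: "TT \<subseteq> TT'" if TT: "TT \<in> cover_inclusive_tilings path" "TT' \<in> cover_inclusive_tilings path"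
    and eq: "tiling_label TT = tiling_label TT'" for TT TT'
  proof
    fix d assume d: "d \<in> TT"
    have J: "joins TT k j \<longleftrightarrow> joins TT' k j" for k j
      using joins_iff[OF TT(1), of k j] joins_iff[OF TT(2), of k j] eq
        joins_range[OF TT(1)] joins_range[OF TT(2)] by metis
    have "d \<noteq> {}" using tiling_partition[OF TT(1)] d by (auto simp: partition_on_def)
    then obtain x where "x \<in> d" by blast
    then obtain k j where kj: "box_at k j \<in> d" "in_region k j" using tile_box[OF TT(1) d] by metis
    then obtain d' where d': "d' \<in> TT'" "box_at k j \<in> d'" using tile_exists[OF TT(2)] by blast
    have "d = d'"
      using tile_mem_iff[OF TT(1) d kj(1)] tile_mem_iff[OF TT(2) d'] by (auto simp: J)
    then show "d \<in> TT'" using d' by simp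
  qed
  show ?thesis by (rule inj_onI) (metis sub subset_antisym)
qed

section \<open>From a labelling to its tiling\<close>

definition linked :: "(nat \<Rightarrow> nat) \<Rightarrow> nat \<Rightarrow> nat \<Rightarrow> bool" where
  "linked f k j \<longleftrightarrow> k \<in> {1..2 * n} \<and> step_ht k + 2 * j < f k"

text \<open>The columns connected to \<open>k\<close> through steps that the labelling asks to be
  crossed in layer \<open>j\<close>. They are the columns of the tile through the box at
  \<open>k\<close>.\<close>

definition run :: "(nat \<Rightarrow> nat) \<Rightarrow> nat \<Rightarrow> nat \<Rightarrow> nat set" where
  "run f k j = {i. \<forall>y. min k i < y \<and> y \<le> max k i \<longrightarrow> linked f y j}"

definition tiling_of :: "(nat \<Rightarrow> nat) \<Rightarrow> box set set" where
  "tiling_of f = {(\<lambda>i. box_at i j) ` run f k j | k j. in_region k j}"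

lemma run_self: "k \<in> run f k j"
  by (auto simp: run_def)

lemma run_sym: "i \<in> run f k j \<longleftrightarrow> k \<in> run f i j"
  by (simp add: run_def min.commute max.commute)

lemma run_trans:
  assumes "i \<in> run f k j" "l \<in> run f i j"
  shows "l \<in> run f k j"
  unfolding run_def mem_Collect_eq
proof (intro allI impI)
  fix y assume "min k l < y \<and> y \<le> max k l"
  then have "min k i < y \<and> y \<le> max k i \<or> min i l < y \<and> y \<le> max i l" by (auto simp: min_def max_def split: if_splits)
  then show "linked f y j" using assms by (auto simp: run_def)
qed

lemma run_eq: "i \<in> run f k j \<Longrightarrow> run f i j = run f k j"
  using run_trans run_sym by blast

lemma linked_between:
  assumes "s \<in> run f k j" "t \<in> run f k j" "s < x" "x \<le> t"
  shows "linked f x j"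
proof -
  have "t \<in> run f s j" using assms run_eq[OF assms(1)] by simp
  then show ?thesis using assms(3,4) by (auto simp: run_def)
qed

lemma run_extend:
  "t \<in> run f k j \<Longrightarrow> linked f (Suc t) j \<Longrightarrow> Suc t \<in> run f k j"
  "Suc t \<in> run f k j \<Longrightarrow> linked f (Suc t) j \<Longrightarrow> t \<in> run f k j"
proof -
  assume l: "linked f (Suc t) j"
  have 1: "Suc t \<in> run f t j"
    unfolding run_def mem_Collect_eq
  proof (intro allI impI)
    fix y assume "min t (Suc t) < y \<and> y \<le> max t (Suc t)"
    then have "y = Suc t" by simp
    then show "linked f y j" using l by simp
  qed
  show "t \<in> run f k j \<Longrightarrow> Suc t \<in> run f k j" using run_trans 1 by blast
  show "Suc t \<in> run f k j \<Longrightarrow> t \<in> run f k j" using run_trans 1 run_sym by blast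
qed

lemma run_convex: "s \<in> run f k j \<Longrightarrow> t \<in> run f k j \<Longrightarrow> s \<le> x \<Longrightarrow> x \<le> t \<Longrightarrow> x \<in> run f k j"
proof (induction x)
  case (Suc x)
  show ?case
  proof (cases "s = Suc x")
    case False
    then have "x \<in> run f k j" using Suc by simp
    moreover have "linked f (Suc x) j" using linked_between[OF Suc.prems(1,2), of "Suc x"] False Suc.prems by simp
    ultimately show ?thesis by (rule run_extend)
  qed (use Suc in simp)
qed simp

lemma run_interval:
  obtains s t where "run f k j = {s..t}" "s \<le> k" "k \<le> t"
proof -
  let ?R = "run f k j"
  have "?R \<subseteq> {..max k (2 * n)}"
  proof
    fix i assume i: "i \<in> ?R"
    show "i \<in> {..max k (2 * n)}"
    proof (cases "i \<le> k")
      case False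
      then have "linked f i j" using i by (auto simp: run_def)
      then show ?thesis by (auto simp: linked_def)
    qed simp
  qed
  then have fin: "finite ?R" by (rule finite_subset) simp
  have ne: "?R \<noteq> {}" using run_self[of k f j] by blast
  have "?R = {Min ?R..Max ?R}"
  proof (intro equalityI subsetI)
    show "x \<in> {Min ?R..Max ?R}" if "x \<in> ?R" for x using fin that by simp
    show "x \<in> ?R" if "x \<in> {Min ?R..Max ?R}" for x
      using run_convex[OF Min_in[OF fin ne] Max_in[OF fin ne]] that unfolding atLeastAtMost_iff by blast
  qed
  moreover have "Min ?R \<le> k" "k \<le> Max ?R" using fin run_self by auto
  ultimately show thesis by (rule that)
qed

context
  fixes f assumes lab: "labelling n \<sigma> f"
begin

lemma label_diff_even: "k \<in> {1..2 * n} \<Longrightarrow> even (f k + step_ht k)"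
  using labellingD(5)[OF lab, of k] step_ht_parity[of k] by auto

text \<open>By \<open>labelling_level\<close> the excess of the label over the depth does not
  decrease inwards. A layer crossed at one end of an arc is thus crossed at the other end and at
  every step underneath.\<close>

lemma linked_arc:
  assumes y: "linked f y j" and i: "min y (\<sigma> y) \<le> i" "i \<le> max y (\<sigma> y)"
  shows "linked f i j"
proof -
  have yin: "y \<in> {1..2 * n}" and ly: "step_ht y + 2 * j < f y" using y by (auto simp: linked_def)
  note yin' = nc_matchingD[OF nc yin]
  have \<sigma>y: "step_ht (\<sigma> y) = step_ht y" "f (\<sigma> y) = f y"
    using step_ht_mate[OF yin] labellingD(1)[OF lab yin] by auto
  have iin: "i \<in> {1..2 * n}" using i yin yin' by auto
  consider "i = y" | "i = \<sigma> y" | "y < i" "i < \<sigma> y" | "\<sigma> y < i" "i < \<sigma> (\<sigma> y)"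
    using i yin'(2,3) by (cases "y < \<sigma> y") fastforce+
  then show ?thesis
  proof cases
    case 3
    then show ?thesis using labelling_level(2)[OF lab iin yin] ly iin by (simp add: linked_def)
  next
    case 4
    then show ?thesis using labelling_level(2)[OF lab iin yin'(1)] ly iin \<sigma>y by (simp add: linked_def)
  qed (use y ly iin \<sigma>y in \<open>auto simp: linked_def\<close>)
qed

text \<open>The excess is even, hence at least \<open>2 * j + 2\<close>. This leaves room below the
  top path for the boxes on both sides of the step.\<close>

lemma linked_region:
  assumes "linked f k j"
  shows "in_region k j \<and> in_region (k - 1) j"
proof -
  have k: "k \<in> {1..2 * n}" and l: "step_ht k + 2 * j < f k" using assms by (auto simp: linked_def)
  have l2: "step_ht k + 2 * j + 2 \<le> f k" 
  proof -
    have "f k \<noteq> step_ht k + 2 * j + 1" using label_diff_even[OF k] by auto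
    then show ?thesis using l by linarith
  qed
  have b: "f k \<le> k" "f k + k \<le> 2 * n + 1" using labellingD[OF lab k] by auto
  have b': "f k \<le> \<sigma> k" "f k + \<sigma> k \<le> 2 * n + 1"
    using labellingD[OF lab nc_matchingD(1)[OF nc k]] labellingD(1)[OF lab k] by auto
  show ?thesis
  proof (cases "k < \<sigma> k")
    case True
    then show ?thesis using l2 b b' ht_Up[OF k] step_ht_eq[OF k] k by (auto simp: in_region_def lam_def)
  next
    case False
    then have "\<sigma> k < k" using nc_matchingD(2)[OF nc k] by simp
    then show ?thesis using l2 b b' ht_Down[OF k] step_ht_eq[OF k] False k by (auto simp: in_region_def lam_def)
  qed
qed

lemma run_region: "in_region k j \<Longrightarrow> i \<in> run f k j \<Longrightarrow> in_region i j"
proof -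
  assume k: "in_region k j" and i: "i \<in> run f k j"
  consider "i = k" | "k < i" | "i < k" by linarith
  then show "in_region i j"
  proof cases
    case 2
    then have "linked f i j" using i by (auto simp: run_def)
    then show ?thesis using linked_region by blast
  next
    case 3
    then have "linked f (Suc i) j" using i by (auto simp: run_def)
    then show ?thesis using linked_region by fastforce
  qed (use k in simp)
qed

text \<open>The run is maximal: if the arc of one of its steps left the interval, the next step
  outside would be linked as well and the run could be extended. Hence the steps are matched among
  themselves, and the heights at both ends are equal and minimal.\<close>

lemma dyck_tile_run:
  assumes k: "in_region k j"
  shows "dyck_tile ((\<lambda>i. box_at i j) ` run f k j)"
proof -
  obtain s t where st: "run f k j = {s..t}" "s \<le> k" "k \<le> t" by (rule run_interval)
  have mem: "s \<in> run f k j" "t \<in> run f k j" using st by auto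
  have t2n: "t \<le> 2 * n" using run_region[OF k mem(2)] by (simp add: in_region_def)
  have closed: "s < \<sigma> x \<and> \<sigma> x \<le> t" if x: "s < x" "x \<le> t" for x
  proof -
    have lx: "linked f x j" using linked_between[OF mem x] .
    show ?thesis
    proof (rule ccontr)
      assume "\<not> ?thesis"
      then consider "\<sigma> x \<le> s" | "t < \<sigma> x" by linarith
      then show False
      proof cases
        case 1
        then have ls: "linked f s j" using linked_arc[OF lx, of s] x by auto
        then obtain s' where s': "s = Suc s'" by (cases s) (auto simp: linked_def)
        then have "s' \<in> run f k j" using run_extend(2) ls mem by blast
        then show False using st s' by simp
      next
        case 2
        then have "linked f (Suc t) j" using linked_arc[OF lx, of "Suc t"] x by auto
        then have "Suc t \<in> run f k j" using run_extend(1) mem by blast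
        then show False using st by simp
      qed
    qed
  qed
  have h: "ht s = ht t" "\<And>k. s \<le> k \<Longrightarrow> k \<le> t \<Longrightarrow> ht s \<le> ht k"
    using ht_closed[of s t] closed st by auto
  have "even (t - s)" using ht_parity[of s] ht_parity[of t] h t2n st by (simp add: even_diff_nat)
  then obtain m where m: "t - s = 2 * m" by (elim evenE)
  then have t: "t = s + 2 * m" using st by linarith
  show ?thesis
    unfolding dyck_tile_def
  proof (intro exI conjI allI impI)
    have "{s..s + 2 * m} = (+) s ` {0..2 * m}" by (simp add: image_add_atLeastAtMost)
    then show "(\<lambda>i. box_at i j) ` run f k j = (\<lambda>i. box_at (s + i) j) ` {0..2 * m}"
      unfolding st(1) t by (simp only: image_image)
    fix i
    show "box_at (s + (i + 1)) j \<in> {(fst (box_at (s + i) j) + 1, snd (box_at (s + i) j) + 1),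
       (fst (box_at (s + i) j) + 1, snd (box_at (s + i) j) - 1)}" if "i < 2 * m"
      using ht_Suc[of "s + i"] that t t2n by (auto simp: box_at_def)
    show "snd (box_at (s + 0) j) \<le> snd (box_at (s + i) j)" if "i \<le> 2 * m"
      using h(2)[of "s + i"] that t by (simp add: box_at_def)
    show "snd (box_at (s + 2 * m) j) = snd (box_at (s + 0) j)"
      using h(1) t by (simp add: box_at_def)
  qed
qed

lemma tiling_of_cover_inclusive: "tiling_of f \<in> cover_inclusive_tilings path"
proof -
  have part: "partition_on (region_boxes path) (tiling_of f)"
  proof (rule partition_onI)
    show "\<Union> (tiling_of f) = region_boxes path"
    proof (intro equalityI subsetI)
      fix x assume "x \<in> \<Union> (tiling_of f)"
      then obtain k j i where "in_region k j" "i \<in> run f k j" "x = box_at i j"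
        unfolding tiling_of_def by blast
      then show "x \<in> region_boxes path" unfolding region_boxes_path using run_region by blast
    next
      fix x assume "x \<in> region_boxes path"
      then obtain k j where "x = box_at k j" "in_region k j" unfolding region_boxes_path by blast
      then show "x \<in> \<Union> (tiling_of f)" unfolding tiling_of_def using run_self by blast
    qed
    show "disjnt p q" if pq: "p \<in> tiling_of f" "q \<in> tiling_of f" "p \<noteq> q" for p q
    proof (rule ccontr)
      assume "\<not> disjnt p q"
      then obtain x where x: "x \<in> p" "x \<in> q" by (auto simp: disjnt_def)
      obtain k j k' j' where p: "p = (\<lambda>i. box_at i j) ` run f k j" and q: "q = (\<lambda>i. box_at i j') ` run f k' j'"
        using pq(1,2) unfolding tiling_of_def by blast
      obtain i where i: "x = box_at i j" "i \<in> run f k j" using x p by blast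
      then have "j' = j" "i \<in> run f k' j" using x q by auto
      then show False using pq(3) p q i run_eq by metis
    qed
    show "{} \<notin> tiling_of f"
      using run_self by (fastforce simp: tiling_of_def)
  qed
  have cover: "below_path path (shift_down d) \<or> (\<exists>d'\<in>tiling_of f. shift_down d \<subseteq> d')" if d: "d \<in> tiling_of f" for d
  proof -
    obtain k j where kj: "in_region k j" and d: "d = (\<lambda>i. box_at i j) ` run f k j"
      using d by (auto simp: tiling_of_def)
    show ?thesis
    proof (cases j)
      case 0
      have "i \<le> 2 * n" if "i \<in> run f k j" for i
        using run_region[OF kj that] by (simp add: in_region_def)
      then have "below_path path (shift_down d)"
        unfolding below_path_def shift_down_def d 0 by (auto simp: box_at_def height_matching_path)
      then show ?thesis by blast
    next
      case (Suc j')
      \<comment> \<open>A step crossed in layer \<open>Suc j'\<close> is also crossed in layer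
        \<open>j'\<close>, which gives cover-inclusion.\<close>
      have "run f k (Suc j') \<subseteq> run f k j'" unfolding run_def linked_def by fastforce
      then have "shift_down d \<subseteq> (\<lambda>i. box_at i j') ` run f k j'"
        unfolding shift_down_def d Suc image_image shift_box_at by blast
      moreover have "in_region k j'" using kj Suc in_region_Suc by blast
      ultimately show ?thesis by (auto simp: tiling_of_def)
    qed
  qed
  have "dyck_tile d" if "d \<in> tiling_of f" for d
    using that dyck_tile_run by (auto simp: tiling_of_def)
  then show ?thesis using part cover by (simp add: cover_inclusive_tilings_def dyck_tiling_def)
qed

lemma joins_tiling_of: "joins (tiling_of f) k j \<longleftrightarrow> linked f k j"
proof
  assume "joins (tiling_of f) k j"
  then obtain k0 j0 where k: "1 \<le> k" and "box_at (k - 1) j \<in> (\<lambda>i. box_at i j0) ` run f k0 j0"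
    "box_at k j \<in> (\<lambda>i. box_at i j0) ` run f k0 j0"
    unfolding joins_def tiling_of_def by blast
  then have "k - 1 \<in> run f k0 j" "k \<in> run f k0 j" by auto
  then show "linked f k j" using linked_between[of "k - 1" f k0 j k k] k by simp
next
  assume l: "linked f k j"
  then have k: "1 \<le> k" by (simp add: linked_def)
  have "k - 1 \<in> run f k j"
    using run_extend(2)[of "k - 1" f k j] l k run_self[of k f j] by simp
  moreover have "in_region k j" using linked_region[OF l] by blast
  ultimately show "joins (tiling_of f) k j"
    unfolding joins_def tiling_of_def using k run_self[of k f j] by blast
qed

lemma tiling_label_tiling_of: "tiling_label (tiling_of f) = f"
proof
  fix k
  show "tiling_label (tiling_of f) k = f k"
  proof (cases "k \<in> {1..2 * n}")
    case True
    obtain g where g: "f k = step_ht k + 2 * g"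
    proof -
      have "even (f k - step_ht k)" using label_diff_even[OF True] by (simp add: even_diff_nat)
      then obtain g where "f k - step_ht k = 2 * g" by (elim evenE)
      then have "f k = step_ht k + 2 * g" using labelling_level(1)[OF lab True] by linarith
      then show thesis by (rule that)
    qed
    have "{j. joins (tiling_of f) k j} = {..<g}"
      unfolding joins_tiling_of linked_def g using True by auto
    then show ?thesis using True g by (simp add: tiling_label_def)
  next
    case False
    have "tiling_label (tiling_of f) k = 0" unfolding tiling_label_def using False by (rule if_not_P)
    then show ?thesis using labelling_zero[OF lab False] by simp
  qed
qed

end

lemma bij_tiling_label:
  "bij_betw tiling_label (cover_inclusive_tilings path) {f. labelling n \<sigma> f}"
  unfolding bij_betw_def
proof (intro conjI equalityI subsetI)
  show "inj_on tiling_label (cover_inclusive_tilings path)" by (rule inj_tiling_label)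
  show "f \<in> {f. labelling n \<sigma> f}" if "f \<in> tiling_label ` cover_inclusive_tilings path" for f
    using that labelling_tiling_label by auto
  show "f \<in> tiling_label ` cover_inclusive_tilings path" if "f \<in> {f. labelling n \<sigma> f}" for f
    using that tiling_of_cover_inclusive[of f] tiling_label_tiling_of[of f] by (metis image_eqI mem_Collect_eq)
qed

text \<open>Every tile is indexed by its leftmost box, the one not joined to the column before. A
  tile starts at its lowest height, so this box has the height of the tile.\<close>

lemma tile_weights:
  assumes TT: "TT \<in> cover_inclusive_tilings path"
  shows "(\<Prod>d\<in>TT. qint (tile_height d) / qint (tile_height d + 1)) =
    (\<Prod>(k, j) | in_region k j \<and> \<not> joins TT k j. box_weight (ht k + 1 + 2 * j))"
proof -
  define T where "T = (\<lambda>(k, j). THE d. d \<in> TT \<and> box_at k j \<in> d)"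
  let ?E = "{(k, j). in_region k j \<and> \<not> joins TT k j}"
  have T: "T (k, j) \<in> TT" "box_at k j \<in> T (k, j)" if "in_region k j" for k j
  proof -
    have "\<exists>!d. d \<in> TT \<and> box_at k j \<in> d" using tile_exists[OF TT that] tile_unique[OF TT] by blast
    then have "T (k, j) \<in> TT \<and> box_at k j \<in> T (k, j)" unfolding T_def prod.case by (rule theI')
    then show "T (k, j) \<in> TT" "box_at k j \<in> T (k, j)" by auto
  qed
  have leftmost: "k \<le> k'" if "in_region k j" "\<not> joins TT k j" "box_at k' j \<in> T (k, j)" for k k' j
  proof (rule ccontr)
    assume "\<not> k \<le> k'"
    then have "joins TT k j" using tile_mem_iff[OF TT T[OF that(1)], of "box_at k' j"] that(3) by auto
    then show False using that by simp
  qed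
  have inj: "inj_on T ?E"
  proof (rule inj_onI, clarsimp)
    fix k j k' j' assume 1: "in_region k j" "\<not> joins TT k j" and 2: "in_region k' j'" "\<not> joins TT k' j'"
      and eq: "T (k, j) = T (k', j')"
    have "j' = j" using tile_layer[OF TT T[OF 1(1)], of k' j'] T(2)[OF 2(1)] eq by simp
    moreover have "k \<le> k'" using leftmost[OF 1, of k'] T(2)[OF 2(1)] eq calculation by simp
    moreover have "k' \<le> k" using leftmost[OF 2, of k] T(2)[OF 1(1)] eq calculation(1) by simp
    ultimately show "k = k' \<and> j = j'" by simp
  qed
  have left: "\<exists>k j. d = T (k, j) \<and> in_region k j \<and> \<not> joins TT k j \<and> tile_height d = int (ht k + 1 + 2 * j)"
    if d: "d \<in> TT" for d
  proof -
    obtain s t j where st: "s \<le> t" "d = (\<lambda>k. box_at k j) ` {s..t}" "ht s = ht t"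
      "\<And>k. s \<le> k \<Longrightarrow> k \<le> t \<Longrightarrow> ht s \<le> ht k \<and> in_region k j"
      using tile_interval[OF TT d] by metis
    have sd: "box_at s j \<in> d" "in_region s j" using st by auto
    have e: "d = T (s, j)" using tile_unique[OF TT d T(1)] sd T(2) by blast
    have "\<not> joins TT s j"
    proof
      assume "joins TT s j"
      then obtain d' where "d' \<in> TT" "box_at (s - 1) j \<in> d'" "box_at s j \<in> d'" "1 \<le> s"
        unfolding joins_def by blast
      then have "box_at (s - 1) j \<in> d" using tile_unique[OF TT d] sd by blast
      then show False using \<open>1 \<le> s\<close> unfolding st(2) by auto
    qed
    moreover have "tile_height d = int (ht s + 1 + 2 * j)"
      unfolding tile_height_def
    proof (rule Min_eqI)
      show "finite (snd ` d)" unfolding st(2) by simp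
      show "int (ht s + 1 + 2 * j) \<in> snd ` d" using sd(1) by (force simp: box_at_def)
      show "int (ht s + 1 + 2 * j) \<le> y" if "y \<in> snd ` d" for y
        using that st(4) unfolding st(2) by (auto simp: box_at_def)
    qed
    ultimately show ?thesis using e sd by blast
  qed
  have "bij_betw T ?E TT"
    unfolding bij_betw_def
  proof (intro conjI equalityI subsetI)
    show "d \<in> TT" if "d \<in> T ` ?E" for d using that T(1) by blast
    show "d \<in> T ` ?E" if "d \<in> TT" for d using left[OF that] by blast
  qed (rule inj)
  then have "(\<Prod>d\<in>TT. qint (tile_height d) / qint (tile_height d + 1)) =
      (\<Prod>x\<in>?E. qint (tile_height (T x)) / qint (tile_height (T x) + 1))"
    by (rule prod.reindex_bij_betw[symmetric])
  also have "\<dots> = (\<Prod>(k, j)\<in>?E. box_weight (ht k + 1 + 2 * j))"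
  proof (rule prod.cong[OF refl])
    fix x assume x: "x \<in> ?E"
    obtain k j where kj: "x = (k, j)" by (cases x)
    then have r: "in_region k j" "\<not> joins TT k j" using x by auto
    obtain k' j' where k': "T (k, j) = T (k', j')" "in_region k' j'" "\<not> joins TT k' j'"
      "tile_height (T (k, j)) = int (ht k' + 1 + 2 * j')"
      using left[OF T(1)[OF r(1)]] by blast
    then have "(k, j) = (k', j')" using inj_onD[OF inj k'(1)] r by simp
    then have "tile_height (T (k, j)) = int (ht k + 1 + 2 * j)" using k'(4) by simp
    then show "qint (tile_height (T x)) / qint (tile_height (T x) + 1) =
        (case x of (k, j) \<Rightarrow> box_weight (ht k + 1 + 2 * j))"
      unfolding kj box_weight_def by simp
  qed
  finally show ?thesis .
qed

text \<open>The boxes of column \<open>k\<close> that are not joined to the left are those of height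
  at least \<open>f k\<close>, so their weight is a quotient of two column weights. The numerators
  multiply to \<open>total_weight\<close>; the denominators are paired along the arcs, each pair
  giving \<open>1 / [f k]\<close>.\<close>

lemma tiling_weight_label:
  assumes TT: "TT \<in> cover_inclusive_tilings path"
  shows "(\<Prod>d\<in>TT. qint (tile_height d) / qint (tile_height d + 1)) =
    total_weight n * arc_prod n \<sigma> (\<lambda>k. qint (int (tiling_label TT k)))"
proof -
  define f where "f = tiling_label TT"
  have lab: "labelling n \<sigma> f" unfolding f_def by (rule labelling_tiling_label[OF TT])
  let ?J = "\<lambda>k. {j. in_region k j \<and> \<not> joins TT k j}"
  let ?B = "\<lambda>k. {b. f k \<le> b \<and> b < lam k \<and> odd (k + b)}"
  have E: "{(k, j). in_region k j \<and> \<not> joins TT k j} = Sigma {1..2 * n} ?J"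
    using in_region_pos by (auto simp: in_region_def)
  have finJ: "finite (?J k)" for k
    by (rule finite_subset[of _ "{..lam k}"]) (auto simp: in_region_def)
  have inner: "(\<Prod>j\<in>?J k. box_weight (ht k + 1 + 2 * j)) * column_weight k (f k) = column_weight k (lam k)"
    if k: "k \<in> {1..2 * n}" for k
  proof -
    have kp: "even (ht k + k)" using ht_parity k by simp
    have fe: "even (f k + step_ht k)" using label_diff_even[OF lab k] .
    have fs: "step_ht k \<le> f k" using labelling_level(1)[OF lab k] .
    have fj: "joins TT k j \<longleftrightarrow> ht k + 1 + 2 * j < f k" for j
    proof (cases "k < \<sigma> k")
      case True
      have "f k \<noteq> ht k + 1 + 2 * j" using fe step_ht_eq[OF k] True by auto
      then show ?thesis using joins_iff[OF TT k, of j, folded f_def] step_ht_eq[OF k] True by auto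
    next
      case False
      then show ?thesis using joins_iff[OF TT k, of j, folded f_def] step_ht_eq[OF k] ht_Down[OF k] by simp
    qed
    have "(\<Prod>j\<in>?J k. box_weight (ht k + 1 + 2 * j)) = (\<Prod>b\<in>?B k. box_weight b)"
    proof (rule prod.reindex_bij_witness[of _ "\<lambda>b. (b - ht k - 1) div 2" "\<lambda>j. ht k + 1 + 2 * j"])
      fix b assume b: "b \<in> ?B k"
      have "ht k \<le> b" using fs b step_ht_def[of k] by simp
      moreover have "ht k \<noteq> b" using b kp by auto
      ultimately have "ht k + 1 \<le> b" by simp
      moreover have "even (b - ht k - 1)" using b kp calculation by (auto simp: even_diff_nat)
      ultimately show e: "ht k + 1 + 2 * ((b - ht k - 1) div 2) = b" by simp
      show "(b - ht k - 1) div 2 \<in> ?J k"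
        using b k e unfolding mem_Collect_eq fj in_region_def by auto
    next
      fix j assume j: "j \<in> ?J k"
      then show "ht k + 1 + 2 * j \<in> ?B k" using fj[of j] kp by (auto simp: in_region_def)
    qed auto
    moreover have "(\<Prod>b\<in>?B k. box_weight b) * column_weight k (f k) = column_weight k (lam k)"
    proof -
      have fb: "f k \<le> lam k + 1" using labellingD[OF lab k] by (simp add: lam_def)
      \<comment> \<open>For \<open>k > n\<close> the label may exceed the height of the top path by
        one. Then that height has the wrong parity for a centre in column \<open>k\<close>, and no
        factor is gained or lost.\<close>
      have le: "f k \<le> lam k \<or> f k = lam k + 1 \<and> even (k + lam k)"
        using fb labellingD(3)[OF lab k] k by (auto simp: lam_def min_def split: if_splits)
      have lt: "b < lam k" if "b < f k" "odd (k + b)" for b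
        using le that by (auto simp: less_Suc_eq)
      have f1: "1 \<le> f k" using labellingD(2)[OF lab k] .
      show ?thesis
        unfolding column_weight_def
      proof (subst prod.union_disjoint[symmetric])
        show "prod box_weight (?B k \<union> {b. 1 \<le> b \<and> b < f k \<and> odd (k + b)}) =
            prod box_weight {b. 1 \<le> b \<and> b < lam k \<and> odd (k + b)}"
          using lt f1 by (intro prod.cong) auto
      qed (auto intro: finite_subset[of _ "{..<lam k}"] finite_subset[of _ "{..<f k}"])
    qed
    ultimately show ?thesis by simp
  qed
  \<comment> \<open>The ends of an arc have equal labels and positions of opposite parity, so
    \<open>column_weight_opposite\<close> applies to them.\<close>
  have cols: "(\<Prod>k\<in>{1..2 * n}. column_weight k (f k)) = arc_prod n \<sigma> (\<lambda>k. 1 / qint (int (f k)))"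
    unfolding prod_arcs
  proof (rule arc_prod_cong)
    fix k assume k: "k \<in> {1..2 * n}"
    have "f (\<sigma> k) = f k" using labellingD(1)[OF lab k] .
    moreover have "odd (k + b) \<longleftrightarrow> even (\<sigma> k + b)" for b
      using labellingD(5)[OF lab k] labellingD(5)[OF lab nc_matchingD(1)[OF nc k]]
        labellingD(1)[OF lab k] nc_matchingD(2,3)[OF nc k] by auto
    ultimately show "column_weight k (f k) * column_weight (\<sigma> k) (f (\<sigma> k)) = 1 / qint (int (f k))"
      using column_weight_opposite[of "f k" k "\<sigma> k"] labellingD(2)[OF lab k] by simp
  qed
  have "(\<Prod>d\<in>TT. qint (tile_height d) / qint (tile_height d + 1)) =
      (\<Prod>k\<in>{1..2 * n}. \<Prod>j\<in>?J k. box_weight (ht k + 1 + 2 * j))"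
    unfolding tile_weights[OF TT] E by (rule prod.Sigma[symmetric]) (use finJ in auto)
  also have "\<dots> * arc_prod n \<sigma> (\<lambda>k. 1 / qint (int (f k))) = total_weight n"
    unfolding cols[symmetric] prod.distrib[symmetric] total_weight_def
    using inner by (intro prod.cong) (auto simp: lam_def)
  finally have W: "(\<Prod>d\<in>TT. qint (tile_height d) / qint (tile_height d + 1)) * arc_prod n \<sigma> (\<lambda>k. 1 / qint (int (f k))) =
     total_weight n" .
  have A: "arc_prod n \<sigma> (\<lambda>k. 1 / qint (int (f k))) * arc_prod n \<sigma> (\<lambda>k. qint (int (f k))) = 1"
    unfolding arc_prod_def prod.distrib[symmetric]
  proof (intro prod.neutral ballI)
    fix k assume "k \<in> {k. k \<in> {1..2 * n} \<and> k < \<sigma> k}"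
    then have "1 \<le> f k" using labellingD(2)[OF lab, of k] by blast
    then show "1 / qint (int (f k)) * qint (int (f k)) = 1" using qint_nonzero[of "int (f k)"] by simp
  qed
  show ?thesis
    unfolding f_def[symmetric] W[symmetric] mult.assoc A by (rule mult_1_right[symmetric])
qed

theorem tiling_sum_eq_label_sum: "tiling_sum path = total_weight n * label_sum n \<sigma>"
proof -
  have "tiling_sum path = (\<Sum>TT\<in>cover_inclusive_tilings path.
      total_weight n * arc_prod n \<sigma> (\<lambda>k. qint (int (tiling_label TT k))))"
    unfolding tiling_sum_def by (rule sum.cong) (auto simp: tiling_weight_label)
  also have "\<dots> = (\<Sum>f | labelling n \<sigma> f. total_weight n * arc_prod n \<sigma> (\<lambda>k. qint (int (f k))))"
    by (rule sum.reindex_bij_betw[OF bij_tiling_label])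
  finally show ?thesis by (simp add: label_sum_def sum_distrib_left)
qed

end


section \<open>Diagrams as matchings\<close>

text \<open>The inverse of \<open>pos n\<close> on the positions \<open>{1..2 * n}\<close>.\<close>

definition pt_at :: "nat \<Rightarrow> nat \<Rightarrow> pt" where
  "pt_at n k = (if k \<le> n then Bot k else Top (2 * n + 1 - k))"

definition diagram_of :: "nat \<Rightarrow> (nat \<Rightarrow> nat) \<Rightarrow> diagram" where
  "diagram_of n \<sigma> = (\<lambda>k. {pt_at n k, pt_at n (\<sigma> k)}) ` {1..2 * n}"

lemma pos_pt_at: "k \<in> {1..2 * n} \<Longrightarrow> pos n (pt_at n k) = k"
  by (auto simp: pt_at_def)

lemma pt_at_inj: "k \<in> {1..2 * n} \<Longrightarrow> l \<in> {1..2 * n} \<Longrightarrow> pt_at n k = pt_at n l \<longleftrightarrow> k = l"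
  by (metis pos_pt_at)

lemma points_eq: "points n = pt_at n ` {1..2 * n}"
proof (intro equalityI subsetI)
  fix a assume "a \<in> points n"
  then consider j where "a = Top j" "j \<in> {1..n}" | j where "a = Bot j" "j \<in> {1..n}"
    by (auto simp: points_def)
  then show "a \<in> pt_at n ` {1..2 * n}"
  proof cases
    case 1
    then have "a = pt_at n (2 * n + 1 - j)" "2 * n + 1 - j \<in> {1..2 * n}" by (auto simp: pt_at_def)
    then show ?thesis by blast
  next
    case 2
    then have "a = pt_at n j" "j \<in> {1..2 * n}" by (auto simp: pt_at_def)
    then show ?thesis by blast
  qed
next
  fix a assume "a \<in> pt_at n ` {1..2 * n}"
  then obtain k where k: "k \<in> {1..2 * n}" "a = pt_at n k" by blast
  show "a \<in> points n"
  proof (cases "k \<le> n")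
    case False
    then have "2 * n + 1 - k \<in> {1..n}" "a = Top (2 * n + 1 - k)" using k by (auto simp: pt_at_def)
    then show ?thesis by (simp add: points_def)
  qed (use k in \<open>simp add: points_def pt_at_def\<close>)
qed

lemma diagram_of_arc:
  assumes m: "nc_matching n \<sigma>" and k: "k \<in> {1..2 * n}" and l: "l \<in> {1..2 * n}"
  shows "{pt_at n k, pt_at n l} \<in> diagram_of n \<sigma> \<longleftrightarrow> l = \<sigma> k"
proof
  assume "{pt_at n k, pt_at n l} \<in> diagram_of n \<sigma>"
  then obtain x where x: "x \<in> {1..2 * n}" "{pt_at n k, pt_at n l} = {pt_at n x, pt_at n (\<sigma> x)}"
    by (auto simp: diagram_of_def)
  note sx = nc_matchingD[OF m x(1)]
  from x(2) consider "k = x" "l = \<sigma> x" | "k = \<sigma> x" "l = x"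
    using pt_at_inj k l x(1) sx(1) by (auto simp: doubleton_eq_iff)
  then show "l = \<sigma> k" using sx by cases auto
qed (use k in \<open>auto simp: diagram_of_def\<close>)

lemma diagram_of_arcE:
  assumes "A \<in> diagram_of n \<sigma>"
  obtains k where "k \<in> {1..2 * n}" "A = {pt_at n k, pt_at n (\<sigma> k)}"
  using assms by (auto simp: diagram_of_def)

lemma diagram_of_pair:
  assumes m: "nc_matching n \<sigma>"
  shows "{a, b} \<in> diagram_of n \<sigma> \<longleftrightarrow> (\<exists>k\<in>{1..2 * n}. a = pt_at n k \<and> b = pt_at n (\<sigma> k))"
proof
  assume "{a, b} \<in> diagram_of n \<sigma>"
  then obtain k where k: "k \<in> {1..2 * n}" "{a, b} = {pt_at n k, pt_at n (\<sigma> k)}" by (rule diagram_of_arcE)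
  then consider "a = pt_at n k" "b = pt_at n (\<sigma> k)" | "a = pt_at n (\<sigma> k)" "b = pt_at n (\<sigma> (\<sigma> k))"
    using nc_matchingD(3)[OF m k(1)] by (auto simp: doubleton_eq_iff)
  then show "\<exists>k\<in>{1..2 * n}. a = pt_at n k \<and> b = pt_at n (\<sigma> k)"
    using k(1) nc_matchingD(1)[OF m k(1)] by cases blast+
qed (auto simp: diagram_of_def)

lemma diagram_of_in_tl_diagrams:
  assumes m: "nc_matching n \<sigma>"
  shows "diagram_of n \<sigma> \<in> tl_diagrams n"
proof -
  have "partition_on (points n) (diagram_of n \<sigma>)"
  proof (rule partition_onI)
    show "\<Union> (diagram_of n \<sigma>) = points n"
      unfolding points_eq diagram_of_def using nc_matchingD(1)[OF m] by auto
    show "{} \<notin> diagram_of n \<sigma>" by (auto simp: diagram_of_def)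
    show "disjnt p q" if pq: "p \<in> diagram_of n \<sigma>" "q \<in> diagram_of n \<sigma>" "p \<noteq> q" for p q
    proof (rule ccontr)
      assume nd: "\<not> disjnt p q"
      obtain k where k: "k \<in> {1..2 * n}" "p = {pt_at n k, pt_at n (\<sigma> k)}" using pq(1) by (rule diagram_of_arcE)
      obtain l where l: "l \<in> {1..2 * n}" "q = {pt_at n l, pt_at n (\<sigma> l)}" using pq(2) by (rule diagram_of_arcE)
      note sk = nc_matchingD[OF m k(1)] and sl = nc_matchingD[OF m l(1)]
      have "k = l \<or> k = \<sigma> l \<or> \<sigma> k = l \<or> \<sigma> k = \<sigma> l"
        using nd k l pt_at_inj sk(1) sl(1) by (auto simp: disjnt_def)
      then have "l = k \<or> l = \<sigma> k" using sk(3) sl(3) by metis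
      then show False using pq(3) k(2) l(2) sk(3) by (auto simp: insert_commute)
    qed
  qed
  moreover have "card A = 2" if A: "A \<in> diagram_of n \<sigma>" for A
  proof -
    obtain k where k: "k \<in> {1..2 * n}" "A = {pt_at n k, pt_at n (\<sigma> k)}" using A by (rule diagram_of_arcE)
    then show ?thesis using pt_at_inj[OF k(1) nc_matchingD(1)[OF m k(1)]] nc_matchingD(2)[OF m k(1)] by auto
  qed
  moreover have "noncrossing n (diagram_of n \<sigma>)"
    unfolding noncrossing_def diagram_of_pair[OF m]
  proof (clarify)
    fix k l assume k: "k \<in> {1..2 * n}" and l: "l \<in> {1..2 * n}"
      and lt: "pos n (pt_at n k) < pos n (pt_at n l)" "pos n (pt_at n l) < pos n (pt_at n (\<sigma> k))"
        "pos n (pt_at n (\<sigma> k)) < pos n (pt_at n (\<sigma> l))"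
    then show False
      using nc_matching_nested(2)[OF m, of k l] pos_pt_at nc_matchingD(1)[OF m k] nc_matchingD(1)[OF m l] by auto
  qed
  ultimately show ?thesis by (simp add: tl_diagrams_def)
qed

lemma diagram_of_inj:
  assumes "nc_matching n \<sigma>" "nc_matching n \<tau>" "diagram_of n \<sigma> = diagram_of n \<tau>"
  shows "\<sigma> = \<tau>"
proof
  fix k
  show "\<sigma> k = \<tau> k"
  proof (cases "k \<in> {1..2 * n}")
    case True
    then have "{pt_at n k, pt_at n (\<sigma> k)} \<in> diagram_of n \<sigma>" by (auto simp: diagram_of_def)
    then have "{pt_at n k, pt_at n (\<sigma> k)} \<in> diagram_of n \<tau>" using assms(3) by simp
    then show ?thesis using diagram_of_arc[OF assms(2) True] nc_matchingD(1)[OF assms(1) True] by blast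
  qed (metis assms nc_matching_fix)
qed

lemma diagram_of_surj:
  assumes D: "D \<in> tl_diagrams n"
  obtains \<sigma> where "nc_matching n \<sigma>" "D = diagram_of n \<sigma>"
proof -
  have part: "partition_on (points n) D" and c2: "\<And>A. A \<in> D \<Longrightarrow> card A = 2" and nc: "noncrossing n D"
    using D by (auto simp: tl_diagrams_def)
  have un: "\<Union>D = pt_at n ` {1..2 * n}" and dj: "disjoint D"
    using part by (auto simp: partition_on_def points_eq)
  have uniq: "A = B" if "A \<in> D" "B \<in> D" "x \<in> A" "x \<in> B" for A B x
    using disjointD[OF dj that(1,2)] that by blast
  have "\<exists>l. k \<in> {1..2 * n} \<longrightarrow> l \<in> {1..2 * n} \<and> l \<noteq> k \<and> {pt_at n k, pt_at n l} \<in> D" for k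
  proof (cases "k \<in> {1..2 * n}")
    case True
    then obtain A where A: "A \<in> D" "pt_at n k \<in> A" using un by blast
    then obtain a where a: "A = {pt_at n k, a}" "a \<noteq> pt_at n k"
      using c2[OF A(1)] by (metis card_2_iff doubleton_eq_iff insertE singletonD)
    then have "a \<in> pt_at n ` {1..2 * n}" using A un by blast
    then obtain l where "l \<in> {1..2 * n}" "a = pt_at n l" by blast
    then show ?thesis using A a by blast
  qed blast
  then obtain \<rho> where \<rho>: "\<And>k. k \<in> {1..2 * n} \<Longrightarrow> \<rho> k \<in> {1..2 * n} \<and> \<rho> k \<noteq> k \<and> {pt_at n k, pt_at n (\<rho> k)} \<in> D"
    by metis
  define \<sigma> where "\<sigma> = (\<lambda>k. if k \<in> {1..2 * n} then \<rho> k else k)"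
  have \<sigma>: "\<sigma> k \<in> {1..2 * n}" "\<sigma> k \<noteq> k" "{pt_at n k, pt_at n (\<sigma> k)} \<in> D" if "k \<in> {1..2 * n}" for k
    using \<rho>[OF that] that by (auto simp: \<sigma>_def)
  have mate: "l = \<sigma> k" if "k \<in> {1..2 * n}" "l \<in> {1..2 * n}" "{pt_at n k, pt_at n l} \<in> D" for k l
  proof -
    have "{pt_at n k, pt_at n l} = {pt_at n k, pt_at n (\<sigma> k)}"
      using uniq[OF that(3) \<sigma>(3)[OF that(1)], of "pt_at n k"] by blast
    then show ?thesis using pt_at_inj that \<sigma>(1)[OF that(1)] by (auto simp: doubleton_eq_iff)
  qed
  have inv: "\<sigma> (\<sigma> k) = k" if "k \<in> {1..2 * n}" for k
    using mate[OF \<sigma>(1)[OF that] that] \<sigma>(3)[OF that] by (simp add: insert_commute)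
  have m: "nc_matching n \<sigma>"
    unfolding nc_matching_def
  proof (intro conjI ballI allI impI)
    fix a b assume a: "a \<in> {1..2 * n}" and ab: "a < b \<and> b < \<sigma> a"
    have b: "b \<in> {1..2 * n}" using ab a \<sigma>(1)[OF a] by auto
    show "\<sigma> b < \<sigma> a"
    proof (rule ccontr)
      assume "\<not> \<sigma> b < \<sigma> a"
      moreover have "\<sigma> b \<noteq> \<sigma> a" using inv[OF a] inv[OF b] ab by (metis less_irrefl)
      ultimately have "\<sigma> a < \<sigma> b" by simp
      then show False
        using nc \<sigma>(3)[OF a] \<sigma>(3)[OF b] ab pos_pt_at[OF a] pos_pt_at[OF b] pos_pt_at[OF \<sigma>(1)[OF a]] pos_pt_at[OF \<sigma>(1)[OF b]]
        unfolding noncrossing_def by metis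
    qed
  qed (use \<sigma> inv in \<open>auto simp: \<sigma>_def\<close>)
  have "D = diagram_of n \<sigma>"
  proof (intro equalityI subsetI)
    fix A assume A: "A \<in> D"
    then obtain x where x: "x \<in> A" using c2[OF A] by fastforce
    then obtain k where k: "k \<in> {1..2 * n}" "x = pt_at n k" using A un by blast
    then have "A = {pt_at n k, pt_at n (\<sigma> k)}" using uniq[OF A \<sigma>(3)[OF k(1)] x] by simp
    then show "A \<in> diagram_of n \<sigma>" using k by (auto simp: diagram_of_def)
  qed (use \<sigma> in \<open>auto simp: diagram_of_def\<close>)
  with m show thesis by (rule that)
qed

lemma bij_diagram_of: "bij_betw (diagram_of n) {\<sigma>. nc_matching n \<sigma>} (tl_diagrams n)"
  unfolding bij_betw_def
proof (intro conjI)
  show "inj_on (diagram_of n) {\<sigma>. nc_matching n \<sigma>}" using diagram_of_inj by (auto intro: inj_onI)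
  show "diagram_of n ` {\<sigma>. nc_matching n \<sigma>} = tl_diagrams n"
    using diagram_of_in_tl_diagrams diagram_of_surj by (metis (mono_tags, lifting) equalityI image_eqI image_subsetI mem_Collect_eq subsetI)
qed

lemma finite_tl_diagrams: "finite (tl_diagrams n)"
  using bij_betw_finite[OF bij_diagram_of] finite_nc_matchings by blast

lemma folded_path_diagram_of:
  assumes m: "nc_matching n \<sigma>"
  shows "folded_path n (diagram_of n \<sigma>) = matching_path n \<sigma>"
  unfolding folded_path_def matching_path_def diagram_of_pair[OF m]
proof (intro map_cong refl if_cong)
  fix k assume "k \<in> set [1..<2 * n + 1]"
  then have k: "k \<in> {1..2 * n}" by auto
  show "(\<exists>a b. (\<exists>k\<in>{1..2 * n}. a = pt_at n k \<and> b = pt_at n (\<sigma> k)) \<and> pos n a = k \<and> k < pos n b) \<longleftrightarrow> k < \<sigma> k"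
    using k pos_pt_at nc_matchingD(1)[OF m] by metis
qed

section \<open>The matchings of the identity and of the generators\<close>

definition id_matching :: "nat \<Rightarrow> nat \<Rightarrow> nat" where
  "id_matching n k = (if k \<in> {1..2 * n} then 2 * n + 1 - k else k)"

lemma nc_id_matching: "nc_matching n (id_matching n)"
proof -
  have "id_matching n k \<noteq> k" if "k \<in> {1..2 * n}" for k
  proof
    assume "id_matching n k = k"
    then have "2 * n + 1 = 2 * k" using that by (auto simp: id_matching_def)
    then show False by presburger
  qed
  then show ?thesis unfolding nc_matching_def by (auto simp: id_matching_def)
qed

text \<open>The heights themselves form a labelling, so the lemmas on labelled contractions apply.\<close>

lemma (in matching) labelling_step_ht:
  "labelling n \<sigma> (\<lambda>k. if k \<in> {1..2 * n} then step_ht k else 0)"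
proof -
  have "b \<in> {1..2 * n}" if "a \<in> {1..2 * n}" "a < b" "b < \<sigma> a" for a b
    using that nc_matchingD(5)[OF nc that(1)] by auto
  then show ?thesis
    unfolding labelling_def
    using step_ht_mate step_ht_bounds step_ht_parity step_ht_less nc_matchingD(1)[OF nc] by simp
qed

text \<open>Contracting the labelling by depths yields some labelling of the contracted involution,
  which is therefore noncrossing.\<close>

lemma nc_contract:
  assumes m: "nc_matching n \<tau>" and p: "n < p" "p < 2 * n"
  shows "nc_matching n (contract p \<tau>)"
proof (cases "\<tau> p = Suc p")
  case False
  interpret matching n \<tau> by unfold_locales (rule m)
  have pin: "p \<in> {1..2 * n}" "Suc p \<in> {1..2 * n}" using p by auto
  define g where "g = (\<lambda>k. if k \<in> {1..2 * n} then step_ht k else 0)"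
  have g: "labelling n \<tau> g" unfolding g_def by (rule labelling_step_ht)
  obtain f where f: "labelling n (contract p \<tau>) f"
    using labelling_contract_left(1)[OF m g p False] labelling_contract_right(1)[OF m g p False]
    by (metis not_less)
  have c: "contract p \<tau> x = (if x = Suc p then p else if x = p then Suc p
      else if x = \<tau> (Suc p) then \<tau> p else if x = \<tau> p then \<tau> (Suc p) else \<tau> x)" for x
    using False by (simp add: contract_def)
  have ne: "\<tau> p \<noteq> \<tau> (Suc p)" "\<tau> (Suc p) \<noteq> p" using invol False by (metis n_not_Suc_n)+
  note pm = nc_matchingD[OF m pin(1)] nc_matchingD[OF m pin(2)]
  show ?thesis
  proof (rule nc_matchingI_labelling[OF f])
    fix k assume k: "k \<in> {1..2 * n}"
    consider "k \<in> {p, Suc p}" | "k = \<tau> p" | "k = \<tau> (Suc p)" | "k \<notin> {p, Suc p, \<tau> p, \<tau> (Suc p)}" by blast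
    then show "contract p \<tau> k \<in> {1..2 * n} \<and> contract p \<tau> k \<noteq> k \<and> contract p \<tau> (contract p \<tau> k) = k"
    proof cases
      case 1
      moreover have "contract p \<tau> p = Suc p" "contract p \<tau> (Suc p) = p" by (simp_all add: c)
      ultimately show ?thesis using pin by (elim insertE emptyE) simp_all
    next
      case 2
      then have "contract p \<tau> k = \<tau> (Suc p)" "contract p \<tau> (\<tau> (Suc p)) = k" using pm False ne unfolding c by auto
      then show ?thesis using pm ne 2 by simp
    next
      case 3
      then have "contract p \<tau> k = \<tau> p" "contract p \<tau> (\<tau> p) = k" using pm False ne unfolding c by auto
      then show ?thesis using pm ne 3 by simp
    next
      case 4
      then have "\<tau> k \<notin> {p, Suc p, \<tau> p, \<tau> (Suc p)}" using invol by (metis insert_iff empty_iff)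
      then have "contract p \<tau> k = \<tau> k" "contract p \<tau> (\<tau> k) = k" using 4 invol unfolding c by auto
      then show ?thesis using nc_matchingD[OF m k] by simp
    qed
  next
    fix k assume k: "k \<notin> {1..2 * n}"
    then have "k \<noteq> p" "k \<noteq> Suc p" "k \<noteq> \<tau> p" "k \<noteq> \<tau> (Suc p)" using pin pm by metis+
    then show "contract p \<tau> k = k" unfolding c using nc_matching_fix[OF m k] by simp
  qed
qed (simp add: contract_def m)

text \<open>The diagram of \<open>e_i\<close> is \<open>e_i\<close> stacked on the identity.\<close>

definition gen_matching :: "nat \<Rightarrow> nat \<Rightarrow> nat \<Rightarrow> nat" where
  "gen_matching n i = contract (2 * n - i) (id_matching n)"

lemma gen_matching:
  assumes i: "i \<in> {1..<n}"
  shows "gen_matching n i i = Suc i" "gen_matching n i (Suc i) = i"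
    "gen_matching n i (2 * n - i) = Suc (2 * n - i)" "gen_matching n i (Suc (2 * n - i)) = 2 * n - i"
    "k \<notin> {i, Suc i, 2 * n - i, Suc (2 * n - i)} \<Longrightarrow> gen_matching n i k = id_matching n k"
proof -
  have id: "id_matching n (2 * n - i) = Suc i" "id_matching n (Suc (2 * n - i)) = i"
    using i by (auto simp: id_matching_def)
  have ne: "Suc i \<noteq> Suc (2 * n - i)" "i \<noteq> 2 * n - i" "Suc i \<noteq> 2 * n - i" "i \<noteq> Suc (2 * n - i)" using i by auto
  show "gen_matching n i i = Suc i" "gen_matching n i (Suc i) = i"
    "gen_matching n i (2 * n - i) = Suc (2 * n - i)" "gen_matching n i (Suc (2 * n - i)) = 2 * n - i"
    "k \<notin> {i, Suc i, 2 * n - i, Suc (2 * n - i)} \<Longrightarrow> gen_matching n i k = id_matching n k"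
    using ne by (simp_all add: gen_matching_def contract_def id)
qed

lemma id_diagram_eq: "id_diagram n = diagram_of n (id_matching n)"
proof (intro equalityI subsetI)
  fix A assume "A \<in> id_diagram n"
  then obtain j where j: "j \<in> {1..n}" "A = {Top j, Bot j}" by (auto simp: id_diagram_def)
  then have "A = {pt_at n j, pt_at n (id_matching n j)}" "j \<in> {1..2 * n}"
    by (auto simp: pt_at_def id_matching_def)
  then show "A \<in> diagram_of n (id_matching n)" unfolding diagram_of_def by blast
next
  fix A assume "A \<in> diagram_of n (id_matching n)"
  then obtain k where k: "k \<in> {1..2 * n}" "A = {pt_at n k, pt_at n (id_matching n k)}" by (rule diagram_of_arcE)
  define j where "j = (if k \<le> n then k else 2 * n + 1 - k)"
  have "j \<in> {1..n}" "A = {Top j, Bot j}" using k by (auto simp: j_def pt_at_def id_matching_def)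
  then show "A \<in> id_diagram n" by (auto simp: id_diagram_def)
qed

lemma nc_gen_matching:
  assumes i: "i \<in> {1..<n}"
  shows "nc_matching n (gen_matching n i)"
  unfolding gen_matching_def using i by (intro nc_contract nc_id_matching) auto

lemma gen_diagram_eq:
  assumes i: "i \<in> {1..<n}"
  shows "gen_diagram n i = diagram_of n (gen_matching n i)"
proof (intro equalityI subsetI)
  fix A assume "A \<in> gen_diagram n i"
  then consider "A = {Top i, Top (i + 1)}" | "A = {Bot i, Bot (i + 1)}"
    | j where "j \<in> {1..n}" "j \<noteq> i" "j \<noteq> Suc i" "A = {Top j, Bot j}"
    unfolding gen_diagram_def by auto
  then show "A \<in> diagram_of n (gen_matching n i)"
  proof cases
    case 1
    then have "A = {pt_at n (2 * n - i), pt_at n (gen_matching n i (2 * n - i))}" "2 * n - i \<in> {1..2 * n}"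
      unfolding gen_matching[OF i] using i by (auto simp: pt_at_def)
    then show ?thesis unfolding diagram_of_def by blast
  next
    case 2
    then have "A = {pt_at n i, pt_at n (gen_matching n i i)}" "i \<in> {1..2 * n}"
      unfolding gen_matching[OF i] using i by (auto simp: pt_at_def)
    then show ?thesis unfolding diagram_of_def by blast
  next
    case 3
    then have "j \<notin> {i, Suc i, 2 * n - i, Suc (2 * n - i)}" using i by auto
    then have "gen_matching n i j = 2 * n + 1 - j"
      using gen_matching(5)[OF i, of j] 3 by (simp add: id_matching_def)
    then have "A = {pt_at n j, pt_at n (gen_matching n i j)}" "j \<in> {1..2 * n}"
      using 3 by (auto simp: pt_at_def)
    then show ?thesis unfolding diagram_of_def by blast
  qed
next
  fix A assume "A \<in> diagram_of n (gen_matching n i)"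
  then obtain k where k: "k \<in> {1..2 * n}" "A = {pt_at n k, pt_at n (gen_matching n i k)}" by (rule diagram_of_arcE)
  consider "k \<in> {i, Suc i}" | "k \<in> {2 * n - i, Suc (2 * n - i)}" | "k \<notin> {i, Suc i, 2 * n - i, Suc (2 * n - i)}" by blast
  then show "A \<in> gen_diagram n i"
  proof cases
    case 1
    then have "A = {Bot i, Bot (i + 1)}" using k i gen_matching[OF i] by (auto simp: pt_at_def)
    then show ?thesis by (simp add: gen_diagram_def)
  next
    case 2
    moreover have "pt_at n (2 * n - i) = Top (i + 1)" "pt_at n (Suc (2 * n - i)) = Top i"
      using i by (auto simp: pt_at_def)
    ultimately have "A = {Top i, Top (i + 1)}"
      unfolding k(2) by (elim insertE emptyE) (simp_all add: gen_matching(3,4)[OF i] insert_commute)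
    then show ?thesis by (simp add: gen_diagram_def)
  next
    case 3
    define j where "j = (if k \<le> n then k else 2 * n + 1 - k)"
    have "A = {pt_at n k, pt_at n (2 * n + 1 - k)}"
      using k gen_matching(5)[OF i 3] by (simp add: id_matching_def)
    then have "A = {Top j, Bot j}" using k by (cases "k \<le> n") (auto simp: j_def pt_at_def)
    moreover have "j \<in> {1..n} - {i, i + 1}"
      using 3 k i by (cases "k \<le> n") (auto simp: j_def)
    ultimately have "j \<in> {1..n} - {i, i + 1}" "A = {Top j, Bot j}" by auto
    then show ?thesis unfolding gen_diagram_def by blast
  qed
qed


section \<open>Stacking a generator on a diagram\<close>

locale stacking = matching +
  fixes i :: nat
  assumes i: "i \<in> {1..<n}"
begin

definition p :: nat where "p = 2 * n - i"

text \<open>\<open>lower_at\<close> places position \<open>k\<close> of the lower diagram in the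
  glued graph, \<open>outer_at\<close> the same position on the boundary of the stack. They agree
  for \<open>k \<le> n\<close>, where the bottom edge is shared.\<close>

definition lower_at :: "nat \<Rightarrow> glued_pt" where "lower_at k = lower (pt_at n k)"

definition outer_at :: "nat \<Rightarrow> glued_pt" where "outer_at k = outer (pt_at n k)"

abbreviation "arcs \<equiv> glued_arcs (gen_diagram n i) (diagram_of n \<sigma>)"

lemma p: "n < p" "p < 2 * n" "p \<in> {1..2 * n}" "Suc p \<in> {1..2 * n}"
  using i by (auto simp: p_def)

lemma outer_eq_lower: "k \<le> n \<Longrightarrow> outer_at k = lower_at k"
  by (simp add: outer_at_def lower_at_def pt_at_def)

lemma outer_at_eq: "outer_at k = (if k \<le> n then GBot k else GTop (2 * n + 1 - k))"
  by (simp add: outer_at_def pt_at_def)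

lemma lower_at_eq: "lower_at k = (if k \<le> n then GBot k else GMid (2 * n + 1 - k))"
  by (simp add: lower_at_def pt_at_def)

lemma upper_gen_arcs: "(`) upper ` gen_diagram n i =
    {{outer_at p, outer_at (Suc p)}, {lower_at p, lower_at (Suc p)}}
    \<union> {{outer_at k, lower_at k} | k. k \<in> {n<..2 * n} - {p, Suc p}}"
proof -
  have 1: "outer_at p = GTop (i + 1)" "outer_at (Suc p) = GTop i" "lower_at p = GMid (i + 1)" "lower_at (Suc p) = GMid i"
    using i by (auto simp: outer_at_eq lower_at_eq p_def)
  have 2: "{{GTop j, GMid j} | j. j \<in> {1..n} - {i, i + 1}} =
      {{outer_at k, lower_at k} | k. k \<in> {n<..2 * n} - {p, Suc p}}"
  proof (intro equalityI subsetI)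
    fix A assume "A \<in> {{GTop j, GMid j} | j. j \<in> {1..n} - {i, i + 1}}"
    then obtain j where j: "j \<in> {1..n} - {i, i + 1}" "A = {GTop j, GMid j}" by blast
    define k where "k = 2 * n + 1 - j"
    have k: "k \<in> {n<..2 * n} - {p, Suc p}" "2 * n + 1 - k = j" using j i by (auto simp: k_def p_def)
    then have "A = {outer_at k, lower_at k}" using j by (simp add: outer_at_eq lower_at_eq)
    with k show "A \<in> {{outer_at k, lower_at k} | k. k \<in> {n<..2 * n} - {p, Suc p}}" by blast
  next
    fix A assume "A \<in> {{outer_at k, lower_at k} | k. k \<in> {n<..2 * n} - {p, Suc p}}"
    then obtain k where k: "k \<in> {n<..2 * n} - {p, Suc p}" "A = {outer_at k, lower_at k}" by blast
    define j where "j = 2 * n + 1 - k"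
    have "j \<in> {1..n} - {i, i + 1}" using k i by (auto simp: j_def p_def)
    moreover have "A = {GTop j, GMid j}" using k by (auto simp: outer_at_eq lower_at_eq j_def)
    ultimately show "A \<in> {{GTop j, GMid j} | j. j \<in> {1..n} - {i, i + 1}}" by blast
  qed
  have "(`) upper ` {{Top j, Bot j} | j. j \<in> {1..n} - {i, i + 1}} =
      {{GTop j, GMid j} | j. j \<in> {1..n} - {i, i + 1}}"
  proof -
    let ?S = "{1..n} - {i, i + 1}"
    have "{{Top j, Bot j} | j. j \<in> ?S} = (\<lambda>j. {Top j, Bot j}) ` ?S"
      "{{GTop j, GMid j} | j. j \<in> ?S} = (\<lambda>j. {GTop j, GMid j}) ` ?S" by blast+
    then show ?thesis by (simp only: image_image image_insert image_empty upper.simps)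
  qed
  then show ?thesis
    unfolding gen_diagram_def image_Un image_insert image_empty upper.simps 1 2
    by (simp add: insert_commute)
qed

lemma glued_arcs_iff: "(x, y) \<in> arcs \<longleftrightarrow>
    (\<exists>k\<in>{1..2 * n}. x = lower_at k \<and> y = lower_at (\<sigma> k)) \<or>
    {x, y} = {outer_at p, outer_at (Suc p)} \<or> {x, y} = {lower_at p, lower_at (Suc p)} \<or>
    (\<exists>k\<in>{n<..2 * n} - {p, Suc p}. {x, y} = {outer_at k, lower_at k})"
proof -
  have "{x, y} \<in> (`) lower ` diagram_of n \<sigma> \<longleftrightarrow> (\<exists>k\<in>{1..2 * n}. x = lower_at k \<and> y = lower_at (\<sigma> k))"
  proof
    assume "{x, y} \<in> (`) lower ` diagram_of n \<sigma>"
    then obtain k where k: "k \<in> {1..2 * n}" "{x, y} = {lower_at k, lower_at (\<sigma> k)}"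
      by (auto simp: diagram_of_def lower_at_def)
    then consider "x = lower_at k" "y = lower_at (\<sigma> k)" | "x = lower_at (\<sigma> k)" "y = lower_at (\<sigma> (\<sigma> k))"
      using invol by (auto simp: doubleton_eq_iff)
    then show "\<exists>k\<in>{1..2 * n}. x = lower_at k \<and> y = lower_at (\<sigma> k)"
      using k nc_matchingD(1)[OF nc k(1)] by cases blast+
  next
    assume "\<exists>k\<in>{1..2 * n}. x = lower_at k \<and> y = lower_at (\<sigma> k)"
    then obtain k where k: "k \<in> {1..2 * n}" "x = lower_at k" "y = lower_at (\<sigma> k)" by blast
    then have "{x, y} = lower ` {pt_at n k, pt_at n (\<sigma> k)}" by (simp add: lower_at_def)
    then show "{x, y} \<in> (`) lower ` diagram_of n \<sigma>" using k(1) unfolding diagram_of_def by blast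
  qed
  then show ?thesis
    unfolding glued_arcs_def mem_Collect_eq case_prod_conv Un_iff upper_gen_arcs by blast
qed

lemma arcs_sym: "(x, y) \<in> arcs \<Longrightarrow> (y, x) \<in> arcs"
  by (simp add: glued_arcs_def insert_commute)

lemma conn_sym: "(x, y) \<in> arcs\<^sup>* \<Longrightarrow> (y, x) \<in> arcs\<^sup>*"
  by (metis arcs_sym sym_def sym_rtrancl)

lemma conn_arc: "k \<in> {1..2 * n} \<Longrightarrow> (lower_at k, lower_at (\<sigma> k)) \<in> arcs\<^sup>*"
  using glued_arcs_iff by blast

lemma conn_strand:
  assumes "k \<in> {1..2 * n}" "k \<noteq> p" "k \<noteq> Suc p"
  shows "(outer_at k, lower_at k) \<in> arcs\<^sup>*"
proof (cases "k \<le> n")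
  case False
  then have "k \<in> {n<..2 * n} - {p, Suc p}" using assms by auto
  then have "(outer_at k, lower_at k) \<in> arcs" unfolding glued_arcs_iff by blast
  then show ?thesis by blast
qed (simp add: outer_eq_lower)

lemma conn_cup: "(lower_at p, lower_at (Suc p)) \<in> arcs\<^sup>*"
  and conn_cap: "(outer_at p, outer_at (Suc p)) \<in> arcs\<^sup>*"
  unfolding atomize_conj by (intro conjI r_into_rtrancl) (simp_all add: glued_arcs_iff)

definition joined :: "nat \<Rightarrow> nat" where "joined = contract p \<sigma>"

lemma nc_joined: "nc_matching n joined"
  unfolding joined_def using nc_contract[OF nc p(1,2)] .

lemma joined_p: "joined p = Suc p" "joined (Suc p) = p"
  using invol[of p] by (auto simp: joined_def contract_def)

lemma joined_other:
  assumes "k \<noteq> p" "k \<noteq> Suc p"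
  shows "joined k = (if \<sigma> p = Suc p then \<sigma> k else if k = \<sigma> p then \<sigma> (Suc p) else if k = \<sigma> (Suc p) then \<sigma> p else \<sigma> k)"
  using assms invol by (auto simp: joined_def contract_def)

lemma mate_p:
  assumes "\<sigma> p \<noteq> Suc p"
  shows "\<sigma> p \<notin> {p, Suc p}" "\<sigma> (Suc p) \<notin> {p, Suc p}" "\<sigma> p \<noteq> \<sigma> (Suc p)"
  using nc_matchingD(2)[OF nc p(3)] nc_matchingD(2)[OF nc p(4)] assms invol[of p] invol[of "Suc p"] by auto

lemma mate_other: "k \<noteq> \<sigma> p \<Longrightarrow> k \<noteq> \<sigma> (Suc p) \<Longrightarrow> \<sigma> k \<noteq> p \<and> \<sigma> k \<noteq> Suc p"
  using invol[of k] by auto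

text \<open>The component of the glued graph that contains a glued point, described by the strand of the
  stacked diagram on it; a closed loop gets the empty set.\<close>

definition strand :: "nat \<Rightarrow> nat set" where "strand k = {k, joined k}"

definition strand_of :: "glued_pt \<Rightarrow> nat set" where
  "strand_of x = (case x of GTop j \<Rightarrow> strand (2 * n + 1 - j) | GBot j \<Rightarrow> strand j
     | GMid j \<Rightarrow> (let k = 2 * n + 1 - j in if k \<noteq> p \<and> k \<noteq> Suc p then strand k
         else if \<sigma> p = Suc p then {} else strand (\<sigma> p)))"

lemma strand_of_outer: "k \<in> {1..2 * n} \<Longrightarrow> strand_of (outer_at k) = strand k"
  by (auto simp: strand_of_def outer_at_eq)

lemma strand_of_lower:
  "k \<in> {1..2 * n} \<Longrightarrow> strand_of (lower_at k) =
    (if k \<noteq> p \<and> k \<noteq> Suc p then strand k else if \<sigma> p = Suc p then {} else strand (\<sigma> p))"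
  using p by (auto simp: strand_of_def lower_at_eq Let_def)

lemma strand_joined: "k \<in> {1..2 * n} \<Longrightarrow> strand (joined k) = strand k"
  using nc_matchingD(3)[OF nc_joined] by (auto simp: strand_def)

lemma strand_of_arc:
  assumes k: "k \<in> {1..2 * n}"
  shows "strand_of (lower_at k) = strand_of (lower_at (\<sigma> k))"
proof -
  have \<sigma>k: "\<sigma> k \<in> {1..2 * n}" using nc_matchingD(1)[OF nc k] .
  show ?thesis
  proof (cases "\<sigma> p = Suc p")
    case True
    then have \<sigma>Sp: "\<sigma> (Suc p) = p" using invol[of p] by simp
    show ?thesis
    proof (cases "k = p \<or> k = Suc p")
      case False
      then have "\<sigma> k \<noteq> p" "\<sigma> k \<noteq> Suc p" using mate_other[of k] True \<sigma>Sp by auto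
      then show ?thesis
        using False joined_other[of k] strand_joined[OF k] True k \<sigma>k by (simp add: strand_of_lower)
    qed (use True \<sigma>Sp p in \<open>auto simp: strand_of_lower\<close>)
  next
    case ne: False
    note mp = mate_p[OF ne]
    have pp: "\<sigma> p \<in> {1..2 * n}" "\<sigma> (Suc p) \<in> {1..2 * n}" using nc_matchingD(1)[OF nc] p by auto
    have j: "joined (\<sigma> p) = \<sigma> (Suc p)" using joined_other[of "\<sigma> p"] mp ne by simp
    have s: "strand (\<sigma> (Suc p)) = strand (\<sigma> p)" using strand_joined[OF pp(1)] j by simp
    have lp: "strand_of (lower_at p) = strand (\<sigma> p)" "strand_of (lower_at (Suc p)) = strand (\<sigma> p)"
      "strand_of (lower_at (\<sigma> p)) = strand (\<sigma> p)" "strand_of (lower_at (\<sigma> (Suc p))) = strand (\<sigma> p)"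
      using p pp mp ne s by (simp_all add: strand_of_lower)
    consider "k = p" | "k = Suc p" | "k = \<sigma> p" | "k = \<sigma> (Suc p)" | "k \<notin> {p, Suc p, \<sigma> p, \<sigma> (Suc p)}" by blast
    then show ?thesis
    proof cases
      case 5
      then have "\<sigma> k \<noteq> p" "\<sigma> k \<noteq> Suc p" "joined k = \<sigma> k"
        using mate_other[of k] joined_other[of k] by auto
      then show ?thesis using 5 strand_joined[OF k] k \<sigma>k by (simp add: strand_of_lower)
    qed (use lp invol in simp_all)
  qed
qed

text \<open>This invariant shows that the components are not larger than the claimed strands; that
  each strand is connected is shown by explicit paths in \<open>conn_joined\<close>.\<close>

lemma strand_of_conn: "(x, y) \<in> arcs\<^sup>* \<Longrightarrow> strand_of x = strand_of y"
proof (induction rule: rtrancl_induct)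
  case (step y z)
  have "strand_of y = strand_of z"
  proof -
    consider k where "k \<in> {1..2 * n}" "y = lower_at k" "z = lower_at (\<sigma> k)"
      | "{y, z} = {outer_at p, outer_at (Suc p)}" | "{y, z} = {lower_at p, lower_at (Suc p)}"
      | k where "k \<in> {n<..2 * n} - {p, Suc p}" "{y, z} = {outer_at k, lower_at k}"
      using step.hyps(2) unfolding glued_arcs_iff by blast
    then show ?thesis
    proof cases
      case 1
      then show ?thesis using strand_of_arc by simp
    next
      case 2
      have "strand_of (outer_at p) = strand_of (outer_at (Suc p))"
        using strand_joined[OF p(3)] joined_p p by (simp add: strand_of_outer)
      then show ?thesis using 2 by (auto simp: doubleton_eq_iff)
    next
      case 3
      have "strand_of (lower_at p) = strand_of (lower_at (Suc p))"
        using p by (simp add: strand_of_lower)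
      then show ?thesis using 3 by (auto simp: doubleton_eq_iff)
    next
      case 4
      then have "k \<in> {1..2 * n}" by auto
      then have "strand_of (outer_at k) = strand_of (lower_at k)"
        using 4 strand_of_outer[of k] strand_of_lower[of k] by simp
      then show ?thesis using 4 by (auto simp: doubleton_eq_iff)
    qed
  qed
  then show ?case using step.IH by simp
qed simp

lemma conn_joined:
  assumes a: "a \<in> {1..2 * n}"
  shows "(outer_at a, outer_at (joined a)) \<in> arcs\<^sup>*"
proof -
  have *: "(outer_at k, outer_at (\<sigma> k)) \<in> arcs\<^sup>*"
    if "k \<in> {1..2 * n}" "k \<notin> {p, Suc p}" "\<sigma> k \<notin> {p, Suc p}" for k
    using conn_strand[of k] conn_arc[of k] conn_strand[of "\<sigma> k"] nc_matchingD(1)[OF nc that(1)] that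
    by (metis conn_sym insertCI rtrancl_trans)
  \<comment> \<open>The path leads down the strand at \<open>\<sigma> p\<close>, along its arc to
    \<open>p\<close>, through the cup to \<open>Suc p\<close>, along the second arc and up
    again.\<close>
  have **: "(outer_at (\<sigma> p), outer_at (\<sigma> (Suc p))) \<in> arcs\<^sup>*" if ne: "\<sigma> p \<noteq> Suc p"
  proof -
    note mp = mate_p[OF ne]
    have "(outer_at (\<sigma> p), lower_at (\<sigma> p)) \<in> arcs\<^sup>*" "(outer_at (\<sigma> (Suc p)), lower_at (\<sigma> (Suc p))) \<in> arcs\<^sup>*"
      using conn_strand nc_matchingD(1)[OF nc] p mp by auto
    then show ?thesis
      using conn_arc[OF p(3)] conn_arc[OF p(4)] conn_cup by (meson conn_sym rtrancl_trans)
  qed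
  consider "a = p" | "a = Suc p" | "a \<notin> {p, Suc p}" "\<sigma> p = Suc p" | "\<sigma> p \<noteq> Suc p" "a = \<sigma> p"
    | "\<sigma> p \<noteq> Suc p" "a = \<sigma> (Suc p)" | "\<sigma> p \<noteq> Suc p" "a \<notin> {p, Suc p, \<sigma> p, \<sigma> (Suc p)}" by blast
  then show ?thesis
  proof cases
    case 1 then show ?thesis using conn_cap joined_p by simp
  next
    case 2 then show ?thesis using conn_sym[OF conn_cap] joined_p by simp
  next
    case 3
    then have "\<sigma> a \<notin> {p, Suc p}" using mate_other[of a] invol[of p] by auto
    then show ?thesis using *[OF a] joined_other[of a] 3 by auto
  next
    case 4 then show ?thesis using ** mate_p joined_other[of a] by auto
  next
    case 5 then show ?thesis using conn_sym[OF **] mate_p joined_other[of a] by auto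
  next
    case 6
    then have "\<sigma> a \<notin> {p, Suc p}" using mate_other[of a] by auto
    then show ?thesis using *[OF a] joined_other[of a] 6 by auto
  qed
qed

lemma outer_at_inj: "a \<in> {1..2 * n} \<Longrightarrow> outer x = outer_at a \<Longrightarrow> x = pt_at n a"
  by (cases x) (auto simp: outer_at_eq pt_at_def split: if_splits)

text \<open>\<open>stack\<close> ranges over points with arbitrary indices. An outer point that
  meets an edge is one of the \<open>2 * n\<close> boundary points, and the distinct points joined
  by \<open>stack\<close> do meet edges.\<close>

lemma arcs_outer:
  assumes "(x, y) \<in> arcs" "x = outer a"
  shows "a \<in> pt_at n ` {1..2 * n}"
proof -
  have *: "a \<in> pt_at n ` {1..2 * n}" if "k \<in> {1..2 * n}" "outer a = outer_at k \<or> outer a = lower_at k" for k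
  proof -
    have "outer a \<noteq> lower_at k \<or> k \<le> n" by (cases a) (auto simp: lower_at_eq)
    then have "outer a = outer_at k" using that outer_eq_lower by auto
    then show ?thesis using outer_at_inj that by blast
  qed
  consider k where "k \<in> {1..2 * n}" "x = lower_at k"
    | "{x, y} = {outer_at p, outer_at (Suc p)}" | "{x, y} = {lower_at p, lower_at (Suc p)}"
    | k where "k \<in> {n<..2 * n} - {p, Suc p}" "{x, y} = {outer_at k, lower_at k}"
    using assms(1) unfolding glued_arcs_iff by blast
  then have "\<exists>k\<in>{1..2 * n}. x = outer_at k \<or> x = lower_at k"
  proof cases
    case 4
    then have "k \<in> {1..2 * n}" "x = outer_at k \<or> x = lower_at k" by auto
    then show ?thesis by blast
  qed (use p(3,4) in blast)+
  then show ?thesis using * assms(2) by auto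
qed

lemma stack_gen_diagram: "stack (gen_diagram n i) (diagram_of n \<sigma>) = diagram_of n joined"
proof (intro equalityI subsetI)
  fix A assume "A \<in> stack (gen_diagram n i) (diagram_of n \<sigma>)"
  then obtain a b where A: "A = {a, b}" "a \<noteq> b" "(outer a, outer b) \<in> arcs\<^sup>*" by (auto simp: stack_def)
  have ne: "outer a \<noteq> outer b" using A(2) by (cases a; cases b) auto
  obtain y where "(outer a, y) \<in> arcs" using A(3) ne by (meson converse_rtranclE)
  then obtain k where k: "k \<in> {1..2 * n}" "a = pt_at n k" using arcs_outer by blast
  obtain z where "(outer b, z) \<in> arcs" using conn_sym[OF A(3)] ne by (metis converse_rtranclE)
  then obtain l where l: "l \<in> {1..2 * n}" "b = pt_at n l" using arcs_outer by blast
  have "strand k = strand l"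
    using strand_of_conn[OF A(3)] strand_of_outer[OF k(1)] strand_of_outer[OF l(1)] k l by (simp add: outer_at_def)
  moreover have "k \<noteq> l" using A k l by auto
  ultimately have "l = joined k" by (auto simp: strand_def)
  then show "A \<in> diagram_of n joined" using A k l by (auto simp: diagram_of_def)
next
  fix A assume "A \<in> diagram_of n joined"
  then obtain k where k: "k \<in> {1..2 * n}" "A = {pt_at n k, pt_at n (joined k)}" by (rule diagram_of_arcE)
  have "pt_at n k \<noteq> pt_at n (joined k)"
    using pt_at_inj[OF k(1) nc_matchingD(1)[OF nc_joined k(1)]] nc_matchingD(2)[OF nc_joined k(1)] by auto
  moreover have "(outer (pt_at n k), outer (pt_at n (joined k))) \<in> arcs\<^sup>*"
    using conn_joined[OF k(1)] by (simp add: outer_at_def)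
  ultimately show "A \<in> stack (gen_diagram n i) (diagram_of n \<sigma>)" using k(2) unfolding stack_def by blast
qed

text \<open>Every glued point except the two at the cup is joined to the outer edge by a vertical
  strand of the generator. A loop must therefore pass through the cup, and it closes exactly when
  the lower diagram joins these two points.\<close>

lemma loops_gen_diagram: "loops n (gen_diagram n i) (diagram_of n \<sigma>) = (if \<sigma> p = Suc p then 1 else 0)"
proof -
  let ?comp = "\<lambda>x. arcs\<^sup>* `` {x}"
  let ?L = "{C. \<exists>j\<in>{1..n}. C = ?comp (GMid j) \<and> C \<subseteq> range GMid}"
  have outer: "\<not> ?comp x \<subseteq> range GMid" if "(x, outer_at k) \<in> arcs\<^sup>*" for x k
  proof
    assume "?comp x \<subseteq> range GMid"
    then have "outer_at k \<in> range GMid" using that by blast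
    then show False by (auto simp: outer_at_eq split: if_splits)
  qed
  have mid: "GMid j = lower_at (2 * n + 1 - j) \<and> 2 * n + 1 - j \<in> {1..2 * n}" if "j \<in> {1..n}" for j
    using that by (auto simp: lower_at_eq)
  have L: "?L = {C. \<exists>k\<in>{p, Suc p}. C = ?comp (lower_at k) \<and> C \<subseteq> range GMid}"
  proof (intro equalityI subsetI)
    fix C assume "C \<in> ?L"
    then obtain j where j: "j \<in> {1..n}" "C = ?comp (GMid j)" "C \<subseteq> range GMid" by blast
    let ?k = "2 * n + 1 - j"
    have "?k \<in> {p, Suc p}"
      using outer[OF conn_sym[OF conn_strand[of ?k]]] mid[OF j(1)] j by auto
    then show "C \<in> {C. \<exists>k\<in>{p, Suc p}. C = ?comp (lower_at k) \<and> C \<subseteq> range GMid}"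
      using mid[OF j(1)] j by auto
  next
    fix C assume "C \<in> {C. \<exists>k\<in>{p, Suc p}. C = ?comp (lower_at k) \<and> C \<subseteq> range GMid}"
    then obtain k where k: "k \<in> {p, Suc p}" "C = ?comp (lower_at k)" "C \<subseteq> range GMid" by blast
    then have "lower_at k = GMid (2 * n + 1 - k)" "2 * n + 1 - k \<in> {1..n}" using p by (auto simp: lower_at_eq)
    then show "C \<in> ?L" using k by auto
  qed
  show ?thesis
  proof (cases "\<sigma> p = Suc p")
    case True
    have "x \<in> range GMid" if x: "(lower_at p, x) \<in> arcs\<^sup>*" for x
    proof -
      have "strand_of x = {}" using strand_of_conn[OF x] p True by (simp add: strand_of_lower)
      then show ?thesis by (cases x) (auto simp: strand_of_def strand_def)
    qed
    then have "?comp (lower_at p) \<subseteq> range GMid" by blast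
    moreover have "?comp (lower_at (Suc p)) = ?comp (lower_at p)"
      using conn_cup conn_sym by (auto intro: rtrancl_trans)
    ultimately have "?L = {?comp (lower_at p)}" unfolding L by auto
    then show ?thesis using True by (simp add: loops_def)
  next
    case False
    note mp = mate_p[OF False]
    have "\<not> ?comp (lower_at k) \<subseteq> range GMid" if k: "k \<in> {p, Suc p}" for k
    proof -
      have kin: "k \<in> {1..2 * n}" "\<sigma> k \<notin> {p, Suc p}" using k p mp by auto
      then have "(lower_at k, outer_at (\<sigma> k)) \<in> arcs\<^sup>*"
        using conn_arc[OF kin(1)] conn_sym[OF conn_strand[of "\<sigma> k"]] nc_matchingD(1)[OF nc kin(1)]
        by (auto intro: rtrancl_trans)
      then show ?thesis by (rule outer)
    qed
    then have "?L = {}" unfolding L by blast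
    then show ?thesis using False by (simp add: loops_def)
  qed
qed

end


section \<open>The action of the generators\<close>

text \<open>The coefficients of the image of the combination \<open>F\<close> under the linear map
  that sends the matching \<sigma> to \<open>w \<sigma>\<close> times
  \<open>c \<sigma>\<close>.\<close>

definition push :: "nat \<Rightarrow> ((nat \<Rightarrow> nat) \<Rightarrow> nat \<Rightarrow> nat) \<Rightarrow> ((nat \<Rightarrow> nat) \<Rightarrow> cq) \<Rightarrow> ((nat \<Rightarrow> nat) \<Rightarrow> cq) \<Rightarrow> (nat \<Rightarrow> nat) \<Rightarrow> cq" where
  "push n c w F \<tau> = (\<Sum>\<sigma> | nc_matching n \<sigma>. if c \<sigma> = \<tau> then w \<sigma> * F \<sigma> else 0)"

definition loop_weight :: "nat \<Rightarrow> (nat \<Rightarrow> nat) \<Rightarrow> cq" where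
  "loop_weight p \<sigma> = (if \<sigma> p = Suc p then - qint 2 else 1)"

text \<open>Left multiplication by \<open>e_i\<close> in the coordinates given by matchings, as
  \<open>diagram_mult_gen\<close> confirms.\<close>

definition gen_op :: "nat \<Rightarrow> nat \<Rightarrow> ((nat \<Rightarrow> nat) \<Rightarrow> cq) \<Rightarrow> (nat \<Rightarrow> nat) \<Rightarrow> cq" where
  "gen_op n i = push n (contract (2 * n - i)) (loop_weight (2 * n - i))"

lemma push_cong:
  assumes "\<And>\<sigma>. nc_matching n \<sigma> \<Longrightarrow> c \<sigma> = c' \<sigma>" "\<And>\<sigma>. nc_matching n \<sigma> \<Longrightarrow> w \<sigma> = w' \<sigma>"
  shows "push n c w F = push n c' w' F"
  unfolding push_def using assms by (intro ext sum.cong) auto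

lemma push_push:
  assumes "\<And>\<sigma>. nc_matching n \<sigma> \<Longrightarrow> nc_matching n (c' \<sigma>)"
  shows "push n c w (push n c' w' F) = push n (\<lambda>\<sigma>. c (c' \<sigma>)) (\<lambda>\<sigma>. w' \<sigma> * w (c' \<sigma>)) F"
proof
  fix \<tau>
  have "push n c w (push n c' w' F) \<tau> = (\<Sum>\<sigma> | nc_matching n \<sigma>. \<Sum>\<rho> | nc_matching n \<rho>.
      if c' \<rho> = \<sigma> then (if c (c' \<rho>) = \<tau> then w' \<rho> * w (c' \<rho>) * F \<rho> else 0) else 0)"
    unfolding push_def
  proof (rule sum.cong[OF refl])
    fix \<sigma>
    show "(if c \<sigma> = \<tau> then w \<sigma> * (\<Sum>\<rho> | nc_matching n \<rho>. if c' \<rho> = \<sigma> then w' \<rho> * F \<rho> else 0) else 0) =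
      (\<Sum>\<rho> | nc_matching n \<rho>. if c' \<rho> = \<sigma> then (if c (c' \<rho>) = \<tau> then w' \<rho> * w (c' \<rho>) * F \<rho> else 0) else 0)"
      by (cases "c \<sigma> = \<tau>") (auto simp: sum_distrib_left mult_ac intro!: sum.cong sum.neutral)
  qed
  also have "\<dots> = (\<Sum>\<rho> | nc_matching n \<rho>. \<Sum>\<sigma> | nc_matching n \<sigma>.
      if c' \<rho> = \<sigma> then (if c (c' \<rho>) = \<tau> then w' \<rho> * w (c' \<rho>) * F \<rho> else 0) else 0)"
    by (rule sum.swap)
  also have "\<dots> = push n (\<lambda>\<sigma>. c (c' \<sigma>)) (\<lambda>\<sigma>. w' \<sigma> * w (c' \<sigma>)) F \<tau>"
    unfolding push_def
  proof (rule sum.cong[OF refl])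
    fix \<rho> assume "\<rho> \<in> {\<rho>. nc_matching n \<rho>}"
    then have "c' \<rho> \<in> {\<sigma>. nc_matching n \<sigma>}" using assms by simp
    then show "(\<Sum>\<sigma> | nc_matching n \<sigma>. if c' \<rho> = \<sigma> then (if c (c' \<rho>) = \<tau> then w' \<rho> * w (c' \<rho>) * F \<rho> else 0) else 0) =
        (if c (c' \<rho>) = \<tau> then w' \<rho> * w (c' \<rho>) * F \<rho> else 0)"
      using finite_nc_matchings[of n] by simp
  qed
  finally show "push n c w (push n c' w' F) \<tau> = push n (\<lambda>\<sigma>. c (c' \<sigma>)) (\<lambda>\<sigma>. w' \<sigma> * w (c' \<sigma>)) F \<tau>" .
qed

lemma push_scale: "push n c (\<lambda>\<sigma>. a * w \<sigma>) F \<tau> = a * push n c w F \<tau>"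
  unfolding push_def sum_distrib_left by (intro sum.cong) auto

lemma push_sum: "push n c w (\<lambda>\<sigma>. \<Sum>x\<in>S. a x * G x \<sigma>) \<tau> = (\<Sum>x\<in>S. a x * push n c w (G x) \<tau>)"
proof -
  have "push n c w (\<lambda>\<sigma>. \<Sum>x\<in>S. a x * G x \<sigma>) \<tau> =
      (\<Sum>\<sigma> | nc_matching n \<sigma>. \<Sum>x\<in>S. a x * (if c \<sigma> = \<tau> then w \<sigma> * G x \<sigma> else 0))"
    unfolding push_def by (intro sum.cong refl) (auto simp: sum_distrib_left mult_ac)
  also have "\<dots> = (\<Sum>x\<in>S. \<Sum>\<sigma> | nc_matching n \<sigma>. a x * (if c \<sigma> = \<tau> then w \<sigma> * G x \<sigma> else 0))"
    by (rule sum.swap)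
  finally show ?thesis by (simp add: push_def sum_distrib_left)
qed

lemma contract_cup: "\<sigma> (\<sigma> p) = p \<Longrightarrow> contract p \<sigma> p = Suc p" "\<sigma> (\<sigma> p) = p \<Longrightarrow> contract p \<sigma> (Suc p) = p"
  by (auto simp: contract_def)

lemma contract_contract: "contract p (contract p \<sigma>) = contract p \<sigma>"
  by (simp add: contract_def)

text \<open>Contracting at an adjacent position moves the loose end along, and contracting back moves it
  home.\<close>

lemma contract_adjacent:
  assumes inv: "\<And>x. \<sigma> (\<sigma> x) = x" and fx: "\<sigma> (Suc (Suc p)) \<noteq> Suc (Suc p)" and p: "\<sigma> p = Suc p"
  shows "contract p (contract (Suc p) \<sigma>) = \<sigma>" "\<sigma> (Suc p) \<noteq> Suc (Suc p)"
    "contract (Suc p) \<sigma> p \<noteq> Suc p"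
proof -
  have q: "\<sigma> (Suc p) = p" using inv p by metis
  define z where "z = \<sigma> (Suc (Suc p))"
  have z: "z \<noteq> p" "z \<noteq> Suc p" "z \<noteq> Suc (Suc p)" "\<sigma> z = Suc (Suc p)"
    using inv[of "Suc (Suc p)"] p q fx unfolding z_def by auto
  have c: "contract (Suc p) \<sigma> = \<sigma>(p := z, z := p, Suc p := Suc (Suc p), Suc (Suc p) := Suc p)"
    using q by (simp add: contract_def z_def)
  show "contract (Suc p) \<sigma> p \<noteq> Suc p" unfolding c using z by simp
  show "\<sigma> (Suc p) \<noteq> Suc (Suc p)" using q by simp
  show "contract p (contract (Suc p) \<sigma>) = \<sigma>"
    unfolding c contract_def[of p] using z p q z_def by (auto simp: fun_eq_iff)
qed

lemma contract_adjacent':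
  assumes inv: "\<And>x. \<sigma> (\<sigma> x) = x" and fx: "\<sigma> p \<noteq> p" and p: "\<sigma> (Suc p) = Suc (Suc p)"
  shows "contract (Suc p) (contract p \<sigma>) = \<sigma>" "\<sigma> p \<noteq> Suc p"
    "contract p \<sigma> (Suc p) \<noteq> Suc (Suc p)"
proof -
  have q: "\<sigma> (Suc (Suc p)) = Suc p" using inv p by metis
  define z where "z = \<sigma> p"
  have z: "z \<noteq> p" "z \<noteq> Suc p" "z \<noteq> Suc (Suc p)" "\<sigma> z = p"
    using inv[of p] p q fx unfolding z_def by auto
  have c: "contract p \<sigma> = \<sigma>(z := Suc (Suc p), Suc (Suc p) := z, p := Suc p, Suc p := p)"
    using z p by (simp add: contract_def z_def)
  show "contract p \<sigma> (Suc p) \<noteq> Suc (Suc p)" unfolding c by simp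
  show "\<sigma> p \<noteq> Suc p" using z z_def by simp
  show "contract (Suc p) (contract p \<sigma>) = \<sigma>"
    unfolding c contract_def[of "Suc p"] using z p q z_def by (auto simp: fun_eq_iff)
qed

text \<open>A description of \<open>contract\<close> that is symmetric in the two points, covers the
  case of a loop by the same formula, and allows arbitrary points. In this form commutation is a
  finite case check on the mates of the four points.\<close>

definition join_ends :: "'a \<Rightarrow> 'a \<Rightarrow> ('a \<Rightarrow> 'a) \<Rightarrow> 'a \<Rightarrow> 'a" where
  "join_ends p p' \<sigma> x = (if x = p then p' else if x = p' then p
     else if x = \<sigma> p then \<sigma> p' else if x = \<sigma> p' then \<sigma> p else \<sigma> x)"

lemma contract_eq_join_ends:
  assumes inv: "\<And>x. \<sigma> (\<sigma> x) = x"
  shows "contract p \<sigma> = join_ends p (Suc p) \<sigma>"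
proof
  fix x
  show "contract p \<sigma> x = join_ends p (Suc p) \<sigma> x"
    using inv[of x] inv[of p] inv[of "Suc p"] unfolding contract_def join_ends_def fun_upd_apply
    by (smt (verit))
qed

lemma join_ends_commute:
  assumes inv: "\<And>x. \<sigma> (\<sigma> x) = x" and fx: "\<sigma> p \<noteq> p" "\<sigma> p' \<noteq> p'" "\<sigma> q \<noteq> q" "\<sigma> q' \<noteq> q'"
    and d: "p \<noteq> p'" "p \<noteq> q" "p \<noteq> q'" "p' \<noteq> q" "p' \<noteq> q'" "q \<noteq> q'"
  shows "join_ends p p' (join_ends q q' \<sigma>) x = join_ends q q' (join_ends p p' \<sigma>) x"
    "join_ends q q' \<sigma> p = p' \<longleftrightarrow> (if \<sigma> p = q then \<sigma> p' = q' else if \<sigma> p = q' then \<sigma> p' = q else \<sigma> p = p')"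
    "join_ends p p' \<sigma> q = q' \<longleftrightarrow> (if \<sigma> p = q then \<sigma> p' = q' else if \<sigma> p = q' then \<sigma> p' = q else \<sigma> q = q')"
    "\<sigma> p = q \<or> \<sigma> p = q' \<Longrightarrow> \<sigma> q \<noteq> q' \<and> \<sigma> p \<noteq> p'"
  using inv[of x] inv[of p] inv[of p'] inv[of q] inv[of q'] fx d unfolding join_ends_def
  by (smt (verit))+

text \<open>The total loop factors agree for the following reason. If the ends at \<open>p\<close>
  and \<open>q\<close> are joined to each other by two arcs, the loop closes at the second
  contraction, whichever that is. In all other cases neither contraction affects whether the other
  one closes a loop.\<close>

lemma contract_commute:
  assumes \<sigma>: "nc_matching n \<sigma>" and pq: "n < p" "Suc p < q" "q < 2 * n"
  shows "contract p (contract q \<sigma>) = contract q (contract p \<sigma>)"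
    "loop_weight q \<sigma> * loop_weight p (contract q \<sigma>) = loop_weight p \<sigma> * loop_weight q (contract p \<sigma>)"
proof -
  note inv = nc_matching_invol[OF \<sigma>]
  have "{p, Suc p, q, Suc q} \<subseteq> {1..2 * n}" using pq by auto
  then have fx: "\<sigma> p \<noteq> p" "\<sigma> (Suc p) \<noteq> Suc p" "\<sigma> q \<noteq> q" "\<sigma> (Suc q) \<noteq> Suc q"
    using nc_matchingD(2)[OF \<sigma>] by blast+
  have d: "p \<noteq> Suc p" "p \<noteq> q" "p \<noteq> Suc q" "Suc p \<noteq> q" "Suc p \<noteq> Suc q" "q \<noteq> Suc q" using pq by auto
  note J = join_ends_commute[of \<sigma>, OF inv fx d]
  have nc: "nc_matching n (contract p \<sigma>)" "nc_matching n (contract q \<sigma>)"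
    using nc_contract[OF \<sigma>] pq by auto
  note c = contract_eq_join_ends[of \<sigma>, OF inv]
  show "contract p (contract q \<sigma>) = contract q (contract p \<sigma>)"
    unfolding contract_eq_join_ends[of "contract q \<sigma>", OF nc_matching_invol[OF nc(2)]]
      contract_eq_join_ends[of "contract p \<sigma>", OF nc_matching_invol[OF nc(1)]]
    unfolding c by (rule ext) (rule J(1))
  show "loop_weight q \<sigma> * loop_weight p (contract q \<sigma>) = loop_weight p \<sigma> * loop_weight q (contract p \<sigma>)"
    unfolding loop_weight_def c J(2,3) using J(4) by auto
qed

section \<open>The relations of the generators and the combination that they kill\<close>

context
  fixes n :: nat
begin

lemma gen_op_square: "i \<in> {1..<n} \<Longrightarrow> gen_op n i (gen_op n i F) \<tau> = - qint 2 * gen_op n i F \<tau>"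
proof -
  assume i: "i \<in> {1..<n}"
  have p: "n < 2 * n - i" "2 * n - i < 2 * n" using i by auto
  let ?p = "2 * n - i"
  have "gen_op n i (gen_op n i F) = push n (contract ?p) (\<lambda>\<sigma>. - qint 2 * loop_weight ?p \<sigma>) F"
  proof -
    have "gen_op n i (gen_op n i F) = push n (\<lambda>\<sigma>. contract ?p (contract ?p \<sigma>))
        (\<lambda>\<sigma>. loop_weight ?p \<sigma> * loop_weight ?p (contract ?p \<sigma>)) F"
      unfolding gen_op_def by (rule push_push) (rule nc_contract[OF _ p])
    also have "\<dots> = push n (contract ?p) (\<lambda>\<sigma>. - qint 2 * loop_weight ?p \<sigma>) F"
    proof (rule push_cong)
      fix \<sigma> assume "nc_matching n \<sigma>"
      then have "contract ?p \<sigma> ?p = Suc ?p" using contract_cup(1) nc_matching_invol by blast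
      then have "loop_weight ?p (contract ?p \<sigma>) = - qint 2" unfolding loop_weight_def by (rule if_P)
      then show "loop_weight ?p \<sigma> * loop_weight ?p (contract ?p \<sigma>) = - qint 2 * loop_weight ?p \<sigma>"
        by (simp only:) (rule mult.commute)
    qed (rule contract_contract)
    finally show ?thesis .
  qed
  then show ?thesis unfolding gen_op_def push_scale by simp
qed

text \<open>The first contraction creates a cup. Contracting at the neighbouring position and back
  again returns to the same matching without closing a loop.\<close>

lemma gen_op_adjacent:
  assumes i: "i \<in> {1..<n}" "j \<in> {1..<n}" "j = Suc i \<or> i = Suc j"
  shows "gen_op n i (gen_op n j (gen_op n i F)) = gen_op n i F"
proof -
  let ?p = "2 * n - i" and ?q = "2 * n - j"
  have p: "n < ?p" "?p < 2 * n" and q: "n < ?q" "?q < 2 * n" using i by auto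
  have *: "contract ?p (contract ?q \<rho>) = \<rho> \<and> loop_weight ?q \<rho> = 1 \<and> loop_weight ?p (contract ?q \<rho>) = 1"
    if \<rho>: "nc_matching n \<rho>" "\<rho> ?p = Suc ?p" for \<rho>
  proof (cases "j = Suc i")
    case True
    then have e: "?p = Suc ?q" using i by auto
    have "\<rho> ?q \<noteq> ?q" using nc_matchingD(2)[OF \<rho>(1), of ?q] q by auto
    then show ?thesis
      using contract_adjacent'[of \<rho> ?q, OF nc_matching_invol[OF \<rho>(1)] _ \<rho>(2)[unfolded e]]
      unfolding e loop_weight_def by metis
  next
    case False
    then have e: "?q = Suc ?p" using i by auto
    have "\<rho> (Suc (Suc ?p)) \<noteq> Suc (Suc ?p)" using nc_matchingD(2)[OF \<rho>(1), of "Suc (Suc ?p)"] q e by auto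
    then show ?thesis
      using contract_adjacent[of \<rho> ?p, OF nc_matching_invol[OF \<rho>(1)] _ \<rho>(2)]
      unfolding e loop_weight_def by metis
  qed
  have c: "nc_matching n (contract ?p \<sigma>) \<and> contract ?p \<sigma> ?p = Suc ?p" if "nc_matching n \<sigma>" for \<sigma>
    using nc_contract[OF that p] contract_cup(1) nc_matching_invol[OF that] by blast
  have 1: "gen_op n j (gen_op n i F) = push n (\<lambda>\<sigma>. contract ?q (contract ?p \<sigma>)) (\<lambda>\<sigma>. loop_weight ?p \<sigma> * loop_weight ?q (contract ?p \<sigma>)) F"
    unfolding gen_op_def by (rule push_push) (rule nc_contract[OF _ p])
  have "gen_op n i (gen_op n j (gen_op n i F)) = push n (\<lambda>\<sigma>. contract ?p (contract ?q (contract ?p \<sigma>)))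
      (\<lambda>\<sigma>. (loop_weight ?p \<sigma> * loop_weight ?q (contract ?p \<sigma>)) * loop_weight ?p (contract ?q (contract ?p \<sigma>))) F"
    unfolding 1 unfolding gen_op_def
    by (rule push_push[where c = "contract ?p" and c' = "\<lambda>\<sigma>. contract ?q (contract ?p \<sigma>)"])
      (rule nc_contract[OF nc_contract[OF _ p] q])
  also have "\<dots> = gen_op n i F"
    unfolding gen_op_def
  proof (rule push_cong)
    fix \<sigma> assume "nc_matching n \<sigma>"
    note c' = *[OF conjunct1[OF c[OF this]] conjunct2[OF c[OF this]]]
    show "contract ?p (contract ?q (contract ?p \<sigma>)) = contract ?p \<sigma>" using c' by blast
    show "loop_weight ?p \<sigma> * loop_weight ?q (contract ?p \<sigma>) * loop_weight ?p (contract ?q (contract ?p \<sigma>)) = loop_weight ?p \<sigma>"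
      using c' by (metis mult_1_right)
  qed
  finally show ?thesis .
qed

lemma gen_op_commute:
  assumes i: "i \<in> {1..<n}" "j \<in> {1..<n}" "\<bar>int i - int j\<bar> > 1"
  shows "gen_op n i (gen_op n j F) = gen_op n j (gen_op n i F)"
proof -
  have *: "gen_op n i (gen_op n j F) = gen_op n j (gen_op n i F)"
    if i: "i \<in> {1..<n}" "j \<in> {1..<n}" "Suc j < i" for i j
  proof -
    let ?p = "2 * n - i" and ?q = "2 * n - j"
    have p: "n < ?p" "?p < 2 * n" and q: "n < ?q" "?q < 2 * n" and pq: "Suc ?p < ?q" using i by auto
    note c = contract_commute[OF _ p(1) pq q(2)]
    have "gen_op n i (gen_op n j F) = push n (\<lambda>\<sigma>. contract ?p (contract ?q \<sigma>)) (\<lambda>\<sigma>. loop_weight ?q \<sigma> * loop_weight ?p (contract ?q \<sigma>)) F"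
      unfolding gen_op_def by (rule push_push) (rule nc_contract[OF _ q])
    also have "\<dots> = push n (\<lambda>\<sigma>. contract ?q (contract ?p \<sigma>)) (\<lambda>\<sigma>. loop_weight ?p \<sigma> * loop_weight ?q (contract ?p \<sigma>)) F"
      by (rule push_cong) (rule c; assumption)+
    also have "\<dots> = gen_op n j (gen_op n i F)"
      unfolding gen_op_def by (rule push_push[symmetric]) (rule nc_contract[OF _ p])
    finally show ?thesis .
  qed
  consider "Suc j < i" | "Suc i < j" using i(3) by linarith
  then show ?thesis using *[of i j] *[of j i] i by cases auto
qed

text \<open>At a matching \<tau> with a cup at this place the coefficient collects
  \<open>- [2]\<close> times the value at \<tau> and the values at the other preimages with factor
  1; the peak relation says that they cancel. Any other \<tau> is not in the image of the
  contraction.\<close>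

lemma gen_op_label_sum:
  assumes i: "i \<in> {1..<n}"
  shows "gen_op n i (\<lambda>\<sigma>. a * label_sum n \<sigma>) \<tau> = 0"
proof -
  let ?p = "2 * n - i"
  have p: "n < ?p" "?p < 2 * n" using i by auto
  have fin: "finite {\<sigma>. nc_matching n \<sigma> \<and> contract ?p \<sigma> = \<tau>}"
    by (rule finite_subset[OF _ finite_nc_matchings[of n]]) auto
  have eq: "gen_op n i (\<lambda>\<sigma>. a * label_sum n \<sigma>) \<tau> =
      (\<Sum>\<sigma> | nc_matching n \<sigma> \<and> contract ?p \<sigma> = \<tau>. loop_weight ?p \<sigma> * (a * label_sum n \<sigma>))"
    unfolding gen_op_def push_def using finite_nc_matchings[of n]
    by (simp add: sum.inter_filter[symmetric])
  show ?thesis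
  proof (cases "nc_matching n \<tau> \<and> \<tau> ?p = Suc ?p")
    case True
    then have self: "contract ?p \<tau> = \<tau>" by (simp add: contract_def)
    have "{\<sigma>. nc_matching n \<sigma> \<and> contract ?p \<sigma> = \<tau>} =
        insert \<tau> {\<sigma>. nc_matching n \<sigma> \<and> contract ?p \<sigma> = \<tau> \<and> \<sigma> \<noteq> \<tau>}"
      using True self by auto
    then have "gen_op n i (\<lambda>\<sigma>. a * label_sum n \<sigma>) \<tau> = - qint 2 * (a * label_sum n \<tau>) +
        (\<Sum>\<sigma> | nc_matching n \<sigma> \<and> contract ?p \<sigma> = \<tau> \<and> \<sigma> \<noteq> \<tau>. loop_weight ?p \<sigma> * (a * label_sum n \<sigma>))"
      unfolding eq using True fin by (simp add: loop_weight_def)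
    also have "(\<Sum>\<sigma> | nc_matching n \<sigma> \<and> contract ?p \<sigma> = \<tau> \<and> \<sigma> \<noteq> \<tau>. loop_weight ?p \<sigma> * (a * label_sum n \<sigma>)) =
        (\<Sum>\<sigma> | nc_matching n \<sigma> \<and> contract ?p \<sigma> = \<tau> \<and> \<sigma> \<noteq> \<tau>. a * label_sum n \<sigma>)"
      by (rule sum.cong) (auto simp: loop_weight_def contract_def)
    also have "\<dots> = a * (qint 2 * label_sum n \<tau>)"
      using label_sum_peak[of n \<tau> ?p] True p by (simp add: sum_distrib_left)
    finally show ?thesis by simp
  next
    case False
    have "{\<sigma>. nc_matching n \<sigma> \<and> contract ?p \<sigma> = \<tau>} = {}"
      using False nc_contract[OF _ p] contract_cup(1) nc_matching_invol by blast
    then show ?thesis unfolding eq by (simp only: sum.empty)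
  qed
qed

section \<open>Single diagrams: the identity and the diagrams with a cap on top\<close>

definition delta :: "(nat \<Rightarrow> nat) \<Rightarrow> (nat \<Rightarrow> nat) \<Rightarrow> cq" where
  "delta \<rho> \<sigma> = (if \<sigma> = \<rho> then 1 else 0)"

lemma gen_op_delta:
  assumes i: "i \<in> {1..<n}" and \<rho>: "nc_matching n \<rho>" "\<rho> (2 * n - i) = Suc (2 * n - i)"
  shows "gen_op n i (delta \<rho>) \<tau> = - qint 2 * delta \<rho> \<tau>"
proof -
  have "gen_op n i (delta \<rho>) \<tau> = (\<Sum>\<sigma> | nc_matching n \<sigma>. if \<sigma> = \<rho> then (if contract (2 * n - i) \<rho> = \<tau> then loop_weight (2 * n - i) \<rho> else 0) else 0)"
    unfolding gen_op_def push_def delta_def by (intro sum.cong) auto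
  also have "\<dots> = (if contract (2 * n - i) \<rho> = \<tau> then loop_weight (2 * n - i) \<rho> else 0)"
    using \<rho>(1) finite_nc_matchings[of n] by simp
  finally show ?thesis using \<rho>(2) by (auto simp: contract_def loop_weight_def delta_def)
qed

lemma sum_delta: "nc_matching n \<sigma> \<Longrightarrow> (\<Sum>\<rho> | nc_matching n \<rho>. F \<rho> * delta \<rho> \<sigma>) = F \<sigma>"
  using finite_nc_matchings[of n] by (simp add: delta_def if_distrib[of "\<lambda>x. _ * x"] cong: if_cong)

text \<open>If some arc opens at a top position, the last one to open can enclose nothing and is the
  required arc. Otherwise all top positions are matched with bottom positions, and in a noncrossing
  way this is possible only in reverse order.\<close>

lemma top_cup_exists:
  assumes m: "nc_matching n \<sigma>" and ne: "\<sigma> \<noteq> id_matching n"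
  obtains i where "i \<in> {1..<n}" "\<sigma> (2 * n - i) = Suc (2 * n - i)"
proof (cases "\<exists>x. n < x \<and> x \<le> 2 * n \<and> x < \<sigma> x")
  case True
  let ?X = "{x. n < x \<and> x \<le> 2 * n \<and> x < \<sigma> x}"
  have fin: "finite ?X" by (rule finite_subset[of _ "{..2 * n}"]) auto
  define x where "x = Max ?X"
  have "?X \<noteq> {}" using True by blast
  then have "x \<in> ?X" unfolding x_def by (rule Max_in[OF fin])
  then have x: "n < x" "x \<le> 2 * n" "x < \<sigma> x" by auto
  have mx: "y \<le> x" if "n < y" "y \<le> 2 * n" "y < \<sigma> y" for y
    unfolding x_def using Max_ge[OF fin] that by blast
  have \<sigma>x: "\<sigma> x \<le> 2 * n" using nc_matchingD(5)[OF m, of x] x by auto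
  have "\<sigma> x = Suc x"
  proof (rule ccontr)
    assume "\<sigma> x \<noteq> Suc x"
    then have y: "x < Suc x" "Suc x < \<sigma> x" using x by auto
    have "x < \<sigma> (Suc x)" using nc_matching_nested(1)[OF m y] .
    moreover have "\<sigma> (Suc x) \<noteq> Suc x" using nc_matchingD(2)[OF m, of "Suc x"] x y \<sigma>x by auto
    ultimately have "Suc x < \<sigma> (Suc x)" by simp
    then show False using mx[of "Suc x"] x y \<sigma>x by auto
  qed
  moreover have "2 * n - x \<in> {1..<n}" "2 * n - (2 * n - x) = x" using x \<sigma>x by auto
  ultimately show thesis using that[of "2 * n - x"] by simp
next
  case False
  then have up: "\<sigma> x < x" if "n < x" "x \<le> 2 * n" for x
  proof -
    have "\<sigma> x \<noteq> x" using nc_matchingD(2)[OF m, of x] that by auto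
    moreover have "\<not> x < \<sigma> x" using False that by blast
    ultimately show ?thesis by linarith
  qed
  have lo: "\<sigma> x \<le> n" if "n < x" "x \<le> 2 * n" for x
  proof (rule ccontr)
    assume "\<not> \<sigma> x \<le> n"
    then have "\<sigma> (\<sigma> x) < \<sigma> x" using up[of "\<sigma> x"] up[OF that] that by auto
    then show False using up[OF that] nc_matching_invol[OF m, of x] by simp
  qed
  have "\<sigma> ` {n<..2 * n} = {1..n}"
  proof (rule card_subset_eq)
    show "\<sigma> ` {n<..2 * n} \<subseteq> {1..n}" using lo nc_matchingD(4)[OF m] by fastforce
    have "inj_on \<sigma> {n<..2 * n}" by (rule inj_on_inverseI[where g = \<sigma>]) (rule nc_matching_invol[OF m])
    then show "card (\<sigma> ` {n<..2 * n}) = card {1..n}" by (simp add: card_image)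
  qed simp
  then have hi: "n < \<sigma> k \<and> \<sigma> k \<le> 2 * n" if k: "k \<in> {1..n}" for k
  proof -
    obtain x where "x \<in> {n<..2 * n}" "k = \<sigma> x" using k \<open>\<sigma> ` {n<..2 * n} = {1..n}\<close> by blast
    then show ?thesis using nc_matching_invol[OF m, of x] by simp
  qed
  \<comment> \<open>A strictly decreasing map from \<open>{1..n}\<close> to the \<open>n\<close>
    positions above \<open>n\<close> is determined; the bounds \<open>le\<close> and
    \<open>ge\<close> enclose its values from both sides.\<close>
  have anti: "\<sigma> (Suc k) < \<sigma> k" if "1 \<le> k" "Suc k \<le> n" for k
    using nc_matching_nested(2)[OF m, of k "Suc k"] hi[of k] that by auto
  have le: "\<sigma> (Suc k) + k \<le> 2 * n" if "Suc k \<le> n" for k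
    using that
  proof (induction k)
    case 0 then show ?case using hi[of 1] by simp
  next
    case (Suc k) then show ?case using anti[of "Suc k"] by simp
  qed
  have ge: "n + 1 + k \<le> \<sigma> (n - k)" if "k < n" for k
    using that
  proof (induction k)
    case 0 then show ?case using hi[of n] by simp
  next
    case (Suc k)
    then have "Suc (n - Suc k) = n - k" "1 \<le> n - Suc k" by simp_all
    then show ?case using Suc anti[of "n - Suc k"] by simp
  qed
  have low: "\<sigma> k = 2 * n + 1 - k" if k: "k \<in> {1..n}" for k
    using le[of "k - 1"] ge[of "n - k"] k by auto
  have "\<sigma> = id_matching n"
  proof
    fix k
    consider "k \<in> {1..n}" | "n < k" "k \<le> 2 * n" | "k \<notin> {1..2 * n}" by fastforce
    then show "\<sigma> k = id_matching n k"
    proof cases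
      case 1 then show ?thesis using low by (simp add: id_matching_def)
    next
      case 2
      then have "2 * n + 1 - k \<in> {1..n}" "2 * n + 1 - (2 * n + 1 - k) = k" by auto
      then have "\<sigma> (2 * n + 1 - k) = k" using low[of "2 * n + 1 - k"] by simp
      then have "\<sigma> k = 2 * n + 1 - k" using nc_matching_invol[OF m] by metis
      then show ?thesis using 2 by (simp add: id_matching_def)
    next
      case 3 then show ?thesis using nc_matching_fix[OF m 3] unfolding id_matching_def by (metis (full_types))
    qed
  qed
  then show thesis using ne by blast
qed

lemma matching_path_id: "matching_path n (id_matching n) = top_path n"
proof (rule nth_equalityI)
  show "length (matching_path n (id_matching n)) = length (top_path n)"
    by (simp add: matching_path_def top_path_def)
  fix k assume "k < length (matching_path n (id_matching n))"
  then have k: "k < 2 * n" by (simp add: matching_path_def del: upt_Suc)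
  then have "matching_path n (id_matching n) ! k = (if Suc k < id_matching n (Suc k) then Up else Down)"
    by (simp add: matching_path_def del: upt_Suc)
  then show "matching_path n (id_matching n) ! k = top_path n ! k"
    using k by (auto simp: id_matching_def top_path_def nth_append)
qed

text \<open>The region is empty and the only tiling has no tiles. This normalises the combination:
  its coefficient at the identity is 1.\<close>

lemma tiling_sum_top_path: "tiling_sum (top_path n) = 1"
proof -
  interpret matching n "id_matching n" by unfold_locales (rule nc_id_matching)
  have "ht k = lam k" if "k \<le> 2 * n" for k
    using height_matching_path[OF that] height_top_path[OF that] by (simp add: matching_path_id lam_def)
  then have "region_boxes (top_path n) = {}"
    using region_boxes_path unfolding matching_path_id by (auto simp: in_region_def)
  then have "cover_inclusive_tilings (top_path n) = {{}}"
    by (auto simp: cover_inclusive_tilings_def dyck_tiling_def partition_on_def)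
  then show ?thesis by (simp add: tiling_sum_def)
qed

end


section \<open>The free algebra acting on combinations of matchings\<close>

definition word_op :: "nat \<Rightarrow> nat list \<Rightarrow> ((nat \<Rightarrow> nat) \<Rightarrow> cq) \<Rightarrow> (nat \<Rightarrow> nat) \<Rightarrow> cq" where
  "word_op n ws F = foldr (gen_op n) ws F"

text \<open>The free algebra acting by left multiplication on combinations of matchings. Applied to
  the identity matching, the action computes the diagram expansion.\<close>

definition act :: "nat \<Rightarrow> (gen_word \<Rightarrow>\<^sub>0 cq) \<Rightarrow> ((nat \<Rightarrow> nat) \<Rightarrow> cq) \<Rightarrow> (nat \<Rightarrow> nat) \<Rightarrow> cq" where
  "act n x F \<tau> = (\<Sum>w\<in>Poly_Mapping.keys x. Poly_Mapping.lookup x w * word_op n (letters w) F \<tau>)"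

lemma sum_single_keys: "x = (\<Sum>w\<in>Poly_Mapping.keys x. Poly_Mapping.single w (Poly_Mapping.lookup x w))"
proof (rule poly_mapping_eqI)
  fix v
  have "Poly_Mapping.lookup (\<Sum>w\<in>Poly_Mapping.keys x. Poly_Mapping.single w (Poly_Mapping.lookup x w)) v =
      (\<Sum>w\<in>Poly_Mapping.keys x. if w = v then Poly_Mapping.lookup x w else 0)"
    unfolding lookup_sum by (intro sum.cong) (auto simp: lookup_single when_def)
  also have "\<dots> = Poly_Mapping.lookup x v" by (simp add: in_keys_iff)
  finally show "Poly_Mapping.lookup x v =
      Poly_Mapping.lookup (\<Sum>w\<in>Poly_Mapping.keys x. Poly_Mapping.single w (Poly_Mapping.lookup x w)) v" ..
qed

lemma word_op_Cons: "word_op n (i # ws) F = gen_op n i (word_op n ws F)"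
  by (simp add: word_op_def)

lemma word_op_append: "word_op n (us @ ws) F = word_op n us (word_op n ws F)"
  by (simp add: word_op_def)

lemma word_op_sum:
  "word_op n ws (\<lambda>\<sigma>. \<Sum>x\<in>S. a x * G x \<sigma>) \<tau> = (\<Sum>x\<in>S. a x * word_op n ws (G x) \<tau>)"
proof (induction ws arbitrary: \<tau>)
  case (Cons i ws)
  have "word_op n ws (\<lambda>\<sigma>. \<Sum>x\<in>S. a x * G x \<sigma>) = (\<lambda>\<tau>. \<Sum>x\<in>S. a x * word_op n ws (G x) \<tau>)"
    using Cons by blast
  then show ?case unfolding word_op_Cons gen_op_def by (simp add: push_sum)
qed (simp add: word_op_def)

lemma act_superset:
  assumes "finite S" "Poly_Mapping.keys x \<subseteq> S"
  shows "act n x F \<tau> = (\<Sum>w\<in>S. Poly_Mapping.lookup x w * word_op n (letters w) F \<tau>)"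
  unfolding act_def using assms by (intro sum.mono_neutral_left) (auto simp: in_keys_iff)

lemma act_add: "act n (x + y) F \<tau> = act n x F \<tau> + act n y F \<tau>"
proof -
  let ?S = "Poly_Mapping.keys x \<union> Poly_Mapping.keys y"
  show ?thesis
    unfolding act_superset[of ?S x n F \<tau>, OF _ Un_upper1] act_superset[of ?S y n F \<tau>, OF _ Un_upper2]
    using act_superset[of ?S "x + y" n F \<tau>] Poly_Mapping.keys_add[of x y]
    by (simp add: act_superset[of ?S] lookup_add algebra_simps sum.distrib)
qed

lemma act_0: "act n 0 F \<tau> = 0"
  by (simp add: act_def)

lemma act_uminus: "act n (- x) F \<tau> = - act n x F \<tau>"
  by (simp add: act_def sum_negf)

lemma act_diff: "act n (x - y) F \<tau> = act n x F \<tau> - act n y F \<tau>"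
  using act_add[of n x "- y"] act_uminus[of n y] by simp

lemma act_single: "act n (Poly_Mapping.single w c) F \<tau> = c * word_op n (letters w) F \<tau>"
  by (simp add: act_def)

lemma act_sum: "act n (\<Sum>x\<in>S. g x) F \<tau> = (\<Sum>x\<in>S. act n (g x) F \<tau>)"
  by (induction S rule: infinite_finite_induct) (simp_all add: act_0 act_add)

lemma one_eq_single: "1 = Poly_Mapping.single (Word []) (1::cq)"
  using single_one zero_gen_word_def by metis

lemma act_linear: "act n x (\<lambda>\<sigma>. \<Sum>y\<in>S. a y * G y \<sigma>) \<tau> = (\<Sum>y\<in>S. a y * act n x (G y) \<tau>)"
  unfolding act_def word_op_sum sum_distrib_left
  by (subst sum.swap) (simp add: mult.left_commute)

lemma act_scale: "act n x (\<lambda>\<sigma>. a * G \<sigma>) \<tau> = a * act n x G \<tau>"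
  using act_linear[of n x "\<lambda>_. a" "\<lambda>_. G" "{()}"] by simp

lemma act_zero_fun: "act n x (\<lambda>\<sigma>. 0) \<tau> = 0"
  using act_scale[of n x 0 "\<lambda>_. 0"] by simp

lemma act_mult: "act n (x * y) F = act n x (act n y F)"
proof
  fix \<tau>
  let ?x = "\<lambda>w. Poly_Mapping.lookup x w" and ?y = "\<lambda>w. Poly_Mapping.lookup y w"
  have "x * y = (\<Sum>u\<in>Poly_Mapping.keys x. \<Sum>v\<in>Poly_Mapping.keys y. Poly_Mapping.single (u + v) (?x u * ?y v))"
    by (subst sum_single_keys[of x], subst sum_single_keys[of y]) (simp add: sum_product mult_single)
  then have "act n (x * y) F \<tau> = (\<Sum>u\<in>Poly_Mapping.keys x. \<Sum>v\<in>Poly_Mapping.keys y.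
      ?x u * ?y v * word_op n (letters (u + v)) F \<tau>)"
    by (simp add: act_sum act_single)
  also have "\<dots> = (\<Sum>u\<in>Poly_Mapping.keys x. ?x u * (\<Sum>v\<in>Poly_Mapping.keys y.
      ?y v * word_op n (letters u) (word_op n (letters v) F) \<tau>))"
    by (simp add: plus_gen_word_def word_op_append sum_distrib_left mult.assoc)
  also have "\<dots> = act n x (act n y F) \<tau>"
    unfolding act_def[of n x] act_def[of n y, abs_def] word_op_sum ..
  finally show "act n (x * y) F \<tau> = act n x (act n y F) \<tau>" .
qed

lemma act_gen: "act n (free_gen i) F = gen_op n i F"
  by (auto simp: free_gen_def act_single word_op_def fun_eq_iff)

lemma act_scalar: "act n (free_scalar c) F \<tau> = c * F \<tau>"
  by (simp add: free_scalar_def act_single word_op_def)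

section \<open>Comparison with the diagram algebra\<close>

lemma diagram_mult_gen:
  assumes i: "i \<in> {1..<n}"
  shows "(basis_diagram (gen_diagram n i) \<otimes>\<^bsub>diagram_algebra n\<^esub> f) D =
    (\<Sum>\<sigma> | nc_matching n \<sigma>. if diagram_of n (contract (2 * n - i) \<sigma>) = D
       then loop_weight (2 * n - i) \<sigma> * f (diagram_of n \<sigma>) else 0)"
proof -
  let ?g = "gen_diagram n i" and ?T = "tl_diagrams n"
  have g: "?g \<in> ?T" using gen_diagram_eq[OF i] diagram_of_in_tl_diagrams[OF nc_gen_matching[OF i]] by simp
  let ?h = "\<lambda>D2. if stack ?g D2 = D then f D2 * (- qint 2) ^ loops n ?g D2 else 0"
  have "(basis_diagram ?g \<otimes>\<^bsub>diagram_algebra n\<^esub> f) D =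
      (\<Sum>(D1, D2)\<in>{(D1, D2). D1 \<in> ?T \<and> D2 \<in> ?T \<and> stack D1 D2 = D}.
        basis_diagram ?g D1 * f D2 * (- qint 2) ^ loops n D1 D2)"
    by (simp add: diagram_algebra_def)
  also have "\<dots> = (\<Sum>(D1, D2)\<in>?T \<times> ?T. if D1 = ?g then ?h D2 else 0)"
    by (rule sum.mono_neutral_cong_left) (auto simp: finite_tl_diagrams basis_diagram_def split: if_splits)
  also have "\<dots> = (\<Sum>D1\<in>?T. \<Sum>D2\<in>?T. if D1 = ?g then ?h D2 else 0)"
    by (rule sum.cartesian_product[symmetric])
  also have "\<dots> = (\<Sum>D1\<in>?T. if D1 = ?g then (\<Sum>D2\<in>?T. ?h D2) else 0)"
    by (intro sum.cong) auto
  also have "\<dots> = (\<Sum>D2\<in>?T. ?h D2)" using g finite_tl_diagrams[of n] by simp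
  also have "\<dots> = (\<Sum>\<sigma> | nc_matching n \<sigma>. ?h (diagram_of n \<sigma>))"
    by (rule sum.reindex_bij_betw[OF bij_diagram_of, symmetric])
  also have "\<dots> = (\<Sum>\<sigma> | nc_matching n \<sigma>. if diagram_of n (contract (2 * n - i) \<sigma>) = D
       then loop_weight (2 * n - i) \<sigma> * f (diagram_of n \<sigma>) else 0)"
  proof (rule sum.cong[OF refl])
    fix \<sigma> assume "\<sigma> \<in> {\<sigma>. nc_matching n \<sigma>}"
    then interpret stacking n \<sigma> i by unfold_locales (use i in auto)
    show "?h (diagram_of n \<sigma>) = (if diagram_of n (contract (2 * n - i) \<sigma>) = D
       then loop_weight (2 * n - i) \<sigma> * f (diagram_of n \<sigma>) else 0)"
      unfolding stack_gen_diagram loops_gen_diagram joined_def p_def by (simp add: loop_weight_def)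
  qed
  finally show ?thesis .
qed

lemma word_diagram_Cons:
  "word_diagram n (i # ws) = basis_diagram (gen_diagram n i) \<otimes>\<^bsub>diagram_algebra n\<^esub> word_diagram n ws"
  by (simp add: word_diagram_def)

lemma word_diagram_diagram_of:
  assumes "set ws \<subseteq> {1..<n}" "nc_matching n \<tau>"
  shows "word_diagram n ws (diagram_of n \<tau>) = word_op n ws (delta (id_matching n)) \<tau>"
  using assms
proof (induction ws arbitrary: \<tau>)
  case Nil
  have "diagram_of n \<tau> = id_diagram n \<longleftrightarrow> \<tau> = id_matching n"
    unfolding id_diagram_eq using diagram_of_inj[OF Nil(2) nc_id_matching] by blast
  then show ?case by (simp add: word_diagram_def word_op_def diagram_algebra_def basis_diagram_def delta_def)
next
  case (Cons i ws)
  then have i: "i \<in> {1..<n}" by simp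
  have p: "n < 2 * n - i" "2 * n - i < 2 * n" using i by auto
  have "word_diagram n (i # ws) (diagram_of n \<tau>) =
      (\<Sum>\<sigma> | nc_matching n \<sigma>. if diagram_of n (contract (2 * n - i) \<sigma>) = diagram_of n \<tau>
       then loop_weight (2 * n - i) \<sigma> * word_diagram n ws (diagram_of n \<sigma>) else 0)"
    unfolding word_diagram_Cons by (rule diagram_mult_gen[OF i])
  also have "\<dots> = (\<Sum>\<sigma> | nc_matching n \<sigma>. if contract (2 * n - i) \<sigma> = \<tau>
       then loop_weight (2 * n - i) \<sigma> * word_op n ws (delta (id_matching n)) \<sigma> else 0)"
  proof (rule sum.cong[OF refl])
    fix \<sigma> assume "\<sigma> \<in> {\<sigma>. nc_matching n \<sigma>}"
    then have \<sigma>: "nc_matching n \<sigma>" by simp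
    have "diagram_of n (contract (2 * n - i) \<sigma>) = diagram_of n \<tau> \<longleftrightarrow> contract (2 * n - i) \<sigma> = \<tau>"
      using diagram_of_inj[OF nc_contract[OF \<sigma> p] Cons.prems(2)] by blast
    then show "(if diagram_of n (contract (2 * n - i) \<sigma>) = diagram_of n \<tau>
       then loop_weight (2 * n - i) \<sigma> * word_diagram n ws (diagram_of n \<sigma>) else 0) =
       (if contract (2 * n - i) \<sigma> = \<tau>
       then loop_weight (2 * n - i) \<sigma> * word_op n ws (delta (id_matching n)) \<sigma> else 0)"
      using Cons.IH[OF _ \<sigma>] Cons.prems by simp
  qed
  finally show ?case by (simp add: word_op_Cons gen_op_def push_def)
qed

text \<open>Expansions are functions on all sets of sets of points. Their equality, on which
  \<open>the_elem\<close> in \<open>diagram_expansion\<close> depends, also concerns arguments that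
  are not diagrams.\<close>

lemma word_diagram_outside:
  assumes "set ws \<subseteq> {1..<n}" "D \<notin> tl_diagrams n"
  shows "word_diagram n ws D = 0"
proof (cases ws)
  case Nil
  have "D \<noteq> id_diagram n"
    using assms(2) diagram_of_in_tl_diagrams[OF nc_id_matching] by (auto simp: id_diagram_eq)
  then show ?thesis using Nil by (simp add: word_diagram_def diagram_algebra_def basis_diagram_def)
next
  case (Cons i us)
  then have i: "i \<in> {1..<n}" using assms by simp
  have p: "n < 2 * n - i" "2 * n - i < 2 * n" using i by auto
  have "diagram_of n (contract (2 * n - i) \<sigma>) \<noteq> D" if "nc_matching n \<sigma>" for \<sigma>
    using diagram_of_in_tl_diagrams[OF nc_contract[OF that p]] assms(2) by blast
  then show ?thesis
    unfolding Cons word_diagram_Cons diagram_mult_gen[OF i] by (intro sum.neutral) auto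
qed

lemma free_expansion_diagram_of:
  assumes "x \<in> carrier (free_algebra n)" "nc_matching n \<tau>"
  shows "free_expansion n x (diagram_of n \<tau>) = act n x (delta (id_matching n)) \<tau>"
  unfolding free_expansion_def act_def
  using assms by (intro sum.cong refl) (simp add: free_algebra_def word_diagram_diagram_of)

lemma free_expansion_outside:
  assumes "x \<in> carrier (free_algebra n)" "D \<notin> tl_diagrams n"
  shows "free_expansion n x D = 0"
  unfolding free_expansion_def
  using assms by (intro sum.neutral ballI) (simp add: free_algebra_def word_diagram_outside)


section \<open>Calculating modulo the defining relations\<close>

text \<open>The coefficient of the empty word is a ring homomorphism to the scalars that kills the
  generators and the relators. It descends to the quotient, where it plays the part of the
  coefficient of the identity.\<close>

abbreviation aug :: "(gen_word \<Rightarrow>\<^sub>0 cq) \<Rightarrow> cq" where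
  "aug x \<equiv> Poly_Mapping.lookup x (Word [])"

lemma free_mult_eq_sum:
  fixes x y :: "gen_word \<Rightarrow>\<^sub>0 cq"
  shows "x * y = (\<Sum>u\<in>Poly_Mapping.keys x. \<Sum>v\<in>Poly_Mapping.keys y.
    Poly_Mapping.single (u + v) (Poly_Mapping.lookup x u * Poly_Mapping.lookup y v))"
  by (subst sum_single_keys[of x], subst sum_single_keys[of y]) (simp add: sum_product mult_single)

lemma aug_mult: "aug (x * y) = aug x * aug y"
proof -
  have "u + v = Word [] \<longleftrightarrow> u = Word [] \<and> v = Word []" for u v
    by (cases u; cases v) (simp add: plus_gen_word_def)
  then have "aug (x * y) = (\<Sum>u\<in>Poly_Mapping.keys x. \<Sum>v\<in>Poly_Mapping.keys y.
      if v = Word [] then (if u = Word [] then aug x * aug y else 0) else 0)"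
    unfolding free_mult_eq_sum lookup_sum
    by (intro sum.cong refl) (auto simp: lookup_single when_def)
  also have "\<dots> = aug x * aug y"
    by (cases "aug y = 0"; cases "aug x = 0") (simp_all add: in_keys_iff)
  finally show ?thesis .
qed

lemma aug_one: "aug 1 = 1"
  unfolding one_eq_single by (rule lookup_single_eq)

lemma aug_gen: "aug (free_gen i) = 0"
  by (simp add: free_gen_def lookup_single when_def)

lemma free_scalar_mult: "free_scalar a * free_scalar b = free_scalar (a * b)"
  by (simp add: free_scalar_def mult_single plus_gen_word_def)

lemma free_scalar_add: "free_scalar a + free_scalar b = free_scalar (a + b)"
  by (simp add: free_scalar_def single_add)

lemma free_scalar_0: "free_scalar 0 = 0"
  by (simp add: free_scalar_def)

lemma free_scalar_1: "free_scalar 1 = 1"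
  by (simp only: free_scalar_def one_eq_single)

lemma free_scalar_minus: "free_scalar (- a) = - free_scalar a"
  using free_scalar_add[of a "- a"] by (simp add: free_scalar_0 eq_neg_iff_add_eq_0 add.commute)

lemma free_scalar_comm: "x * free_scalar c = free_scalar c * x"
proof -
  have "Poly_Mapping.single w a * free_scalar c = free_scalar c * Poly_Mapping.single w a" for w a
    by (cases w) (simp add: free_scalar_def mult_single plus_gen_word_def mult.commute)
  then have "(\<Sum>w\<in>Poly_Mapping.keys x. Poly_Mapping.single w (Poly_Mapping.lookup x w)) * free_scalar c =
      free_scalar c * (\<Sum>w\<in>Poly_Mapping.keys x. Poly_Mapping.single w (Poly_Mapping.lookup x w))"
    by (simp add: sum_distrib_left sum_distrib_right)
  then show ?thesis unfolding sum_single_keys[symmetric] .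
qed

lemma free_scalar_left_comm: "x * (free_scalar c * y) = free_scalar c * (x * y)"
  by (metis free_scalar_comm mult.assoc)

lemma single_Word_Cons:
  "Poly_Mapping.single (Word (i # us)) c = free_gen i * Poly_Mapping.single (Word us) (c :: cq)"
  by (simp add: free_gen_def mult_single plus_gen_word_def)

lemma single_Word_snoc:
  "Poly_Mapping.single (Word (us @ [i])) c = Poly_Mapping.single (Word us) (c :: cq) * free_gen i"
  by (simp add: free_gen_def mult_single plus_gen_word_def)

section \<open>The ideal of relations and congruence modulo it\<close>

locale tl =
  fixes n :: nat
begin

abbreviation "R \<equiv> free_algebra n"
abbreviation "C \<equiv> carrier (free_algebra n)"
abbreviation "I \<equiv> tl_ideal n"

lemma C_single: "set us \<subseteq> {1..<n} \<Longrightarrow> Poly_Mapping.single (Word us) c \<in> C"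
  by (simp add: free_algebra_def)

lemma C_add: "x \<in> C \<Longrightarrow> y \<in> C \<Longrightarrow> x + y \<in> C"
  using Poly_Mapping.keys_add[of x y] by (auto simp: free_algebra_def)

lemma C_uminus: "x \<in> C \<Longrightarrow> - x \<in> C"
  by (simp add: free_algebra_def)

lemma C_diff: "x \<in> C \<Longrightarrow> y \<in> C \<Longrightarrow> x - y \<in> C"
  using C_add[of x "- y"] C_uminus by simp

lemma C_mult: "x \<in> C \<Longrightarrow> y \<in> C \<Longrightarrow> x * y \<in> C"
  using keys_mult[of x y] by (fastforce simp: free_algebra_def plus_gen_word_def)

lemma C_scalar: "free_scalar c \<in> C"
  unfolding free_scalar_def by (rule C_single) simp

lemma C_gen: "i \<in> {1..<n} \<Longrightarrow> free_gen i \<in> C"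
  unfolding free_gen_def by (rule C_single) simp

lemma C_0: "0 \<in> C" and C_1: "1 \<in> C"
  using C_scalar[of 0] C_scalar[of 1] by (simp_all add: free_scalar_0 free_scalar_1)

lemmas C_intros = C_add C_uminus C_diff C_mult C_scalar C_gen C_0 C_1

lemma R_ops: "x \<oplus>\<^bsub>R\<^esub> y = x + y" "x \<otimes>\<^bsub>R\<^esub> y = x * y" "\<zero>\<^bsub>R\<^esub> = 0" "\<one>\<^bsub>R\<^esub> = 1"
  by (simp_all add: free_algebra_def)

lemma ring_R: "ring R"
proof (rule ringI)
  show "abelian_group R"
    by (rule abelian_groupI) (auto simp: R_ops C_intros algebra_simps intro!: bexI[of _ "- _"])
  show "monoid R"
    by (rule monoidI) (auto simp: R_ops C_intros mult.assoc)
qed (simp_all add: R_ops algebra_simps)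

sublocale ring R by (rule ring_R)

lemma R_minus: "x \<in> C \<Longrightarrow> y \<in> C \<Longrightarrow> x \<ominus>\<^bsub>R\<^esub> y = x - y"
  using minus_equality[of "- y" y] by (simp add: a_minus_def R_ops C_intros)

lemma ideal_RI:
  assumes K: "K \<subseteq> C" "0 \<in> K" and add: "\<And>x y. x \<in> K \<Longrightarrow> y \<in> K \<Longrightarrow> x + y \<in> K"
    and l: "\<And>a x. x \<in> K \<Longrightarrow> a \<in> C \<Longrightarrow> a * x \<in> K" and r: "\<And>a x. x \<in> K \<Longrightarrow> a \<in> C \<Longrightarrow> x * a \<in> K"
  shows "ideal K R"
proof (rule idealI[OF ring_R])
  show "subgroup K (add_monoid R)"
  proof (rule subgroup.intro)
    fix x assume x: "x \<in> K"
    have "- x = free_scalar (- 1) * x" by (simp add: free_scalar_minus free_scalar_1)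
    then have "- x \<in> K" using l[OF x C_scalar] by simp
    moreover have "\<ominus>\<^bsub>R\<^esub> x = - x"
      using minus_equality[of "- x" x] x K(1) by (auto simp: R_ops C_intros)
    ultimately show "inv\<^bsub>add_monoid R\<^esub> x \<in> K" by (simp add: a_inv_def)
  qed (use K add in \<open>auto simp: R_ops\<close>)
qed (simp_all add: R_ops l r)

lemma relators_C: "tl_relators n \<subseteq> C"
  unfolding tl_relators_def by (auto intro!: C_intros)

lemma ideal_I: "ideal I R"
  unfolding tl_ideal_def by (rule genideal_ideal[OF relators_C])

sublocale I: ideal I R by (rule ideal_I)

lemma I_C: "x \<in> I \<Longrightarrow> x \<in> C"
  using I.a_subset by blast

lemma I_add: "x \<in> I \<Longrightarrow> y \<in> I \<Longrightarrow> x + y \<in> I"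
  using I.a_closed[of x y] by (simp add: R_ops)

lemma I_lmult: "x \<in> I \<Longrightarrow> a \<in> C \<Longrightarrow> a * x \<in> I"
  using I.I_l_closed[of x a] by (simp add: R_ops)

lemma I_rmult: "x \<in> I \<Longrightarrow> a \<in> C \<Longrightarrow> x * a \<in> I"
  using I.I_r_closed[of x a] by (simp add: R_ops)

lemma I_0: "0 \<in> I"
  using I.zero_closed by (simp add: R_ops)

lemma I_uminus: "x \<in> I \<Longrightarrow> - x \<in> I"
  using I_lmult[OF _ C_scalar, of x "- 1"] by (simp add: free_scalar_minus free_scalar_1)

lemma I_sum: "(\<And>x. x \<in> S \<Longrightarrow> g x \<in> I) \<Longrightarrow> sum g S \<in> I"
  by (induction S rule: infinite_finite_induct) (auto simp: I_0 I_add)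

lemma I_minimal:
  assumes "ideal K R" "tl_relators n \<subseteq> K" "x \<in> I"
  shows "x \<in> K"
  using genideal_minimal[OF assms(1,2)] assms(3) by (auto simp: tl_ideal_def)

text \<open>The kernel is an ideal containing the relators. Elements with nonzero constant term are
  thereby seen to be nonzero in the quotient.\<close>

lemma aug_I: "x \<in> I \<Longrightarrow> aug x = 0"
proof -
  assume x: "x \<in> I"
  have "ideal {x \<in> C. aug x = 0} R"
    by (rule ideal_RI) (auto simp: C_intros lookup_add aug_mult)
  moreover have "tl_relators n \<subseteq> {x \<in> C. aug x = 0}"
  proof
    fix r assume r: "r \<in> tl_relators n"
    then have "aug r = 0" unfolding tl_relators_def by (auto simp: lookup_minus aug_mult aug_gen)
    then show "r \<in> {x \<in> C. aug x = 0}" using r relators_C by blast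
  qed
  ultimately show ?thesis using I_minimal x by blast
qed

text \<open>The operators satisfy the defining relations, so the annihilator of the action is an
  ideal containing the relators. Hence the action descends to the quotient.\<close>

lemma act_I: "x \<in> I \<Longrightarrow> act n x F \<tau> = 0"
proof -
  assume x: "x \<in> I"
  let ?K = "{x \<in> C. \<forall>F \<tau>. act n x F \<tau> = 0}"
  have "ideal ?K R"
  proof (rule ideal_RI)
    fix a x assume x: "x \<in> ?K" and a: "a \<in> C"
    then have "act n x F = (\<lambda>_. 0)" for F by auto
    then show "a * x \<in> ?K" "x * a \<in> ?K" using x a by (auto simp: C_intros act_mult act_zero_fun)
  qed (auto simp: C_intros act_add act_0)
  moreover have "tl_relators n \<subseteq> ?K"
  proof
    fix r assume r: "r \<in> tl_relators n"
    then have "r \<in> C" using relators_C by blast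
    moreover have "act n r F \<tau> = 0" for F \<tau>
      using r unfolding tl_relators_def
      by (auto simp: act_diff act_mult act_gen act_scalar gen_op_square gen_op_adjacent gen_op_commute)
    ultimately show "r \<in> ?K" by blast
  qed
  ultimately show ?thesis using I_minimal x by blast
qed

text \<open>The underlying type contains words with arbitrary indices, so the congruence is confined
  to the carrier, where the ideal lives.\<close>

definition cg :: "(gen_word \<Rightarrow>\<^sub>0 cq) \<Rightarrow> (gen_word \<Rightarrow>\<^sub>0 cq) \<Rightarrow> bool" (infix "\<approx>" 50) where
  "x \<approx> y \<longleftrightarrow> x \<in> C \<and> y \<in> C \<and> x - y \<in> I"

lemma cg_refl: "x \<in> C \<Longrightarrow> x \<approx> x"
  by (simp add: cg_def I_0)

lemma cg_sym: "x \<approx> y \<Longrightarrow> y \<approx> x"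
  using I_uminus[of "x - y"] by (simp add: cg_def)

lemma cg_trans [trans]: "x \<approx> y \<Longrightarrow> y \<approx> z \<Longrightarrow> x \<approx> z"
  using I_add[of "x - y" "y - z"] by (simp add: cg_def)

lemma cg_add: "x \<approx> x' \<Longrightarrow> y \<approx> y' \<Longrightarrow> x + y \<approx> x' + y'"
  using I_add[of "x - x'" "y - y'"] by (simp add: cg_def C_intros algebra_simps)

lemma cg_lmult: "a \<in> C \<Longrightarrow> x \<approx> y \<Longrightarrow> a * x \<approx> a * y"
  using I_lmult[of "x - y" a] by (simp add: cg_def C_intros algebra_simps)

lemma cg_rmult: "a \<in> C \<Longrightarrow> x \<approx> y \<Longrightarrow> x * a \<approx> y * a"
  using I_rmult[of "x - y" a] by (simp add: cg_def C_intros algebra_simps)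

lemma cg_0_iff: "x \<approx> 0 \<longleftrightarrow> x \<in> I"
  using I_C by (auto simp: cg_def C_intros)

lemma relator_cg: "x - y \<in> tl_relators n \<Longrightarrow> x \<in> C \<Longrightarrow> y \<in> C \<Longrightarrow> x \<approx> y"
  using genideal_self[OF relators_C] by (auto simp: cg_def tl_ideal_def)

lemma gen_square:
  assumes "i \<in> {1..<n}"
  shows "free_gen i * free_gen i \<approx> free_scalar (- qint 2) * free_gen i"
proof (rule relator_cg)
  show "free_gen i * free_gen i - free_scalar (- qint 2) * free_gen i \<in> tl_relators n"
    unfolding tl_relators_def using assms by blast
qed (use assms in \<open>auto intro!: C_intros\<close>)

lemma gen_adjacent:
  assumes "i \<in> {1..<n}" "Suc i \<in> {1..<n}"
  shows "free_gen (Suc i) * free_gen i * free_gen (Suc i) \<approx> free_gen (Suc i)"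
proof (rule relator_cg)
  show "free_gen (Suc i) * free_gen i * free_gen (Suc i) - free_gen (Suc i) \<in> tl_relators n"
    unfolding tl_relators_def Suc_eq_plus1 using assms[unfolded Suc_eq_plus1] by blast
qed (use assms in \<open>auto intro!: C_intros\<close>)

lemma gen_commute:
  assumes "i \<in> {1..<n}" "j \<in> {1..<n}" "Suc i < j"
  shows "free_gen j * free_gen i \<approx> free_gen i * free_gen j"
proof (rule relator_cg)
  have "\<bar>int j - int i\<bar> > 1" using assms by auto
  then show "free_gen j * free_gen i - free_gen i * free_gen j \<in> tl_relators n"
    unfolding tl_relators_def using assms by blast
qed (use assms in \<open>auto intro!: C_intros\<close>)

text \<open>Every nonempty word ends with a generator, which kills \<open>P\<close>; only the
  constant term of \<open>x\<close> survives.\<close>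

lemma left_killed:
  assumes P: "P \<in> C" "\<And>i. i \<in> {1..<n} \<Longrightarrow> free_gen i * P \<approx> 0" and x: "x \<in> C"
  shows "x * P \<approx> free_scalar (aug x) * P"
proof -
  let ?s = "\<lambda>w. Poly_Mapping.single w (Poly_Mapping.lookup x w)"
  have *: "?s w * P \<in> I" if w: "w \<in> Poly_Mapping.keys x - {Word []}" for w
  proof -
    obtain us where us: "w = Word us" "us \<noteq> []" using w by (cases w) auto
    then obtain vs i where v: "us = vs @ [i]" by (cases us rule: rev_cases) auto
    have "set (letters w) \<subseteq> {1..<n}" using x w unfolding free_algebra_def by simp
    then have "set us \<subseteq> {1..<n}" using us by simp
    then have iC: "i \<in> {1..<n}" "Poly_Mapping.single (Word vs) (Poly_Mapping.lookup x w) \<in> C"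
      using v by (auto intro!: C_single[unfolded One_nat_def])
    then show ?thesis
      unfolding us(1) v single_Word_snoc mult.assoc
      using I_lmult[OF P(2)[OF iC(1), unfolded cg_0_iff] iC(2)] us v by simp
  qed
  have "x * P - free_scalar (aug x) * P = (\<Sum>w\<in>Poly_Mapping.keys x - {Word []}. ?s w * P)"
  proof (cases "Word [] \<in> Poly_Mapping.keys x")
    case True
    have "x * P = (\<Sum>w\<in>Poly_Mapping.keys x. ?s w * P)"
      by (subst sum_single_keys[of x]) (simp add: sum_distrib_right)
    also have "\<dots> = free_scalar (aug x) * P + (\<Sum>w\<in>Poly_Mapping.keys x - {Word []}. ?s w * P)"
      using sum.remove[OF finite_keys True, of "\<lambda>w. ?s w * P"] by (simp add: free_scalar_def)
    finally show ?thesis by simp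
  next
    case False
    then have "aug x = 0" by (simp add: in_keys_iff)
    moreover have "x * P = (\<Sum>w\<in>Poly_Mapping.keys x. ?s w * P)"
      by (subst sum_single_keys[of x]) (simp add: sum_distrib_right)
    ultimately show ?thesis using False by (simp add: free_scalar_0)
  qed
  then have "x * P - free_scalar (aug x) * P \<in> I" by (simp only:) (rule I_sum, rule *)
  then show ?thesis using P(1) x by (simp add: cg_def C_intros)
qed

lemma right_killed:
  assumes P: "P \<in> C" "\<And>i. i \<in> {1..<n} \<Longrightarrow> P * free_gen i \<approx> 0" and x: "x \<in> C"
  shows "P * x \<approx> free_scalar (aug x) * P"
proof -
  let ?s = "\<lambda>w. Poly_Mapping.single w (Poly_Mapping.lookup x w)"
  have *: "P * ?s w \<in> I" if w: "w \<in> Poly_Mapping.keys x - {Word []}" for w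
  proof -
    obtain us where us: "w = Word us" "us \<noteq> []" using w by (cases w) auto
    then obtain vs i where v: "us = i # vs" by (cases us) auto
    have "set (letters w) \<subseteq> {1..<n}" using x w unfolding free_algebra_def by simp
    then have "set us \<subseteq> {1..<n}" using us by simp
    then have iC: "i \<in> {1..<n}" "Poly_Mapping.single (Word vs) (Poly_Mapping.lookup x w) \<in> C"
      using v by (auto intro!: C_single[unfolded One_nat_def])
    then show ?thesis
      unfolding us(1) v single_Word_Cons mult.assoc[symmetric]
      using I_rmult[OF P(2)[OF iC(1), unfolded cg_0_iff] iC(2)] us v by simp
  qed
  have "P * x - free_scalar (aug x) * P = (\<Sum>w\<in>Poly_Mapping.keys x - {Word []}. P * ?s w)"
  proof (cases "Word [] \<in> Poly_Mapping.keys x")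
    case True
    have "P * x = (\<Sum>w\<in>Poly_Mapping.keys x. P * ?s w)"
      by (subst sum_single_keys[of x]) (simp add: sum_distrib_left)
    also have "\<dots> = free_scalar (aug x) * P + (\<Sum>w\<in>Poly_Mapping.keys x - {Word []}. P * ?s w)"
      using sum.remove[OF finite_keys True, of "\<lambda>w. P * ?s w"] free_scalar_comm[of P "aug x"]
      by (simp add: free_scalar_def)
    finally show ?thesis by simp
  next
    case False
    then have "aug x = 0" by (simp add: in_keys_iff)
    moreover have "P * x = (\<Sum>w\<in>Poly_Mapping.keys x. P * ?s w)"
      by (subst sum_single_keys[of x]) (simp add: sum_distrib_left)
    ultimately show ?thesis using False by (simp add: free_scalar_0)
  qed
  then have "P * x - free_scalar (aug x) * P \<in> I" by (simp only:) (rule I_sum, rule *)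
  then show ?thesis using P(1) x by (simp add: cg_def C_intros)
qed

text \<open>The same principle for the action: the last letter of a word is applied to
  \<open>F\<close> before the others.\<close>

lemma act_killed:
  assumes x: "x \<in> C" and F: "\<And>i. i \<in> {1..<n} \<Longrightarrow> gen_op n i F = (\<lambda>_. 0)"
  shows "act n x F \<tau> = aug x * F \<tau>"
proof -
  have z: "word_op n us (\<lambda>_. 0) \<sigma> = 0" for us \<sigma>
    using word_op_sum[of n us "\<lambda>_. 0" "\<lambda>_ _. 0" "{}::unit set" \<sigma>] by simp
  have *: "word_op n (letters w) F \<tau> = (if w = Word [] then F \<tau> else 0)" if w: "w \<in> Poly_Mapping.keys x" for w
  proof (cases "letters w" rule: rev_cases)
    case Nil
    then show ?thesis by (cases w) (auto simp: word_op_def)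
  next
    case (snoc us i)
    then have "i \<in> {1..<n}" using x w by (auto simp: free_algebra_def)
    then have "word_op n (letters w) F \<tau> = 0"
      unfolding snoc word_op_append using F z by (simp add: word_op_def)
    then show ?thesis using snoc by auto
  qed
  have "act n x F \<tau> = (\<Sum>w\<in>Poly_Mapping.keys x. if w = Word [] then aug x * F \<tau> else 0)"
    unfolding act_def by (intro sum.cong refl) (auto simp: *)
  then show ?thesis by (simp add: in_keys_iff)
qed

end


section \<open>The Jones--Wenzl projection\<close>

text \<open>Wenzl's recursion. The coefficient vanishes for \<open>m = 0\<close>, so the meaningless generator with
  index 0 does not contribute.\<close>

primrec wenzl :: "nat \<Rightarrow> (gen_word \<Rightarrow>\<^sub>0 cq)" where
  "wenzl 0 = 1"
| "wenzl (Suc m) = wenzl m +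
     free_scalar (qint (int m) / qint (int m + 1)) * (wenzl m * free_gen m * wenzl m)"

lemma wenzl_1: "wenzl (Suc 0) = 1"
  by (simp add: free_scalar_0)

lemma aug_wenzl: "aug (wenzl m) = 1"
  by (induction m) (simp_all add: aug_one lookup_add aug_mult aug_gen)

context tl
begin

text \<open>One step of the recursion for \<open>A = wenzl m\<close>,
  \<open>B = wenzl (m - 1)\<close> and the generator \<open>e\<close> of index \<open>m\<close>.
  Modulo the relations \<open>e * X\<close> is \<open>1 + c * d\<close> times \<open>e * A\<close>,
  which is why \<open>c * d = - 1\<close> is the right normalisation.\<close>

lemma wenzl_step:
  fixes A B e :: "gen_word \<Rightarrow>\<^sub>0 cq" and c d :: cq
  assumes C: "A \<in> C" "B \<in> C" "e \<in> C"
    and AA: "A * A \<approx> A" and BA: "B * A \<approx> A" and AB: "A * B \<approx> A"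
    and eAe: "e * A * e \<approx> free_scalar d * (B * e)" and eB: "e * B \<approx> B * e" and cd: "c * d = - 1"
  defines "X \<equiv> A + free_scalar c * (A * e * A)"
  shows "X \<in> C" "e * X \<approx> 0" "X * e \<approx> 0" "X * A \<approx> X" "A * X \<approx> X" "X * X \<approx> X"
proof -
  show XC: "X \<in> C" unfolding X_def by (intro C_intros C)
  have sd: "free_scalar c * (free_scalar d * y) = - y" for y
    by (simp add: mult.assoc[symmetric] free_scalar_mult cd free_scalar_minus free_scalar_1)
  have "e * X = e * A + free_scalar c * ((e * A * e) * A)"
    by (simp add: X_def distrib_left free_scalar_left_comm mult.assoc)
  also have "\<dots> \<approx> e * A + free_scalar c * (free_scalar d * (B * e) * A)"
    by (intro cg_add cg_refl cg_lmult cg_rmult eAe C_intros C)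
  also have "\<dots> = e * A + - (B * e * A)" by (simp add: mult.assoc[of "free_scalar d"] sd)
  also have "\<dots> \<approx> e * A + - (e * A)"
  proof (intro cg_add cg_refl C_intros C)
    have "B * e * A \<approx> e * B * A" by (intro cg_rmult cg_sym[OF eB] C)
    also have "\<dots> = e * (B * A)" by (rule mult.assoc)
    also have "\<dots> \<approx> e * A" by (intro cg_lmult BA C)
    finally have "free_scalar (- 1) * (B * e * A) \<approx> free_scalar (- 1) * (e * A)" by (intro cg_lmult C_intros)
    then show "- (B * e * A) \<approx> - (e * A)" by (simp add: free_scalar_minus free_scalar_1)
  qed
  finally show eX: "e * X \<approx> 0" by simp
  have "X * e = A * e + free_scalar c * (A * (e * A * e))"
    by (simp add: X_def distrib_right mult.assoc)
  also have "\<dots> \<approx> A * e + free_scalar c * (A * (free_scalar d * (B * e)))"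
    by (intro cg_add cg_refl cg_lmult cg_rmult eAe C_intros C)
  also have "\<dots> = A * e + - (A * B * e)" by (simp add: free_scalar_left_comm[of A d] sd mult.assoc)
  also have "\<dots> \<approx> A * e + - (A * e)"
  proof (intro cg_add cg_refl C_intros C)
    have "A * B * e \<approx> A * e" by (intro cg_rmult AB C)
    then have "free_scalar (- 1) * (A * B * e) \<approx> free_scalar (- 1) * (A * e)" by (intro cg_lmult C_intros)
    then show "- (A * B * e) \<approx> - (A * e)" by (simp add: free_scalar_minus free_scalar_1)
  qed
  finally show Xe: "X * e \<approx> 0" by simp
  have "X * A = A * A + free_scalar c * (A * e * (A * A))"
    by (simp add: X_def distrib_right mult.assoc)
  also have "\<dots> \<approx> X" unfolding X_def by (intro cg_add cg_lmult AA C_intros C)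
  finally show XA: "X * A \<approx> X" .
  have "A * X = A * A + free_scalar c * (A * A * e * A)"
    by (simp add: X_def distrib_left free_scalar_left_comm mult.assoc)
  also have "\<dots> \<approx> X" unfolding X_def by (intro cg_add cg_lmult cg_rmult AA C_intros C)
  finally show "A * X \<approx> X" .
  have "X * X = X * (A + free_scalar c * (A * e * A))" by (simp only: X_def)
  also have "\<dots> = X * A + free_scalar c * (X * A * (e * A))"
    by (simp add: distrib_left free_scalar_left_comm mult.assoc)
  also have "\<dots> \<approx> X + free_scalar c * (X * (e * A))"
    by (intro cg_add cg_lmult cg_rmult XA C_intros C)
  also have "\<dots> = X + free_scalar c * (X * e * A)" by (simp add: mult.assoc)
  also have "\<dots> \<approx> X + free_scalar c * (0 * A)"
    by (intro cg_add cg_lmult cg_rmult cg_refl Xe C_intros C XC)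
  finally show "X * X \<approx> X" by simp
qed

text \<open>The induction has to carry the previous element along: sandwiching
  \<open>wenzl m\<close> between two copies of the next generator gives a multiple of
  \<open>wenzl (m - 1)\<close> times that generator, and this is absorbed only because the two
  elements absorb each other and the generator commutes with the earlier one.\<close>

lemma wenzl_props:
  assumes "1 \<le> m" "m \<le> n"
  shows "wenzl m \<in> C \<and> wenzl (m - 1) \<in> C \<and> wenzl m * wenzl m \<approx> wenzl m \<and>
    wenzl (m - 1) * wenzl m \<approx> wenzl m \<and> wenzl m * wenzl (m - 1) \<approx> wenzl m \<and>
    (\<forall>i\<in>{1..<m}. free_gen i * wenzl m \<approx> 0 \<and> wenzl m * free_gen i \<approx> 0) \<and>
    (\<forall>j\<in>{1..<n}. m < j \<longrightarrow> free_gen j * wenzl m \<approx> wenzl m * free_gen j) \<and>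
    (\<forall>j\<in>{1..<n}. m - 1 < j \<longrightarrow> free_gen j * wenzl (m - 1) \<approx> wenzl (m - 1) * free_gen j) \<and>
    (m < n \<longrightarrow> free_gen m * wenzl m * free_gen m \<approx>
      free_scalar (- (qint (int m + 1) / qint (int m))) * (wenzl (m - 1) * free_gen m))"
  using assms
proof (induction m rule: dec_induct)
  case base
  \<comment> \<open>For \<open>m = 1\<close> both elements are 1, and the last clause is the square
    relation because \<open>[2] / [1] = [2]\<close>.\<close>
  have "free_gen 1 * free_gen 1 \<approx> free_scalar (- qint 2) * free_gen 1" if "1 < n"
    using gen_square that by auto
  then show ?case by (auto simp: wenzl_1 free_scalar_0 intro!: cg_refl C_intros)
next
  case (step m)
  let ?A = "wenzl m" and ?B = "wenzl (m - 1)" and ?e = "free_gen m" and ?f = "free_gen (Suc m)"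
  let ?c = "qint (int m) / qint (int m + 1)" and ?d = "- (qint (int m + 1) / qint (int m))"
  let ?X = "wenzl (Suc m)"
  have m: "1 \<le> m" "m < n" "m \<in> {1..<n}" using step by auto
  have q: "qint (int m) \<noteq> 0" "qint (int m + 1) \<noteq> 0" using m by (auto intro!: qint_nonzero)
  have C: "?A \<in> C" "?B \<in> C" "?e \<in> C" and AA: "?A * ?A \<approx> ?A" and BA: "?B * ?A \<approx> ?A" and AB: "?A * ?B \<approx> ?A"
    and kill: "\<And>i. i \<in> {1..<m} \<Longrightarrow> free_gen i * ?A \<approx> 0 \<and> ?A * free_gen i \<approx> 0"
    and comA: "\<And>j. j \<in> {1..<n} \<Longrightarrow> m < j \<Longrightarrow> free_gen j * ?A \<approx> ?A * free_gen j"
    and eB: "?e * ?B \<approx> ?B * ?e" and eAe: "?e * ?A * ?e \<approx> free_scalar ?d * (?B * ?e)"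
    using step.IH m by (auto intro: C_gen)
  have X: "?X = ?A + free_scalar ?c * (?A * ?e * ?A)" by simp
  have cd: "?c * ?d = - 1" using q by simp
  note S = wenzl_step[OF C AA BA AB eAe eB cd, folded X]
  have killX: "free_gen i * ?X \<approx> 0 \<and> ?X * free_gen i \<approx> 0" if i: "i \<in> {1..<Suc m}" for i
  proof (cases "i = m")
    case False
    then have i': "i \<in> {1..<m}" and iC: "free_gen i \<in> C" using i m by (auto intro!: C_gen)
    have "free_gen i * ?X = free_gen i * ?A + free_scalar ?c * (free_gen i * ?A * (?e * ?A))"
      by (simp add: distrib_left free_scalar_left_comm mult.assoc)
    also have "\<dots> \<approx> 0 + free_scalar ?c * (0 * (?e * ?A))"
      using kill[OF i'] by (intro cg_add cg_lmult cg_rmult C_intros C) auto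
    finally have 1: "free_gen i * ?X \<approx> 0" by simp
    have "?X * free_gen i = ?A * free_gen i + free_scalar ?c * (?A * ?e * (?A * free_gen i))"
      by (simp add: distrib_right mult.assoc)
    also have "\<dots> \<approx> 0 + free_scalar ?c * (?A * ?e * 0)"
      using kill[OF i'] by (intro cg_add cg_lmult cg_rmult C_intros C) auto
    finally show ?thesis using 1 by simp
  qed (use S in simp)
  have comX: "free_gen j * ?X \<approx> ?X * free_gen j" if j: "j \<in> {1..<n}" "Suc m < j" for j
  proof -
    have jC: "free_gen j \<in> C" using j by (intro C_gen)
    have jA: "free_gen j * ?A \<approx> ?A * free_gen j" using comA j by simp
    have je: "free_gen j * ?e \<approx> ?e * free_gen j" using gen_commute[OF m(3) j] .
    have "free_gen j * (?A * ?e * ?A) = free_gen j * ?A * (?e * ?A)" by (simp add: mult.assoc)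
    also have "\<dots> \<approx> ?A * free_gen j * (?e * ?A)" by (intro cg_rmult jA C_intros C)
    also have "\<dots> = ?A * (free_gen j * ?e) * ?A" by (simp add: mult.assoc)
    also have "\<dots> \<approx> ?A * (?e * free_gen j) * ?A" by (intro cg_rmult cg_lmult je C)
    also have "\<dots> = ?A * ?e * (free_gen j * ?A)" by (simp add: mult.assoc)
    also have "\<dots> \<approx> ?A * ?e * (?A * free_gen j)" by (intro cg_lmult jA C_intros C)
    finally have t: "free_gen j * (?A * ?e * ?A) \<approx> ?A * ?e * ?A * free_gen j" by (simp add: mult.assoc)
    have "free_gen j * ?X = free_gen j * ?A + free_scalar ?c * (free_gen j * (?A * ?e * ?A))"
      by (simp add: distrib_left free_scalar_left_comm)
    also have "\<dots> \<approx> ?A * free_gen j + free_scalar ?c * (?A * ?e * ?A * free_gen j)"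
      by (intro cg_add cg_lmult jA t C_intros)
    also have "\<dots> = ?X * free_gen j" by (simp add: distrib_right mult.assoc)
    finally show ?thesis .
  qed
  have fXf: "?f * ?X * ?f \<approx> free_scalar (- (qint (int (Suc m) + 1) / qint (int (Suc m)))) * (?A * ?f)"
    if "Suc m < n"
  proof -
    have f: "Suc m \<in> {1..<n}" and fC: "?f \<in> C" using that by (auto intro: C_gen)
    have fA: "?f * ?A \<approx> ?A * ?f" using comA f by simp
    have fef: "?f * ?e * ?f \<approx> ?f" using gen_adjacent[OF m(3) f] .
    have "?f * ?A * ?f \<approx> ?A * ?f * ?f" by (intro cg_rmult fA fC)
    also have "\<dots> = ?A * (?f * ?f)" by (rule mult.assoc)
    also have "\<dots> \<approx> ?A * (free_scalar (- qint 2) * ?f)" by (intro cg_lmult gen_square f C)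
    also have "\<dots> = free_scalar (- qint 2) * (?A * ?f)" by (rule free_scalar_left_comm)
    finally have 1: "?f * ?A * ?f \<approx> free_scalar (- qint 2) * (?A * ?f)" .
    have "?f * (?A * ?e * ?A) * ?f = ?f * ?A * (?e * (?A * ?f))" by (simp add: mult.assoc)
    also have "\<dots> \<approx> ?A * ?f * (?e * (?A * ?f))" by (intro cg_rmult fA C_intros C fC)
    also have "\<dots> \<approx> ?A * ?f * (?e * (?f * ?A))" by (intro cg_lmult cg_sym[OF fA] C_intros C fC)
    also have "\<dots> = ?A * (?f * ?e * ?f) * ?A" by (simp add: mult.assoc)
    also have "\<dots> \<approx> ?A * ?f * ?A" by (intro cg_rmult cg_lmult fef C)
    also have "\<dots> = ?A * (?f * ?A)" by (rule mult.assoc)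
    also have "\<dots> \<approx> ?A * (?A * ?f)" by (intro cg_lmult fA C)
    also have "\<dots> = ?A * ?A * ?f" by (rule mult.assoc[symmetric])
    also have "\<dots> \<approx> ?A * ?f" by (intro cg_rmult AA fC)
    finally have 2: "?f * (?A * ?e * ?A) * ?f \<approx> ?A * ?f" .
    have "?f * ?X * ?f = ?f * ?A * ?f + free_scalar ?c * (?f * (?A * ?e * ?A) * ?f)"
      by (simp add: distrib_left distrib_right free_scalar_left_comm mult.assoc)
    also have "\<dots> \<approx> free_scalar (- qint 2) * (?A * ?f) + free_scalar ?c * (?A * ?f)"
      by (intro cg_add cg_lmult 1 2 C_intros)
    also have "\<dots> = free_scalar (- qint 2 + ?c) * (?A * ?f)"
      by (simp only: free_scalar_add[symmetric] distrib_right)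
    \<comment> \<open>The square relation contributes \<open>- [2]\<close> and the correction term
      of the recursion contributes \<open>[m] / [m+1]\<close>; they combine by
      \<open>[2][m+1] = [m+2] + [m]\<close>.\<close>
    also have "- qint 2 + ?c = - (qint (int (Suc m) + 1) / qint (int (Suc m)))"
    proof -
      have "qint 2 * qint (int m + 1) = qint (int m + 2) + qint (int m)"
        using qint_2_mult[of "int m + 1"] by (simp add: add.assoc)
      then have "qint 2 = (qint (int m + 2) + qint (int m)) / qint (int m + 1)"
        using q by (simp add: nonzero_eq_divide_eq)
      then show ?thesis by (simp add: add_divide_distrib add.commute)
    qed
    finally show ?thesis .
  qed
  have comA': "free_gen j * ?A \<approx> ?A * free_gen j" if "j \<in> {1..<n}" "Suc m - 1 < j" for j
    using comA that by simp
  have e: "Suc m - 1 = m" by simp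
  show ?case
    unfolding e using S(1,4,5,6) C(1) killX comX fXf comA by blast
qed

section \<open>Passage to the quotient algebra\<close>

lemma coset_eq_iff: "x \<in> C \<Longrightarrow> y \<in> C \<Longrightarrow> I +>\<^bsub>R\<^esub> x = I +>\<^bsub>R\<^esub> y \<longleftrightarrow> x \<approx> y"
  using quotient_eq_iff_same_a_r_cos[OF ideal_I, of x y] R_minus[of x y] by (simp add: cg_def)

lemma coset_zero: "\<zero>\<^bsub>tl_algebra n\<^esub> = I +>\<^bsub>R\<^esub> 0"
  using a_rcos_zero[OF ideal_I I_0] by (simp add: tl_algebra_def FactRing_def)

lemma coset_mult:
  "x \<in> C \<Longrightarrow> y \<in> C \<Longrightarrow> (I +>\<^bsub>R\<^esub> x) \<otimes>\<^bsub>tl_algebra n\<^esub> (I +>\<^bsub>R\<^esub> y) = I +>\<^bsub>R\<^esub> (x * y)"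
  using I.rcoset_mult_add[of x y] by (simp add: tl_algebra_def FactRing_def R_ops)

lemma is_jones_wenzl_coset:
  assumes x: "x \<in> C"
  shows "is_jones_wenzl n (I +>\<^bsub>R\<^esub> x) \<longleftrightarrow> \<not> x \<approx> 0 \<and> x * x \<approx> x \<and>
    (\<forall>i\<in>{1..<n}. free_gen i * x \<approx> 0 \<and> x * free_gen i \<approx> 0)"
proof -
  have "I +>\<^bsub>R\<^esub> x \<in> carrier (tl_algebra n)"
    using x by (auto simp: tl_algebra_def FactRing_def A_RCOSETS_def')
  moreover have "tl_gen n i \<otimes>\<^bsub>tl_algebra n\<^esub> (I +>\<^bsub>R\<^esub> x) = \<zero>\<^bsub>tl_algebra n\<^esub> \<longleftrightarrow> free_gen i * x \<approx> 0"
    "(I +>\<^bsub>R\<^esub> x) \<otimes>\<^bsub>tl_algebra n\<^esub> tl_gen n i = \<zero>\<^bsub>tl_algebra n\<^esub> \<longleftrightarrow> x * free_gen i \<approx> 0"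
    if "i \<in> {1..<n}" for i
    unfolding tl_gen_def coset_zero using x C_gen[OF that] by (simp_all add: coset_mult coset_eq_iff C_intros)
  moreover have "I +>\<^bsub>R\<^esub> x = \<zero>\<^bsub>tl_algebra n\<^esub> \<longleftrightarrow> x \<approx> 0"
    unfolding coset_zero using x by (simp add: coset_eq_iff C_intros)
  moreover have "(I +>\<^bsub>R\<^esub> x) \<otimes>\<^bsub>tl_algebra n\<^esub> (I +>\<^bsub>R\<^esub> x) = I +>\<^bsub>R\<^esub> x \<longleftrightarrow> x * x \<approx> x"
    using x by (simp add: coset_mult coset_eq_iff C_intros)
  ultimately show ?thesis unfolding is_jones_wenzl_def by simp
qed

lemma not_cg_0: "aug x \<noteq> 0 \<Longrightarrow> \<not> x \<approx> 0"
  using aug_I by (auto simp: cg_0_iff)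

text \<open>Two elements killed on both sides and with constant term 1 absorb each other, so their
  product equals each of them. It remains to see that idempotence and nonvanishing force the
  constant term 1.\<close>

lemma jones_wenzl_eq:
  assumes "1 \<le> n"
  shows "jones_wenzl n = I +>\<^bsub>R\<^esub> wenzl n"
  unfolding jones_wenzl_def
proof (rule the_equality)
  let ?P = "wenzl n"
  have P: "?P \<in> C" "?P * ?P \<approx> ?P" "\<And>i. i \<in> {1..<n} \<Longrightarrow> free_gen i * ?P \<approx> 0"
    "\<And>i. i \<in> {1..<n} \<Longrightarrow> ?P * free_gen i \<approx> 0"
    using wenzl_props[OF assms order_refl] by blast+
  show "is_jones_wenzl n (I +>\<^bsub>R\<^esub> ?P)"
    unfolding is_jones_wenzl_coset[OF P(1)] using P not_cg_0 by (simp add: aug_wenzl)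
  fix X assume X: "is_jones_wenzl n X"
  then obtain Q where Q: "Q \<in> C" "X = I +>\<^bsub>R\<^esub> Q"
    unfolding is_jones_wenzl_def by (auto simp: tl_algebra_def FactRing_def A_RCOSETS_def')
  have QQ: "\<not> Q \<approx> 0" "Q * Q \<approx> Q" "\<And>i. i \<in> {1..<n} \<Longrightarrow> free_gen i * Q \<approx> 0"
    "\<And>i. i \<in> {1..<n} \<Longrightarrow> Q * free_gen i \<approx> 0"
    using X unfolding Q(2) is_jones_wenzl_coset[OF Q(1)] by blast+
  \<comment> \<open>Since \<open>Q\<close> is killed by the generators, idempotence reads
    \<open>Q = aug Q * Q\<close>; any scalar other than 1 would give \<open>Q = 0\<close>.\<close>
  have "aug Q = 1"
  proof (rule ccontr)
    assume ne: "aug Q \<noteq> 1"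
    have "Q \<approx> free_scalar (aug Q) * Q"
      using cg_trans[OF cg_sym[OF QQ(2)] left_killed[OF Q(1) QQ(3) Q(1)]] by blast
    then have "Q - free_scalar (aug Q) * Q \<in> I" by (simp add: cg_def)
    moreover have "free_scalar (1 - aug Q) = 1 - free_scalar (aug Q)"
      using free_scalar_add[of 1 "- aug Q"] by (simp add: free_scalar_1 free_scalar_minus)
    then have "Q - free_scalar (aug Q) * Q = free_scalar (1 - aug Q) * Q"
      by (simp add: left_diff_distrib)
    ultimately have "free_scalar (1 - aug Q) * Q \<in> I" by simp
    then have "free_scalar (1 / (1 - aug Q)) * (free_scalar (1 - aug Q) * Q) \<in> I"
      by (rule I_lmult[OF _ C_scalar])
    then have "Q \<in> I" using ne by (simp add: mult.assoc[symmetric] free_scalar_mult free_scalar_1)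
    then show False using QQ(1) by (simp add: cg_0_iff)
  qed
  then have "Q * ?P \<approx> ?P"
    using left_killed[OF P(1,3) Q(1)] by (simp add: free_scalar_1)
  moreover have "Q * ?P \<approx> Q"
    using right_killed[OF Q(1) QQ(4) P(1)] by (simp add: aug_wenzl free_scalar_1)
  ultimately have "Q \<approx> ?P" using cg_sym cg_trans by blast
  then show "X = I +>\<^bsub>R\<^esub> ?P" unfolding Q(2) using coset_eq_iff Q(1) P(1) by blast
qed

text \<open>All representatives of a coset have the same expansion because the ideal acts as zero,
  so the image of the coset is a singleton.\<close>

lemma diagram_expansion_coset:
  assumes P: "P \<in> C"
  shows "diagram_expansion n (I +>\<^bsub>R\<^esub> P) = free_expansion n P"
proof -
  have "free_expansion n (h + P) D = free_expansion n P D" if h: "h \<in> I" for h D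
  proof (cases "D \<in> tl_diagrams n")
    case True
    then obtain \<tau> where "nc_matching n \<tau>" "D = diagram_of n \<tau>" by (rule diagram_of_surj)
    then show ?thesis
      using P I_C[OF h] by (simp add: free_expansion_diagram_of C_add act_add act_I[OF h])
  next
    case False
    then show ?thesis using P I_C[OF h] by (simp add: free_expansion_outside C_add)
  qed
  then have "free_expansion n (h + P) = free_expansion n P" if "h \<in> I" for h using that by blast
  moreover have "I +>\<^bsub>R\<^esub> P = (\<lambda>h. h + P) ` I" by (auto simp: a_r_coset_def' R_ops)
  ultimately have "free_expansion n ` (I +>\<^bsub>R\<^esub> P) = {free_expansion n P}"
    using I_0 by (auto simp: image_image)
  then show ?thesis by (simp add: diagram_expansion_def)
qed

text \<open>The projection fixes every combination killed by the generators and kills every diagram other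
  than the identity, so its expansion is the normalised such combination.\<close>

lemma act_wenzl_delta:
  assumes n: "1 \<le> n" and \<rho>: "nc_matching n \<rho>" "\<rho> \<noteq> id_matching n"
  shows "act n (wenzl n) (delta \<rho>) \<tau> = 0"
proof -
  obtain i where i: "i \<in> {1..<n}" "\<rho> (2 * n - i) = Suc (2 * n - i)" using top_cup_exists[OF \<rho>] .
  have "wenzl n * free_gen i \<in> I"
    using wenzl_props[OF n order_refl] i(1) by (auto simp: cg_0_iff)
  then have "0 = act n (wenzl n) (gen_op n i (delta \<rho>)) \<tau>"
    using act_I[of "wenzl n * free_gen i" "delta \<rho>" \<tau>] by (simp add: act_mult act_gen)
  also have "gen_op n i (delta \<rho>) = (\<lambda>\<sigma>. - qint 2 * delta \<rho> \<sigma>)"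
    by (rule ext) (rule gen_op_delta[OF i(1) \<rho>(1) i(2)])
  finally have "- qint 2 * act n (wenzl n) (delta \<rho>) \<tau> = 0" by (simp only: act_scale)
  then show ?thesis using qint_nonzero[of 2] by simp
qed

lemma wenzl_expansion:
  assumes n: "1 \<le> n" and F: "\<And>i. i \<in> {1..<n} \<Longrightarrow> gen_op n i F = (\<lambda>_. 0)" and F1: "F (id_matching n) = 1"
    and out: "\<And>\<sigma>. \<not> nc_matching n \<sigma> \<Longrightarrow> F \<sigma> = 0"
  shows "act n (wenzl n) (delta (id_matching n)) \<tau> = F \<tau>"
proof -
  have C: "wenzl n \<in> C" using wenzl_props[OF n order_refl] by blast
  have Fd: "F = (\<lambda>\<sigma>. \<Sum>\<rho> | nc_matching n \<rho>. F \<rho> * delta \<rho> \<sigma>)"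
  proof
    fix \<sigma>
    show "F \<sigma> = (\<Sum>\<rho> | nc_matching n \<rho>. F \<rho> * delta \<rho> \<sigma>)"
    proof (cases "nc_matching n \<sigma>")
      case False
      then have "(\<Sum>\<rho> | nc_matching n \<rho>. F \<rho> * delta \<rho> \<sigma>) = 0"
        by (intro sum.neutral) (auto simp: delta_def)
      then show ?thesis using out[OF False] by simp
    qed (simp add: sum_delta)
  qed
  have "F \<tau> = act n (wenzl n) F \<tau>"
    using act_killed[OF C F] by (simp add: aug_wenzl)
  also have "\<dots> = (\<Sum>\<rho> | nc_matching n \<rho>. F \<rho> * act n (wenzl n) (delta \<rho>) \<tau>)"
    by (subst Fd) (rule act_linear)
  also have "\<dots> = (\<Sum>\<rho>\<in>{id_matching n}. F \<rho> * act n (wenzl n) (delta \<rho>) \<tau>)"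
    using nc_id_matching act_wenzl_delta[OF n] finite_nc_matchings[of n]
    by (intro sum.mono_neutral_right) auto
  finally show ?thesis using F1 by simp
qed

end

lemma jw_coeff_diagram_of:
  assumes n: "1 \<le> n" and \<tau>: "nc_matching n \<tau>"
  shows "jw_coeff n (diagram_of n \<tau>) = tiling_sum (matching_path n \<tau>)"
proof -
  interpret tl n .
  \<comment> \<open>Extension by zero outside the matchings makes this function a combination of the
    functions \<open>delta\<close>, as \<open>wenzl_expansion\<close> requires.\<close>
  define F where "F = (\<lambda>\<sigma>. if nc_matching n \<sigma> then total_weight n * label_sum n \<sigma> else 0)"
  have F: "F \<sigma> = tiling_sum (matching_path n \<sigma>)" if "nc_matching n \<sigma>" for \<sigma>
    using matching.tiling_sum_eq_label_sum[OF matching.intro[OF that]] that by (simp add: F_def)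
  have "gen_op n i F = (\<lambda>_. 0)" if "i \<in> {1..<n}" for i
  proof
    fix \<sigma>
    have "gen_op n i F \<sigma> = gen_op n i (\<lambda>\<sigma>. total_weight n * label_sum n \<sigma>) \<sigma>"
      unfolding gen_op_def push_def F_def by (intro sum.cong) auto
    then show "gen_op n i F \<sigma> = 0" using gen_op_label_sum[OF that] by simp
  qed
  moreover have "F (id_matching n) = 1"
    using F[OF nc_id_matching] by (simp add: matching_path_id tiling_sum_top_path)
  moreover have "F \<sigma> = 0" if "\<not> nc_matching n \<sigma>" for \<sigma> using that by (simp add: F_def)
  ultimately have "act n (wenzl n) (delta (id_matching n)) \<tau> = F \<tau>" by (rule wenzl_expansion[OF n])
  moreover have "wenzl n \<in> carrier (free_algebra n)" using wenzl_props[OF n order_refl] by blast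
  ultimately show ?thesis
    unfolding jw_coeff_def jones_wenzl_eq[OF n]
    using F[OF \<tau>] \<tau> by (simp add: diagram_expansion_coset free_expansion_diagram_of)
qed

theorem theorem3p4:
  fixes n :: nat and D :: diagram and \<mu> :: "step list"
  assumes "n \<ge> 1"
    and "D \<in> tl_diagrams n"
    and "\<mu> \<in> dyck_paths n"
    and "\<mu> = folded_path n D"
  shows "jw_coeff n D =
    (\<Sum>TT\<in>cover_inclusive_tilings \<mu>. \<Prod>d\<in>TT. qint (tile_height d) / qint (tile_height d + 1))"
  proof -
  obtain \<tau> where \<tau>: "nc_matching n \<tau>" "D = diagram_of n \<tau>"
    using assms(2) by (rule diagram_of_surj)
  then have "jw_coeff n D = tiling_sum \<mu>"
    using jw_coeff_diagram_of[OF assms(1)] assms(4) by (simp add: folded_path_diagram_of)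
  then show ?thesis by (simp only: tiling_sum_def)
qed

end
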